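(* Let $B=B_q(\mathfrak g)$ be the $q$-boson Kashiwara algebra of a symmetrizable Kac--Moody algebra $\mathfrak g$, let $B^-$ be the subalgebra of $B$ generated by the $f_i$ ($i\in I$), let $\mathcal O(B)$ be the category of $B$-modules described in the context, and for $\lambda\in P$ let $H(\lambda)=B/I_\lambda$, where $I_\lambda=\sum_i Be''_i+\sum_{h\in P^*}B(q^h-q^{\langle h,\lambda\rangle})$. (i) The category $\mathcal O(B)$ is semi-simple. (ii) For every $\lambda\in P$, the module $H(\lambda)$ is a simple object of $\mathcal O(B)$, and for any simple object $M$ of $\mathcal O(B)$ there exists some $\lambda\in P$ such that $M\cong H(\lambda)$. Furthermore, $H(\lambda)$ is a free $B^-$-module of rank one.
   Context: Cartan data. $\mathfrak g$ is a symmetrizable Kac--Moody algebra over $\mathbf Q$ with Cartan subalgebra $\mathfrak t$, finite index set $I$, simple roots $\alpha_i\in\mathfrak t^*$, coroots $h_i\in\mathfrak t$, and an inner product on $\mathfrak t^*$ with $(\alpha_i,\alpha_i)\in 2\mathbf Z_{>0}$ and $\langle h_i,\lambda\rangle=2(\alpha_i,\lambda)/(\alpha_i,\alpha_i)$ for $\lambda\in\mathfrak t^*$. $P\subset\mathfrak t^*$ is a lattice (free $\mathbf Z$-submodule with $\mathbf Q\otimes_{\mathbf Z}P\cong\mathfrak t^*$) containing all $\alpha_i$, and $P^*=\{h\in\mathfrak t:\langle h,P\rangle\subset\mathbf Z\}$ contains all $h_i$. $q$ is transcendental over $\mathbf Q$; $q_i=q^{(\alpha_i,\alpha_i)/2}$,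 $[n]_i=(q_i^n-q_i^{-n})/(q_i-q_i^{-1})$, $[n]_i!=\prod_{k=1}^n[k]_i$, $X_i^{(n)}=X_i^n/[n]_i!$. The algebra $B=B_q(\mathfrak g)$. It is the associative $\mathbf Q(q)$-algebra generated by $e''_i,f_i$ ($i\in I$), $q^h$ ($h\in P^*$) with relations: $q^0=1$, $q^hq^{h'}=q^{h+h'}$; $q^he''_iq^{-h}=q^{\langle h,\alpha_i\rangle}e''_i$; $q^hf_iq^{-h}=q^{-\langle h,\alpha_i\rangle}f_i$; $e''_if_j=q_i^{\langle h_i,\alpha_j\rangle}f_je''_i+\delta_{i,j}$; and the $q$-Serre relations $\sum_{k=0}^{1-\langle h_i,\alpha_j\rangle}(-1)^kX_i^{(k)}X_jX_i^{(1-\langle h_i,\alpha_j\rangle-k)}=0$ ($i\ne j$) for $X_i=e''_i$ and for $X_i=f_i$. The category $\mathcal O(B)$. Its objects are the left $B$-modules $M$ such that (1) $M=\oplus_{\lambda\in P}M_\lambda$ with $M_\lambda=\{u\in M: q^hu=q^{\langle h,\lambda\rangle}u\text{ for all }h\in P^*\}$; (2) for every $u\in M$ there is $l>0$ such that $e''_{i_1}e''_{i_2}\cdots e''_{i_l}u=0$ for all $i_1,\dots,i_l\in I$. Morphisms are $B$-module homomorphisms. Semi-simple means: for all objects $L\subset M$ of $\mathcal O(B)$ ($L$ a submodule) there is a submodule $N\subset M$ with $M=L\oplus N$. *)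

theory Defs
  imports
    "HOL-Library.Poly_Mapping"
    "HOL-Library.Function_Algebras"
    "HOL-Computational_Algebra.Polynomial"
    "HOL-Computational_Algebra.Fraction_Field"
    "HOL-Algebra.QuotRing"
    "HOL-Algebra.Module"
    "HOL-Algebra.Generated_Rings"
begin

section \<open>Left modules over a not necessarily commutative ring\<close>

text \<open>The library locale for modules requires a commutative ring of scalars. We reuse its
  record type (whose fields \<^term>\<open>mult\<close> and \<^term>\<open>one\<close> are irrelevant for modules) and its
  notion of submodule.\<close>

locale left_module = R?: ring R + M?: abelian_group M
  for R :: "('a, 'r) ring_scheme" (structure) and M :: "('a, 'm, 's) module_scheme" (structure) +
  assumes smult_closed:
      "\<lbrakk> a \<in> carrier R; x \<in> carrier M \<rbrakk> \<Longrightarrow> a \<odot>\<^bsub>M\<^esub> x \<in> carrier M"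
    and smult_l_distr:
      "\<lbrakk> a \<in> carrier R; b \<in> carrier R; x \<in> carrier M \<rbrakk> \<Longrightarrow>
        (a \<oplus>\<^bsub>R\<^esub> b) \<odot>\<^bsub>M\<^esub> x = a \<odot>\<^bsub>M\<^esub> x \<oplus>\<^bsub>M\<^esub> b \<odot>\<^bsub>M\<^esub> x"
    and smult_r_distr:
      "\<lbrakk> a \<in> carrier R; x \<in> carrier M; y \<in> carrier M \<rbrakk> \<Longrightarrow>
        a \<odot>\<^bsub>M\<^esub> (x \<oplus>\<^bsub>M\<^esub> y) = a \<odot>\<^bsub>M\<^esub> x \<oplus>\<^bsub>M\<^esub> a \<odot>\<^bsub>M\<^esub> y"
    and smult_assoc:
      "\<lbrakk> a \<in> carrier R; b \<in> carrier R; x \<in> carrier M \<rbrakk> \<Longrightarrow>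
        (a \<otimes>\<^bsub>R\<^esub> b) \<odot>\<^bsub>M\<^esub> x = a \<odot>\<^bsub>M\<^esub> (b \<odot>\<^bsub>M\<^esub> x)"
    and smult_one:
      "x \<in> carrier M \<Longrightarrow> \<one>\<^bsub>R\<^esub> \<odot>\<^bsub>M\<^esub> x = x"

definition regular_module :: "'a ring \<Rightarrow> ('a, 'a) module" where
  "regular_module R = \<lparr>carrier = carrier R, mult = mult R, one = one R,
     zero = zero R, add = add R, smult = mult R\<rparr>"

text \<open>\<open>left_span R S\<close> is the left ideal \<open>\<Sum>\<^sub>s R s\<close>, with \<open>s\<close> ranging over \<open>S\<close>.\<close>

definition left_span :: "'a ring \<Rightarrow> 'a set \<Rightarrow> 'a set" where
  "left_span R S = {x. \<exists>A c. finite A \<and> A \<subseteq> S \<and> c \<in> A \<rightarrow> carrier R \<and>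
     x = finsum R (\<lambda>s. c s \<otimes>\<^bsub>R\<^esub> s) A}"

definition quotient_module :: "('a, 'm) module \<Rightarrow> 'm set \<Rightarrow> ('a, 'm set) module" where
  "quotient_module M N = \<lparr>carrier = a_rcosets\<^bsub>M\<^esub> N, mult = undefined, one = undefined,
     zero = N, add = set_add M,
     smult = (\<lambda>a C. \<Union>x\<in>C. N +>\<^bsub>M\<^esub> (a \<odot>\<^bsub>M\<^esub> x))\<rparr>"

definition left_module_iso ::
    "'a ring \<Rightarrow> ('a, 'm) module \<Rightarrow> ('a, 'n) module \<Rightarrow> ('m \<Rightarrow> 'n) \<Rightarrow> bool" where
  "left_module_iso R M N \<phi> \<longleftrightarrow> bij_betw \<phi> (carrier M) (carrier N) \<and>
     (\<forall>x\<in>carrier M. \<forall>y\<in>carrier M. \<phi> (x \<oplus>\<^bsub>M\<^esub> y) = \<phi> x \<oplus>\<^bsub>N\<^esub> \<phi> y) \<and>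
     (\<forall>a\<in>carrier R. \<forall>x\<in>carrier M. \<phi> (a \<odot>\<^bsub>M\<^esub> x) = a \<odot>\<^bsub>N\<^esub> \<phi> x)"

definition left_module_isomorphic ::
    "'a ring \<Rightarrow> ('a, 'm) module \<Rightarrow> ('a, 'n) module \<Rightarrow> bool" where
  "left_module_isomorphic R M N \<longleftrightarrow> (\<exists>\<phi>. left_module_iso R M N \<phi>)"

definition free_of_rank :: "'a ring \<Rightarrow> ('a, 'm) module \<Rightarrow> nat \<Rightarrow> bool" where
  "free_of_rank R M n \<longleftrightarrow> left_module R M \<and>
     (\<exists>S. finite S \<and> card S = n \<and> S \<subseteq> carrier M \<and>
       (\<forall>x\<in>carrier M. \<exists>!c. c \<in> S \<rightarrow>\<^sub>E carrier R \<and> x = finsum M (\<lambda>s. c s \<odot>\<^bsub>M\<^esub> s) S))"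

text \<open>Internal direct sum \<open>M = \<Oplus> V \<lambda>\<close> over \<open>\<lambda> \<in> \<Lambda>\<close>: every element is a finite sum of elements
  of the \<open>V \<lambda>\<close> in exactly one way.\<close>

definition is_direct_sum :: "('a, 'm) module \<Rightarrow> 'l set \<Rightarrow> ('l \<Rightarrow> 'm set) \<Rightarrow> bool" where
  "is_direct_sum M \<Lambda> V \<longleftrightarrow> (\<forall>u\<in>carrier M. \<exists>!c.
     (\<forall>l\<in>\<Lambda>. c l \<in> V l) \<and> (\<forall>l. l \<notin> \<Lambda> \<longrightarrow> c l = \<zero>\<^bsub>M\<^esub>) \<and> finite {l. c l \<noteq> \<zero>\<^bsub>M\<^esub>} \<and>
     u = finsum M c {l. c l \<noteq> \<zero>\<^bsub>M\<^esub>})"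

text \<open>A category of left modules (full subcategory) is represented by its class \<open>C\<close> of objects.\<close>

definition semisimple_category :: "'a ring \<Rightarrow> ('a, 'm) module set \<Rightarrow> bool" where
  "semisimple_category R C \<longleftrightarrow>
     (\<forall>M\<in>C. \<forall>L. submodule L R M \<and> M\<lparr>carrier := L\<rparr> \<in> C \<longrightarrow>
        (\<exists>N. submodule N R M \<and> L \<inter> N = {\<zero>\<^bsub>M\<^esub>} \<and> L <+>\<^bsub>M\<^esub> N = carrier M))"

definition simple_object :: "'a ring \<Rightarrow> ('a, 'm) module set \<Rightarrow> ('a, 'm) module \<Rightarrow> bool" where
  "simple_object R C M \<longleftrightarrow> M \<in> C \<and> carrier M \<noteq> {\<zero>\<^bsub>M\<^esub>} \<and>
     (\<forall>L. submodule L R M \<and> M\<lparr>carrier := L\<rparr> \<in> C \<longrightarrow> L = {\<zero>\<^bsub>M\<^esub>} \<or> L = carrier M)"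


section \<open>Cartan data of a symmetrizable Kac--Moody algebra\<close>

text \<open>The Kac--Moody algebra enters only through its Cartan data. The Cartan subalgebra is the
  type \<open>'t\<close> with scalar multiplication \<open>tscale\<close>; elements of its dual are functions
  \<open>'t \<Rightarrow> rat\<close>, so that the pairing of \<open>h\<close> and \<open>\<lambda>\<close> is the application \<open>\<lambda> h\<close>.\<close>

record ('i, 't) cartan_data =
  index_set :: "'i set"
  tscale :: "rat \<Rightarrow> 't \<Rightarrow> 't"
  simple_root :: "'i \<Rightarrow> 't \<Rightarrow> rat"
  coroot :: "'i \<Rightarrow> 't"
  inner_prod :: "('t \<Rightarrow> rat) \<Rightarrow> ('t \<Rightarrow> rat) \<Rightarrow> rat"
  weight_lattice :: "('t \<Rightarrow> rat) set"

definition fun_scale :: "rat \<Rightarrow> ('a \<Rightarrow> rat) \<Rightarrow> 'a \<Rightarrow> rat" where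
  "fun_scale c \<phi> = (\<lambda>x. c * \<phi> x)"

definition t_dual :: "('i, 't::ab_group_add) cartan_data \<Rightarrow> ('t \<Rightarrow> rat) set" where
  "t_dual D = {\<phi>. Vector_Spaces.linear (tscale D) (*) \<phi>}"

definition coweight_lattice :: "('i, 't) cartan_data \<Rightarrow> 't set" where
  "coweight_lattice D = {h. \<forall>\<phi>\<in>weight_lattice D. \<phi> h \<in> \<int>}"

definition cartan_entry :: "('i, 't) cartan_data \<Rightarrow> 'i \<Rightarrow> 'i \<Rightarrow> rat" where
  "cartan_entry D i j = simple_root D j (coroot D i)"

definition generalized_cartan_matrix :: "'i set \<Rightarrow> ('i \<Rightarrow> 'i \<Rightarrow> rat) \<Rightarrow> bool" where
  "generalized_cartan_matrix I a \<longleftrightarrow> (\<forall>i\<in>I. \<forall>j\<in>I. a i j \<in> \<int>) \<and> (\<forall>i\<in>I. a i i = 2) \<and>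
     (\<forall>i\<in>I. \<forall>j\<in>I. i \<noteq> j \<longrightarrow> a i j \<le> 0) \<and>
     (\<forall>i\<in>I. \<forall>j\<in>I. a i j = 0 \<longleftrightarrow> a j i = 0)"

definition symmetrizable :: "'i set \<Rightarrow> ('i \<Rightarrow> 'i \<Rightarrow> rat) \<Rightarrow> bool" where
  "symmetrizable I a \<longleftrightarrow>
     (\<exists>d. (\<forall>i\<in>I. d i > 0) \<and> (\<forall>i\<in>I. \<forall>j\<in>I. d i * a i j = d j * a j i))"

definition cartan_rank :: "('i, 't) cartan_data \<Rightarrow> nat" where
  "cartan_rank D = vector_space.dim fun_scale
     ((\<lambda>i j. if j \<in> index_set D then cartan_entry D i j else 0) ` index_set D)"

text \<open>\<open>P\<close> is a lattice in \<open>t\<^sup>*\<close>: a free \<open>\<int>\<close>-module whose scalar extension to the rationals is \<open>t\<^sup>*\<close>,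
  that is, it has a \<open>\<int>\<close>-basis which is a basis of the rational vector space \<open>t\<^sup>*\<close>.\<close>

definition is_lattice :: "('i, 't::ab_group_add) cartan_data \<Rightarrow> ('t \<Rightarrow> rat) set \<Rightarrow> bool" where
  "is_lattice D P \<longleftrightarrow> (\<exists>S. finite S \<and> \<not> module.dependent fun_scale S \<and>
     module.span fun_scale S = t_dual D \<and>
     P = {\<Sum>s\<in>S. fun_scale (of_int (c s)) s | c :: ('t \<Rightarrow> rat) \<Rightarrow> int. True})"

text \<open>The dimension condition is Kac's: \<open>(t, (\<alpha>\<^sub>i), (h\<^sub>i))\<close> is a realization of the generalized Cartan
  matrix. The inner product is a nondegenerate symmetric bilinear form, in general indefinite.\<close>

locale kac_moody_data =
  fixes D :: "('i, 't::ab_group_add) cartan_data"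
  assumes finite_index: "finite (index_set D)"
    and t_dimension: "\<exists>Basis. finite_dimensional_vector_space (tscale D) Basis \<and>
      card Basis + cartan_rank D = 2 * card (index_set D)"
    and simple_root_dual: "\<And>i. i \<in> index_set D \<Longrightarrow> simple_root D i \<in> t_dual D"
    and simple_root_indep: "inj_on (simple_root D) (index_set D)"
      "\<not> module.dependent fun_scale (simple_root D ` index_set D)"
    and coroot_indep: "inj_on (coroot D) (index_set D)"
      "\<not> module.dependent (tscale D) (coroot D ` index_set D)"
    and gcm: "generalized_cartan_matrix (index_set D) (cartan_entry D)"
    and symm: "symmetrizable (index_set D) (cartan_entry D)"
    and inner_add: "\<And>\<phi> \<psi> \<chi>. \<lbrakk> \<phi> \<in> t_dual D; \<psi> \<in> t_dual D; \<chi> \<in> t_dual D \<rbrakk> \<Longrightarrow>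
      inner_prod D (\<phi> + \<psi>) \<chi> = inner_prod D \<phi> \<chi> + inner_prod D \<psi> \<chi>"
    and inner_scale: "\<And>c \<phi> \<psi>. \<lbrakk> \<phi> \<in> t_dual D; \<psi> \<in> t_dual D \<rbrakk> \<Longrightarrow>
      inner_prod D (fun_scale c \<phi>) \<psi> = c * inner_prod D \<phi> \<psi>"
    and inner_sym: "\<And>\<phi> \<psi>. \<lbrakk> \<phi> \<in> t_dual D; \<psi> \<in> t_dual D \<rbrakk> \<Longrightarrow>
      inner_prod D \<phi> \<psi> = inner_prod D \<psi> \<phi>"
    and inner_nondegenerate: "\<And>\<phi>. \<lbrakk> \<phi> \<in> t_dual D; \<forall>\<psi>\<in>t_dual D. inner_prod D \<phi> \<psi> = 0 \<rbrakk> \<Longrightarrow> \<phi> = 0"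
    and inner_root: "\<And>i. i \<in> index_set D \<Longrightarrow>
      \<exists>n::int. n > 0 \<and> inner_prod D (simple_root D i) (simple_root D i) = 2 * of_int n"
    and inner_coroot: "\<And>i \<phi>. \<lbrakk> i \<in> index_set D; \<phi> \<in> t_dual D \<rbrakk> \<Longrightarrow>
      \<phi> (coroot D i) = 2 * inner_prod D (simple_root D i) \<phi>
        / inner_prod D (simple_root D i) (simple_root D i)"
    and lattice: "is_lattice D (weight_lattice D)"
    and simple_root_lattice: "\<And>i. i \<in> index_set D \<Longrightarrow> simple_root D i \<in> weight_lattice D"
    and coroot_lattice: "\<And>i. i \<in> index_set D \<Longrightarrow> coroot D i \<in> coweight_lattice D"


section \<open>The field of rational functions and quantum integers\<close>

type_synonym Qq = "rat poly fract"

definition q :: Qq where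
  "q = Fract [:0, 1:] 1"

text \<open>All rational numbers to which \<open>qpow\<close> is applied below are integers, so rounding never
  takes place.\<close>

definition qpow :: "rat \<Rightarrow> Qq" where
  "qpow r = q powi \<lfloor>r\<rfloor>"

definition q_at :: "('i, 't) cartan_data \<Rightarrow> 'i \<Rightarrow> Qq" where
  "q_at D i = qpow (inner_prod D (simple_root D i) (simple_root D i) / 2)"

definition qint :: "('i, 't) cartan_data \<Rightarrow> 'i \<Rightarrow> nat \<Rightarrow> Qq" where
  "qint D i n = (q_at D i powi int n - q_at D i powi (- int n))
     / (q_at D i powi 1 - q_at D i powi (-1))"

definition qfact :: "('i, 't) cartan_data \<Rightarrow> 'i \<Rightarrow> nat \<Rightarrow> Qq" where
  "qfact D i n = (\<Prod>k = 1..n. qint D i k)"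


section \<open>Free associative algebras\<close>

text \<open>Words form the free monoid, written additively so that the convolution product of
  \<open>'g word \<Rightarrow>\<^sub>0 'k\<close> is the multiplication of the free associative algebra on the letters \<open>'g\<close>.\<close>

datatype 'g word = Word (letters: "'g list")

instantiation word :: (type) monoid_add
begin

definition zero_word :: "'g word" where
  "zero_word = Word []"

definition plus_word :: "'g word \<Rightarrow> 'g word \<Rightarrow> 'g word" where
  "plus_word v w = Word (letters v @ letters w)"

instance
  by standard (simp_all add: zero_word_def plus_word_def)

end

definition letter :: "'g \<Rightarrow> 'g word \<Rightarrow>\<^sub>0 Qq" where
  "letter g = Poly_Mapping.single (Word [g]) 1"

definition scal :: "Qq \<Rightarrow> 'g word \<Rightarrow>\<^sub>0 Qq" where
  "scal c = Poly_Mapping.single 0 c"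

definition free_algebra :: "'g set \<Rightarrow> ('g word \<Rightarrow>\<^sub>0 Qq) ring" where
  "free_algebra G = \<lparr>carrier = {p. \<forall>w\<in>Poly_Mapping.keys p. set (letters w) \<subseteq> G},
     mult = (*), one = 1, zero = 0, add = (+)\<rparr>"


section \<open>The q-boson Kashiwara algebra\<close>

text \<open>\<open>E i\<close>, \<open>F i\<close> and \<open>K h\<close> stand for \<open>e''\<^sub>i\<close>, \<open>f\<^sub>i\<close> and \<open>q\<^sup>h\<close>.\<close>

datatype ('i, 't) boson_gen = E 'i | F 'i | K 't

type_synonym ('i, 't) boson_free = "('i, 't) boson_gen word \<Rightarrow>\<^sub>0 Qq"
type_synonym ('i, 't) boson = "('i, 't) boson_free set"

definition boson_gens :: "('i, 't) cartan_data \<Rightarrow> ('i, 't) boson_gen set" where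
  "boson_gens D = E ` index_set D \<union> F ` index_set D \<union> K ` coweight_lattice D"

definition divided_power ::
    "('i, 't) cartan_data \<Rightarrow> 'i \<Rightarrow> ('i, 't) boson_free \<Rightarrow> nat \<Rightarrow> ('i, 't) boson_free" where
  "divided_power D i x n = scal (1 / qfact D i n) * x ^ n"

definition serre ::
    "('i, 't) cartan_data \<Rightarrow> ('i \<Rightarrow> ('i, 't) boson_gen) \<Rightarrow> 'i \<Rightarrow> 'i \<Rightarrow> ('i, 't) boson_free" where
  "serre D X i j = (let m = nat \<lfloor>1 - cartan_entry D i j\<rfloor> in
     \<Sum>k = 0..m. (-1) ^ k * divided_power D i (letter (X i)) k * letter (X j)
       * divided_power D i (letter (X i)) (m - k))"

text \<open>A relation \<open>x = y\<close> is recorded as the element \<open>x - y\<close> of the free algebra.\<close>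

definition boson_relations ::
    "('i, 't::ab_group_add) cartan_data \<Rightarrow> ('i, 't) boson_free set" where
  "boson_relations D =
     {letter (K 0) - 1}
   \<union> {letter (K h) * letter (K h') - letter (K (h + h')) | h h'.
       h \<in> coweight_lattice D \<and> h' \<in> coweight_lattice D}
   \<union> {letter (K h) * letter (E i) * letter (K (- h))
        - scal (qpow (simple_root D i h)) * letter (E i) | h i.
       h \<in> coweight_lattice D \<and> i \<in> index_set D}
   \<union> {letter (K h) * letter (F i) * letter (K (- h))
        - scal (qpow (- simple_root D i h)) * letter (F i) | h i.
       h \<in> coweight_lattice D \<and> i \<in> index_set D}
   \<union> {letter (E i) * letter (F j)
        - (scal (q_at D i powi \<lfloor>cartan_entry D i j\<rfloor>) * letter (F j) * letter (E i)
           + (if i = j then 1 else 0)) | i j.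
       i \<in> index_set D \<and> j \<in> index_set D}
   \<union> {serre D E i j | i j. i \<in> index_set D \<and> j \<in> index_set D \<and> i \<noteq> j}
   \<union> {serre D F i j | i j. i \<in> index_set D \<and> j \<in> index_set D \<and> i \<noteq> j}"

definition boson_ideal :: "('i, 't::ab_group_add) cartan_data \<Rightarrow> ('i, 't) boson_free set" where
  "boson_ideal D = genideal (free_algebra (boson_gens D)) (boson_relations D)"

definition boson_algebra ::
    "('i, 't::ab_group_add) cartan_data \<Rightarrow> ('i, 't) boson ring" where
  "boson_algebra D = free_algebra (boson_gens D) Quot boson_ideal D"

definition boson_class ::
    "('i, 't::ab_group_add) cartan_data \<Rightarrow> ('i, 't) boson_free \<Rightarrow> ('i, 't) boson" where
  "boson_class D x = a_r_coset (free_algebra (boson_gens D)) (boson_ideal D) x"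

text \<open>Since \<open>B\<^sup>-\<close> is a subalgebra over the rational functions, the scalars are among the ring
  generators.\<close>

definition boson_minus :: "('i, 't::ab_group_add) cartan_data \<Rightarrow> ('i, 't) boson ring" where
  "boson_minus D = (boson_algebra D)\<lparr>carrier := generate_ring (boson_algebra D)
     (range (\<lambda>c. boson_class D (scal c)) \<union> (\<lambda>i. boson_class D (letter (F i))) ` index_set D)\<rparr>"


section \<open>The category O(B) and the modules H(\<lambda>)\<close>

definition weight_space ::
    "('i, 't::ab_group_add) cartan_data \<Rightarrow> (('i, 't) boson, 'm) module \<Rightarrow> ('t \<Rightarrow> rat) \<Rightarrow> 'm set"
  where
  "weight_space D M \<phi> = {u \<in> carrier M. \<forall>h\<in>coweight_lattice D.
     boson_class D (letter (K h)) \<odot>\<^bsub>M\<^esub> u = boson_class D (scal (qpow (\<phi> h))) \<odot>\<^bsub>M\<^esub> u}"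

definition category_O ::
    "('i, 't::ab_group_add) cartan_data \<Rightarrow> (('i, 't) boson, 'm) module set" where
  "category_O D = {M. left_module (boson_algebra D) M \<and>
     is_direct_sum M (weight_lattice D) (weight_space D M) \<and>
     (\<forall>u\<in>carrier M. \<exists>l>0. \<forall>is. length is = l \<and> set is \<subseteq> index_set D \<longrightarrow>
        foldr (\<lambda>i v. boson_class D (letter (E i)) \<odot>\<^bsub>M\<^esub> v) is u = \<zero>\<^bsub>M\<^esub>)}"

definition H_ideal ::
    "('i, 't::ab_group_add) cartan_data \<Rightarrow> ('t \<Rightarrow> rat) \<Rightarrow> ('i, 't) boson set" where
  "H_ideal D \<phi> = left_span (boson_algebra D)
     ((\<lambda>i. boson_class D (letter (E i))) ` index_set D \<union>
      (\<lambda>h. boson_class D (letter (K h) - scal (qpow (\<phi> h)))) ` coweight_lattice D)"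

definition H_module ::
    "('i, 't::ab_group_add) cartan_data \<Rightarrow> ('t \<Rightarrow> rat) \<Rightarrow> (('i, 't) boson, ('i, 't) boson set) module"
  where
  "H_module D \<phi> = quotient_module (regular_module (boson_algebra D)) (H_ideal D \<phi>)"

end

theory Submission
  imports Defs
begin

text \<open>The key point is that a nonconstant element of \<open>B\<^sup>-\<close>, viewed as words in the \<open>f\<^sub>i\<close> modulo the Serre relations, is not
  killed by all the skew derivations \<open>e''\<^sub>i\<close>. For an element \<open>y\<close> of minimal weight \<open>\<beta>\<close> violating this, the right skew
  derivations kill \<open>y\<close> too; being then a highest weight vector for each quantum \<open>sl\<^sub>2\<close> acting by \<open>q\<close>-commutators with
  \<open>f\<^sub>i\<close>, which is locally nilpotent by the Serre relations, \<open>y\<close> satisfies \<open>(\<alpha>\<^sub>i, \<beta>) \<le> 0\<close> for all \<open>i\<close>. On the other hand the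
  antipode of the braided Hopf algebra of words sends the primitive element \<open>y\<close> to \<open>-y\<close>, and its square is multiplication
  by \<open>q\<close> to the power \<open>(\<beta>, \<beta>) - 2 (\<rho>, \<beta>) < 0\<close>, a contradiction since \<open>q\<close> is not a root of unity.

  Consequently the natural form pairing \<open>B\<^sup>-\<close> with the algebra of the \<open>e''\<^sub>i\<close> is nondegenerate. Therefore a vector \<open>u\<close>
  killed by all \<open>e''\<^sub>i\<close> can be recovered from any nonzero element of \<open>B\<^sup>- u\<close>, and, correcting vectors by dual bases, every
  module in the category is generated by such vectors. Semisimplicity, the classification of the simple objects
  and the freeness of \<open>H(\<lambda>)\<close> follow.\<close>

section \<open>Free algebras\<close>

text \<open>The obstacle is that nothing about the size of \<open>B\<close> is known beforehand: a
  priori the relations could collapse it, and a triangular decomposition is not at hand.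
  Computations therefore take place in the free algebra, modulo an explicitly spanned ideal
  \<open>serre_ideal\<close>, and \<open>B\<close> enters only through two facts: elements of that
  ideal in the \<open>f_i\<close> vanish in \<open>B\<close>, and the free algebra acts on words
  (\<open>rho\<close>) with every relation of \<open>B\<close> acting into that ideal. The second
  fact uses the nondegeneracy theorem for the Serre relations among the \<open>e''_i\<close>, and it
  is what keeps \<open>H(\<lambda>)\<close> from being zero.

  A projector onto primitive vectors would be an infinite sum of terms \<open>f_a e_b\<close> in a
  completion of \<open>B\<close>. Local nilpotency allows one word length to be treated at a time by
  a finite sum. Words of fixed length are in general dependent modulo the ideal, so their Gram
  matrix \<open>G\<close> need not be invertible; a matrix \<open>H\<close> with
  \<open>G H G = G\<close> serves instead, and restricting it to blocks of equal letter content
  makes the correction preserve weights.\<close>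

lemma scal_0 [simp]: "scal 0 = 0"
  by (simp add: scal_def)

lemma scal_1 [simp]: "scal 1 = 1"
  by (simp add: scal_def)

lemma scal_add: "scal (a + b) = scal a + scal b"
  by (simp add: scal_def single_add)

lemma scal_mult: "scal (a * b) = scal a * scal b"
  by (simp add: scal_def mult_single)

lemma scal_minus: "scal (- a) = - scal a"
  by (simp add: scal_def single_uminus)

lemma scal_diff: "scal (a - b) = scal a - scal b"
  by (simp add: scal_def single_diff)

lemma scal_sum: "scal (\<Sum>x\<in>A. f x) = (\<Sum>x\<in>A. scal (f x))"
  by (induction A rule: infinite_finite_induct) (simp_all add: scal_add)

lemma scal_power: "scal (a ^ n) = scal a ^ n"
  by (induction n) (simp_all add: scal_mult)

lemma lookup_scal_mult: "Poly_Mapping.lookup (scal c * p) w = c * Poly_Mapping.lookup p w"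
proof (cases "c = 0")
  case False
  show ?thesis
    unfolding scal_def mult_map_scale_conv_mult [symmetric]
    by (simp add: Poly_Mapping.map.rep_eq when_def)
qed simp

definition wmon :: "'g list \<Rightarrow> 'g word \<Rightarrow>\<^sub>0 Qq" where
  "wmon w = Poly_Mapping.single (Word w) 1"

lemma wmon_Nil [simp]: "wmon [] = 1"
  by (simp add: wmon_def zero_word_def [symmetric])

lemma wmon_append: "wmon (v @ w) = wmon v * wmon w"
  by (simp add: wmon_def mult_single plus_word_def)

lemma wmon_Cons: "wmon (i # w) = letter i * wmon w"
  by (simp add: wmon_def letter_def mult_single plus_word_def)

lemma wmon_single [simp]: "wmon [i] = letter i"
  by (simp add: wmon_def letter_def)

lemma wmon_replicate: "wmon (replicate n i) = letter i ^ n"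
  by (induction n) (simp_all add: wmon_Cons)

lemma keys_wmon [simp]: "Poly_Mapping.keys (wmon w) = {Word w}"
  by (simp add: wmon_def)

lemma lookup_wmon: "Poly_Mapping.lookup (wmon w) v = (if v = Word w then 1 else 0)"
  by (simp add: wmon_def lookup_single when_def)

lemma falg_expand:
  "p = (\<Sum>w\<in>Poly_Mapping.keys p. scal (Poly_Mapping.lookup p w) * wmon (letters w))"
proof (rule poly_mapping_eqI)
  fix v
  have "Poly_Mapping.lookup
      (\<Sum>w\<in>Poly_Mapping.keys p. scal (Poly_Mapping.lookup p w) * wmon (letters w)) v
      = (\<Sum>w\<in>Poly_Mapping.keys p. if w = v then Poly_Mapping.lookup p w else 0)"
    unfolding lookup_sum by (intro sum.cong refl) (auto simp: lookup_scal_mult lookup_wmon)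
  also have "\<dots> = Poly_Mapping.lookup p v"
    by (simp add: in_keys_iff)
  finally show "Poly_Mapping.lookup p v = Poly_Mapping.lookup
      (\<Sum>w\<in>Poly_Mapping.keys p. scal (Poly_Mapping.lookup p w) * wmon (letters w)) v"
    by simp
qed

lemma falg_induct [case_names zero add word]:
  assumes "P 0" and "\<And>p r. P p \<Longrightarrow> P r \<Longrightarrow> P (p + r)" and "\<And>c w. P (scal c * wmon w)"
  shows "P p"
proof -
  have "P (\<Sum>w\<in>A. scal (Poly_Mapping.lookup p w) * wmon (letters w))" if "finite A" for A
    using that by (induction A rule: finite_induct) (use assms in auto)
  from this [OF finite_keys] show ?thesis
    by (subst falg_expand)
qed

lemma scal_commute: "p * scal c = scal c * p"
proof (induction p rule: falg_induct)
  case (word a w)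
  show ?case
    by (simp add: scal_def wmon_def mult_single mult.commute)
qed (simp_all add: algebra_simps)

lemma scal_left_commute: "p * (scal c * r) = scal c * (p * r)"
  by (metis mult.assoc scal_commute)

lemma scal_scal: "scal a * (scal b * p) = scal (a * b) * p"
  by (simp add: scal_mult mult.assoc)

text \<open>Scalars act by multiplication with \<open>scal c\<close>, so linearity becomes a pair of
  ring equations, and identities between linear maps reduce to words by
  \<open>lin_eqI\<close>.\<close>

definition lin :: "(('g word \<Rightarrow>\<^sub>0 Qq) \<Rightarrow> ('h word \<Rightarrow>\<^sub>0 Qq)) \<Rightarrow> bool" where
  "lin \<phi> \<longleftrightarrow> (\<forall>p r. \<phi> (p + r) = \<phi> p + \<phi> r) \<and> (\<forall>c p. \<phi> (scal c * p) = scal c * \<phi> p)"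

lemma linI: "\<lbrakk> \<And>p r. \<phi> (p + r) = \<phi> p + \<phi> r; \<And>c p. \<phi> (scal c * p) = scal c * \<phi> p \<rbrakk> \<Longrightarrow> lin \<phi>"
  by (simp add: lin_def)

lemma lin_add: "lin \<phi> \<Longrightarrow> \<phi> (p + r) = \<phi> p + \<phi> r"
  by (simp add: lin_def)

lemma lin_scal: "lin \<phi> \<Longrightarrow> \<phi> (scal c * p) = scal c * \<phi> p"
  by (simp add: lin_def)

lemma lin_0: "lin \<phi> \<Longrightarrow> \<phi> 0 = 0"
  using lin_scal [of \<phi> 0 0] by simp

lemma lin_minus: "lin \<phi> \<Longrightarrow> \<phi> (- p) = - \<phi> p"
  using lin_add [of \<phi> p "- p"] by (simp add: lin_0 eq_neg_iff_add_eq_0 add.commute)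

lemma lin_diff: "lin \<phi> \<Longrightarrow> \<phi> (p - r) = \<phi> p - \<phi> r"
  using lin_add [of \<phi> p "- r"] by (simp add: lin_minus)

lemma lin_sum: "lin \<phi> \<Longrightarrow> \<phi> (\<Sum>x\<in>A. f x) = (\<Sum>x\<in>A. \<phi> (f x))"
  by (induction A rule: infinite_finite_induct) (simp_all add: lin_0 lin_add)

lemma lin_id: "lin (\<lambda>p. p)"
  by (simp add: lin_def)

lemma lin_const_0: "lin (\<lambda>p. 0)"
  by (simp add: lin_def)

lemma lin_comp: "lin \<phi> \<Longrightarrow> lin \<psi> \<Longrightarrow> lin (\<lambda>p. \<phi> (\<psi> p))"
  by (simp add: lin_def)

lemma lin_plus: "lin \<phi> \<Longrightarrow> lin \<psi> \<Longrightarrow> lin (\<lambda>p. \<phi> p + \<psi> p)"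
  by (simp add: lin_def algebra_simps)

lemma lin_sub: "lin \<phi> \<Longrightarrow> lin \<psi> \<Longrightarrow> lin (\<lambda>p. \<phi> p - \<psi> p)"
  by (simp add: lin_def algebra_simps)

lemma lin_mult_left: "lin \<phi> \<Longrightarrow> lin (\<lambda>p. z * \<phi> p)"
  by (simp add: lin_def distrib_left scal_left_commute)

lemma lin_mult_right: "lin \<phi> \<Longrightarrow> lin (\<lambda>p. \<phi> p * z)"
  by (simp add: lin_def distrib_right mult.assoc)

lemma lin_funpow:
  fixes \<phi> :: "('g word \<Rightarrow>\<^sub>0 Qq) \<Rightarrow> ('g word \<Rightarrow>\<^sub>0 Qq)"
  shows "lin \<phi> \<Longrightarrow> lin (\<phi> ^^ n)"
  by (induction n) (auto simp: lin_def)

lemma lin_setsum: "(\<And>x. x \<in> A \<Longrightarrow> lin (\<phi> x)) \<Longrightarrow> lin (\<lambda>p. \<Sum>x\<in>A. \<phi> x p)"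
  by (auto simp: lin_def sum.distrib sum_distrib_left)

lemmas lin_intros = lin_id lin_const_0 lin_plus lin_sub lin_mult_left lin_mult_right lin_setsum

lemma lin_eqI:
  assumes "lin \<phi>" "lin \<psi>" "\<And>w. \<phi> (wmon w) = \<psi> (wmon w)"
  shows "\<phi> p = \<psi> p"
proof (induction p rule: falg_induct)
  case zero
  show ?case using assms by (simp add: lin_0)
next
  case (add p r)
  then show ?case using assms by (simp add: lin_add)
next
  case (word c w)
  show ?case using assms by (simp add: lin_scal)
qed

definition lext :: "('g list \<Rightarrow> ('h word \<Rightarrow>\<^sub>0 Qq)) \<Rightarrow> ('g word \<Rightarrow>\<^sub>0 Qq) \<Rightarrow> ('h word \<Rightarrow>\<^sub>0 Qq)" where
  "lext f p = (\<Sum>w\<in>Poly_Mapping.keys p. scal (Poly_Mapping.lookup p w) * f (letters w))"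

lemma lext_superset:
  assumes "finite A" "Poly_Mapping.keys p \<subseteq> A"
  shows "lext f p = (\<Sum>w\<in>A. scal (Poly_Mapping.lookup p w) * f (letters w))"
  unfolding lext_def using assms
  by (intro sum.mono_neutral_left) (auto simp: in_keys_iff)

lemma lin_lext: "lin (lext f)"
proof (rule linI)
  fix p r :: "'a word \<Rightarrow>\<^sub>0 Qq"
  let ?A = "Poly_Mapping.keys p \<union> Poly_Mapping.keys r"
  have fin: "finite ?A" by simp
  show "lext f (p + r) = lext f p + lext f r"
    using keys_add [of p r]
    by (simp add: lext_superset [OF fin] lookup_add scal_add distrib_right sum.distrib)
next
  fix c and p :: "'a word \<Rightarrow>\<^sub>0 Qq"
  have sub: "Poly_Mapping.keys (scal c * p) \<subseteq> Poly_Mapping.keys p"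
    by (auto simp: in_keys_iff lookup_scal_mult)
  show "lext f (scal c * p) = scal c * lext f p"
    by (simp add: lext_superset [OF _ sub] lookup_scal_mult scal_mult sum_distrib_left mult.assoc)
      (simp add: lext_def sum_distrib_left)
qed

lemma lext_wmon [simp]: "lext f (wmon w) = f w"
  by (simp add: lext_def lookup_wmon)

lemma lext_eqI: "lin \<phi> \<Longrightarrow> (\<And>w. \<phi> (wmon w) = f w) \<Longrightarrow> \<phi> p = lext f p"
  by (rule lin_eqI) (simp_all add: lin_lext)

lemma lext_in:
  assumes "0 \<in> A" and "\<And>p r. p \<in> A \<Longrightarrow> r \<in> A \<Longrightarrow> p + r \<in> A"
    and "\<And>c p. p \<in> A \<Longrightarrow> scal c * p \<in> A"
    and "\<And>w. Word w \<in> Poly_Mapping.keys p \<Longrightarrow> f w \<in> A"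
  shows "lext f p \<in> A"
proof -
  have "(\<Sum>w\<in>X. scal (Poly_Mapping.lookup p w) * f (letters w)) \<in> A"
    if "finite X" "X \<subseteq> Poly_Mapping.keys p" for X
    using that by (induction X rule: finite_induct) (use assms in auto)
  then show ?thesis
    by (simp add: lext_def)
qed

lemma lext_cong:
  "(\<And>w. Word w \<in> Poly_Mapping.keys p \<Longrightarrow> f w = g w) \<Longrightarrow> lext f p = lext g p"
  unfolding lext_def by (intro sum.cong) auto

definition over :: "'g set \<Rightarrow> ('g word \<Rightarrow>\<^sub>0 Qq) set" where
  "over A = {p. \<forall>w\<in>Poly_Mapping.keys p. set (letters w) \<subseteq> A}"

lemma over_0 [simp]: "0 \<in> over A"
  by (simp add: over_def)

lemma over_add: "p \<in> over A \<Longrightarrow> r \<in> over A \<Longrightarrow> p + r \<in> over A"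
  unfolding over_def using keys_add [of p r] by blast

lemma over_mult: "p \<in> over A \<Longrightarrow> r \<in> over A \<Longrightarrow> p * r \<in> over A"
  unfolding over_def using keys_mult [of p r] by (fastforce simp: plus_word_def)

lemma over_scal [simp]: "scal c \<in> over A"
  by (simp add: over_def scal_def zero_word_def)

lemma over_1 [simp]: "1 \<in> over A"
  using over_scal [of 1] by simp

lemma over_scal_mult: "p \<in> over A \<Longrightarrow> scal c * p \<in> over A"
  by (intro over_mult over_scal)

lemma over_minus: "p \<in> over A \<Longrightarrow> - p \<in> over A"
  using over_scal_mult [of p A "-1"] by (simp add: scal_minus)

lemma over_diff: "p \<in> over A \<Longrightarrow> r \<in> over A \<Longrightarrow> p - r \<in> over A"
  using over_add [of p A "- r"] by (simp add: over_minus)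

lemma over_wmon [simp]: "wmon w \<in> over A \<longleftrightarrow> set w \<subseteq> A"
  by (simp add: over_def)

lemma over_letter [simp]: "letter i \<in> over A \<longleftrightarrow> i \<in> A"
  by (simp add: over_def letter_def)

lemma over_sum: "(\<And>x. x \<in> X \<Longrightarrow> f x \<in> over A) \<Longrightarrow> (\<Sum>x\<in>X. f x) \<in> over A"
  by (induction X rule: infinite_finite_induct) (auto intro: over_add)

lemma over_power: "p \<in> over A \<Longrightarrow> p ^ n \<in> over A"
  by (induction n) (auto intro: over_mult)

lemma over_lext:
  "p \<in> over A \<Longrightarrow> (\<And>w. set w \<subseteq> A \<Longrightarrow> f w \<in> over B) \<Longrightarrow> lext f p \<in> over B"
  by (rule lext_in [OF over_0 over_add over_scal_mult]) (auto simp: over_def [of A])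

lemma over_induct [consumes 1, case_names zero add word]:
  assumes "p \<in> over A" and "P 0" and "\<And>p r. P p \<Longrightarrow> P r \<Longrightarrow> P (p + r)"
    and "\<And>c w. set w \<subseteq> A \<Longrightarrow> P (scal c * wmon w)"
  shows "P p"
proof -
  have "P (\<Sum>w\<in>X. scal (Poly_Mapping.lookup p w) * wmon (letters w))"
    if "finite X" "X \<subseteq> Poly_Mapping.keys p" for X
    using that by (induction X rule: finite_induct) (use assms in \<open>auto simp: over_def\<close>)
  from this [OF finite_keys order_refl] show ?thesis
    by (subst falg_expand)
qed

text \<open>For letters \<open>f_i\<close> the multiset records, up to sign, the weight of a word as
  an element of the positive cone of the root lattice.\<close>

definition homog :: "'g multiset \<Rightarrow> ('g word \<Rightarrow>\<^sub>0 Qq) \<Rightarrow> bool" where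
  "homog \<gamma> p \<longleftrightarrow> (\<forall>w\<in>Poly_Mapping.keys p. mset (letters w) = \<gamma>)"

lemma homog_0 [simp]: "homog \<gamma> 0"
  by (simp add: homog_def)

lemma homog_add: "homog \<gamma> p \<Longrightarrow> homog \<gamma> r \<Longrightarrow> homog \<gamma> (p + r)"
  unfolding homog_def using keys_add [of p r] by blast

lemma homog_mult: "homog \<gamma> p \<Longrightarrow> homog \<delta> r \<Longrightarrow> homog (\<gamma> + \<delta>) (p * r)"
  unfolding homog_def using keys_mult [of p r] by (fastforce simp: plus_word_def)

lemma homog_scal [simp]: "homog {#} (scal c)"
  by (simp add: homog_def scal_def zero_word_def)

lemma homog_scal_mult: "homog \<gamma> p \<Longrightarrow> homog \<gamma> (scal c * p)"
  using homog_mult [OF homog_scal] by fastforce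

lemma homog_minus: "homog \<gamma> p \<Longrightarrow> homog \<gamma> (- p)"
  using homog_scal_mult [of \<gamma> p "-1"] by (simp add: scal_minus)

lemma homog_diff: "homog \<gamma> p \<Longrightarrow> homog \<gamma> r \<Longrightarrow> homog \<gamma> (p - r)"
  using homog_add [of \<gamma> p "- r"] by (simp add: homog_minus)

lemma homog_sum: "(\<And>x. x \<in> X \<Longrightarrow> homog \<gamma> (f x)) \<Longrightarrow> homog \<gamma> (\<Sum>x\<in>X. f x)"
  by (induction X rule: infinite_finite_induct) (auto intro: homog_add)

lemma homog_wmon [simp]: "homog \<gamma> (wmon w) \<longleftrightarrow> mset w = \<gamma>"
  by (simp add: homog_def)

lemma homog_lext:
  "homog \<gamma> p \<Longrightarrow> (\<And>w. mset w = \<gamma> \<Longrightarrow> homog \<delta> (f w)) \<Longrightarrow> homog \<delta> (lext f p)"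
  using lext_in [of "{p. homog \<delta> p}" p f] homog_add [of \<delta>] homog_scal_mult [of \<delta>]
  by (fastforce simp: homog_def [of \<gamma>])

lemma homog_over: "homog \<gamma> p \<Longrightarrow> set_mset \<gamma> \<subseteq> A \<Longrightarrow> p \<in> over A"
  by (simp add: homog_def over_def) (metis set_mset_mset)

lemma homog_empty_scal:
  assumes "homog {#} p"
  shows "p = scal (Poly_Mapping.lookup p 0)"
proof -
  have "Poly_Mapping.keys p \<subseteq> {0}"
    using assms by (auto simp: homog_def zero_word_def) (metis word.exhaust_sel)
  then show ?thesis
    by (intro poly_mapping_eqI) (auto simp: scal_def lookup_single in_keys_iff when_def)
qed

definition hpart :: "'g multiset \<Rightarrow> ('g word \<Rightarrow>\<^sub>0 Qq) \<Rightarrow> 'g word \<Rightarrow>\<^sub>0 Qq" where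
  "hpart \<gamma> = lext (\<lambda>w. if mset w = \<gamma> then wmon w else 0)"

lemma homog_hpart: "homog \<gamma> (hpart \<gamma> p)"
  unfolding hpart_def
  using lext_in [of "{p. homog \<gamma> p}" p "\<lambda>w. if mset w = \<gamma> then wmon w else 0"]
    homog_add [of \<gamma>] homog_scal_mult [of \<gamma>]
  by fastforce

lemma lext_id: "lext wmon p = p"
  by (rule lext_eqI [symmetric]) (simp_all add: lin_id)

lemma sum_hpart: "p = (\<Sum>\<gamma>\<in>(\<lambda>w. mset (letters w)) ` Poly_Mapping.keys p. hpart \<gamma> p)"
proof -
  have "(\<Sum>\<gamma>\<in>(\<lambda>w. mset (letters w)) ` Poly_Mapping.keys p. hpart \<gamma> p)
    = (\<Sum>w\<in>Poly_Mapping.keys p. \<Sum>\<gamma>\<in>(\<lambda>w. mset (letters w)) ` Poly_Mapping.keys p.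
        if mset (letters w) = \<gamma> then scal (Poly_Mapping.lookup p w) * wmon (letters w) else 0)"
    unfolding hpart_def lext_def by (subst sum.swap) (intro sum.cong refl, auto)
  also have "\<dots> = (\<Sum>w\<in>Poly_Mapping.keys p. scal (Poly_Mapping.lookup p w) * wmon (letters w))"
    by (intro sum.cong refl) simp
  finally show ?thesis
    by (subst falg_expand) simp
qed

text \<open>The algebra endomorphism sending the letters outside \<open>A\<close> to zero. It
  confines ideal membership to words in the \<open>f_i\<close>, although the type of letters will
  later contain the other generators as well.\<close>

definition restrict_letters :: "'g set \<Rightarrow> ('g word \<Rightarrow>\<^sub>0 Qq) \<Rightarrow> 'g word \<Rightarrow>\<^sub>0 Qq" where
  "restrict_letters A = lext (\<lambda>w. if set w \<subseteq> A then wmon w else 0)"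

lemma lin_restrict_letters: "lin (restrict_letters A)"
  by (simp add: restrict_letters_def lin_lext)

lemma restrict_letters_wmon: "restrict_letters A (wmon w) = (if set w \<subseteq> A then wmon w else 0)"
  by (simp add: restrict_letters_def)

lemma restrict_letters_mult: "restrict_letters A (p * r) = restrict_letters A p * restrict_letters A r"
proof -
  have 1: "restrict_letters A (wmon v * r) = restrict_letters A (wmon v) * restrict_letters A r" for v
    by (rule lin_eqI [where \<phi> = "\<lambda>r. restrict_letters A (wmon v * r)"])
      (auto intro!: lin_intros lin_comp [OF lin_restrict_letters] lin_restrict_letters
        simp: wmon_append [symmetric] restrict_letters_wmon)
  show ?thesis
    by (rule lin_eqI [where \<phi> = "\<lambda>p. restrict_letters A (p * r)"])
      (auto intro!: lin_intros lin_comp [OF lin_restrict_letters] lin_restrict_letters simp: 1)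
qed

lemma restrict_letters_over: "p \<in> over A \<Longrightarrow> restrict_letters A p = p"
  unfolding restrict_letters_def over_def
  by (subst lext_cong [where g = wmon]) (fastforce simp: lext_id)+

section \<open>Skew derivations\<close>

text \<open>The field of rational functions is ordered by the sign of the leading coefficient, so that \<open>q\<close> is
  infinitely large. All nonvanishing statements about quantum integers follow from positivity.\<close>

lemma q_gt_1: "1 < q"
proof -
  have "(1 :: rat poly) < [:0, 1:]"
    by (simp add: less_poly_def one_pCons pos_poly_pCons)
  then show ?thesis
    by (simp add: q_def One_fract_def)
qed

lemma q_pos: "0 < q" and q_neq_0 [simp]: "q \<noteq> 0"
  using q_gt_1 by auto

lemma q_powi_add: "q powi (a + b) = q powi a * q powi b"
  by (simp add: power_int_add)

lemma q_powi_gt_1: "0 < n \<Longrightarrow> 1 < q powi n"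
  using q_gt_1 by (metis one_less_power power_int_def less_imp_le zero_less_nat_eq)

lemma q_powi_eq_1: "q powi n = 1 \<Longrightarrow> n = 0"
proof (rule ccontr)
  assume 1: "q powi n = 1" and "n \<noteq> 0"
  then consider "0 < n" | "0 < - n" by linarith
  then show False
  proof cases
    case 2
    then show False
      using q_powi_gt_1 [OF 2] 1 by (simp add: power_int_minus)
  qed (use q_powi_gt_1 [of n] 1 in simp)
qed

lemma q_powi_inj: "q powi a = q powi b \<Longrightarrow> a = b"
  using q_powi_eq_1 [of "a - b"] by (simp add: power_int_diff)

abbreviation qs :: "int \<Rightarrow> 'g word \<Rightarrow>\<^sub>0 Qq" where
  "qs n \<equiv> scal (q powi n)"

lemma qs_add: "qs (a + b) = qs a * qs b"
  by (simp add: q_powi_add scal_mult)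

lemma qs_qs: "qs a * (qs b * p) = qs (a + b) * p"
  by (simp add: qs_add mult.assoc)

lemma letter_scal: "letter i * (scal c * p) = scal c * (letter i * p)"
  by (rule scal_left_commute)

lemma letter_scal': "letter i * scal c = scal c * letter i"
  by (rule scal_commute)

lemma wmon_scal: "wmon i * (scal c * p) = scal c * (wmon i * p)"
  by (rule scal_left_commute)

text \<open>The anti-automorphism fixing all letters; on homogeneous elements it is, up to a scalar,
  the braided antipode used below.\<close>

definition tau :: "('g word \<Rightarrow>\<^sub>0 Qq) \<Rightarrow> 'g word \<Rightarrow>\<^sub>0 Qq" where
  "tau = lext (\<lambda>w. wmon (rev w))"

lemma lin_tau: "lin tau"
  by (simp add: tau_def lin_lext)

lemma tau_wmon [simp]: "tau (wmon w) = wmon (rev w)"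
  by (simp add: tau_def)

lemma tau_1 [simp]: "tau 1 = 1"
  using tau_wmon [of "[]"] by (simp del: tau_wmon)

lemma tau_letter [simp]: "tau (letter i) = letter i"
  using tau_wmon [of "[i]"] by (simp del: tau_wmon)

lemma tau_scal_mult [simp]: "tau (scal c * p) = scal c * tau p"
  by (rule lin_scal [OF lin_tau])

lemma tau_tau [simp]: "tau (tau p) = p"
  by (rule lin_eqI [OF lin_comp [OF lin_tau lin_tau] lin_id]) simp

lemma tau_mult: "tau (p * r) = tau r * tau p"
proof -
  have 1: "tau (wmon v * r) = tau r * tau (wmon v)" for v
    by (rule lin_eqI [where \<phi> = "\<lambda>r. tau (wmon v * r)"])
      (auto intro!: lin_intros lin_comp [OF lin_tau] lin_tau simp: wmon_append [symmetric])
  show ?thesis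
    by (rule lin_eqI [where \<phi> = "\<lambda>p. tau (p * r)"])
      (auto intro!: lin_intros lin_comp [OF lin_tau] lin_tau simp: 1 simp del: tau_wmon)
qed

lemma tau_power: "tau (p ^ n) = tau p ^ n"
  by (induction n) (simp_all add: tau_mult power_commutes)

lemma tau_homog: "homog \<gamma> p \<Longrightarrow> homog \<gamma> (tau p)"
  unfolding tau_def by (rule homog_lext) auto

lemma tau_over: "p \<in> over A \<Longrightarrow> tau p \<in> over A"
  unfolding tau_def by (rule over_lext) auto

text \<open>\<open>der i\<close> is \<open>e''\<^sub>i\<close> acting on words in the \<open>f\<^sub>j\<close>, \<open>rder i\<close> is its mirror image, and \<open>kap c i\<close> multiplies
  a word of weight \<open>\<gamma>\<close> by the power of \<open>q\<close> with exponent \<open>c (\<alpha>\<^sub>i, \<gamma>)\<close>.\<close>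

locale twist =
  fixes bil :: "'g \<Rightarrow> 'g \<Rightarrow> int"
  assumes bil_sym: "bil i j = bil j i"
begin

primrec der_word :: "'g \<Rightarrow> 'g list \<Rightarrow> 'g word \<Rightarrow>\<^sub>0 Qq" where
  "der_word i [] = 0"
| "der_word i (j # w) = (if i = j then wmon w else 0) + qs (bil i j) * (letter j * der_word i w)"

definition der :: "'g \<Rightarrow> ('g word \<Rightarrow>\<^sub>0 Qq) \<Rightarrow> 'g word \<Rightarrow>\<^sub>0 Qq" where
  "der i = lext (der_word i)"

definition wt :: "'g \<Rightarrow> 'g multiset \<Rightarrow> int" where
  "wt i \<gamma> = (\<Sum>j\<in>#\<gamma>. bil i j)"

definition kap :: "int \<Rightarrow> 'g \<Rightarrow> ('g word \<Rightarrow>\<^sub>0 Qq) \<Rightarrow> 'g word \<Rightarrow>\<^sub>0 Qq" where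
  "kap c i = lext (\<lambda>w. qs (c * wt i (mset w)) * wmon w)"

definition rder :: "'g \<Rightarrow> ('g word \<Rightarrow>\<^sub>0 Qq) \<Rightarrow> 'g word \<Rightarrow>\<^sub>0 Qq" where
  "rder i p = tau (der i (tau p))"

lemma lin_der: "lin (der i)"
  by (simp add: der_def lin_lext)

lemma lin_kap: "lin (kap c i)"
  by (simp add: kap_def lin_lext)

lemma lin_rder: "lin (rder i)"
  unfolding rder_def by (intro lin_comp [OF lin_tau] lin_comp [OF lin_der] lin_tau)

lemma der_scal_mult [simp]: "der i (scal c * p) = scal c * der i p"
  by (rule lin_scal [OF lin_der])

lemma kap_scal_mult [simp]: "kap n i (scal c * p) = scal c * kap n i p"
  by (rule lin_scal [OF lin_kap])

lemma rder_scal_mult [simp]: "rder i (scal c * p) = scal c * rder i p"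
  by (rule lin_scal [OF lin_rder])

lemma der_0 [simp]: "der i 0 = 0"
  by (rule lin_0 [OF lin_der])

lemma kap_0 [simp]: "kap n i 0 = 0"
  by (rule lin_0 [OF lin_kap])

lemma rder_0 [simp]: "rder i 0 = 0"
  by (rule lin_0 [OF lin_rder])

lemma wt_add: "wt i (\<gamma> + \<delta>) = wt i \<gamma> + wt i \<delta>"
  by (simp add: wt_def)

lemma wt_add_mset [simp]: "wt i (add_mset j \<gamma>) = bil i j + wt i \<gamma>"
  by (simp add: wt_def)

lemma wt_empty [simp]: "wt i {#} = 0"
  by (simp add: wt_def)

lemma wt_replicate [simp]: "wt i (replicate_mset n j) = int n * bil i j"
  by (induction n) (simp_all add: algebra_simps)

lemma wt_remove: "j \<in># \<gamma> \<Longrightarrow> wt i (\<gamma> - {#j#}) = wt i \<gamma> - bil i j"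
  using wt_add_mset [of i j "\<gamma> - {#j#}"] by (simp del: wt_add_mset)

lemma der_wmon [simp]: "der i (wmon w) = der_word i w"
  by (simp add: der_def)

lemma der_letter_mult:
  "der i (letter j * p) = (if i = j then p else 0) + qs (bil i j) * (letter j * der i p)"
proof (rule lin_eqI [where p = p and \<phi> = "\<lambda>p. der i (letter j * p)"])
  show "lin (\<lambda>p. (if i = j then p else 0) + qs (bil i j) * (letter j * der i p))"
    by (cases "i = j") (auto intro!: lin_intros lin_der)
qed (auto intro!: lin_intros lin_der lin_comp [OF lin_der] simp: wmon_Cons [symmetric])

lemma der_1 [simp]: "der i 1 = 0"
  using der_wmon [of i "[]"] by (simp del: der_wmon)

lemma der_letter [simp]: "der i (letter j) = (if i = j then 1 else 0)"
  using der_letter_mult [of i j 1] by simp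

lemma kap_wmon: "kap c i (wmon w) = qs (c * wt i (mset w)) * wmon w"
  by (simp add: kap_def)

lemma kap_1 [simp]: "kap c i 1 = 1"
  using kap_wmon [of c i "[]"] by simp

lemma kap_letter [simp]: "kap c i (letter j) = qs (c * bil i j) * letter j"
  using kap_wmon [of c i "[j]"] by simp

lemma kap_homog: "homog \<gamma> p \<Longrightarrow> kap c i p = qs (c * wt i \<gamma>) * p"
proof -
  assume p: "homog \<gamma> p"
  have "kap c i p = lext (\<lambda>w. qs (c * wt i \<gamma>) * wmon w) p"
    unfolding kap_def using p by (intro lext_cong) (auto simp: homog_def)
  also have "\<dots> = qs (c * wt i \<gamma>) * p"
    by (rule lext_eqI [symmetric]) (auto intro!: lin_intros)
  finally show ?thesis .
qed

lemma kap_mult: "kap c i (p * r) = kap c i p * kap c i r"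
proof -
  have w: "kap c i (wmon v * wmon w) = kap c i (wmon v) * kap c i (wmon w)" for v w
    by (simp add: wmon_append [symmetric] kap_wmon wt_add distrib_left qs_add)
      (simp add: wmon_append mult.assoc wmon_scal)
  have 1: "kap c i (wmon v * r) = kap c i (wmon v) * kap c i r" for v
    by (rule lin_eqI [where \<phi> = "\<lambda>r. kap c i (wmon v * r)"])
      (auto intro!: lin_intros lin_comp [OF lin_kap] lin_kap simp: w)
  show ?thesis
    by (rule lin_eqI [where \<phi> = "\<lambda>p. kap c i (p * r)"])
      (auto intro!: lin_intros lin_comp [OF lin_kap] lin_kap simp: 1)
qed

lemma kap_kap: "kap c i (kap c' i p) = kap (c + c') i p"
  by (rule lin_eqI [OF lin_comp [OF lin_kap lin_kap] lin_kap])
    (simp add: kap_wmon qs_qs algebra_simps)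

lemma kap_zero [simp]: "kap 0 i p = p"
  by (rule lin_eqI [OF lin_kap lin_id]) (simp add: kap_wmon)

lemma homog_kap: "homog \<gamma> p \<Longrightarrow> homog \<gamma> (kap c i p)"
  by (simp add: kap_homog homog_scal_mult)

text \<open>Moving \<open>der i\<close> past a letter \<open>j\<close> costs the power of
  \<open>q\<close> with exponent \<open>bil i j\<close>, so moving it past all of \<open>p\<close>
  costs \<open>kap 1 i p\<close>; the proof peels letters off the first factor.\<close>

lemma der_mult: "der i (p * r) = der i p * r + kap 1 i p * der i r"
proof -
  have 1: "der i (wmon v * r) = der i (wmon v) * r + kap 1 i (wmon v) * der i r" for v
  proof (induction v)
    case (Cons j v)
    have "der i (wmon (j # v) * r) =
        (if i = j then wmon v * r else 0) + qs (bil i j) * (letter j * der i (wmon v * r))"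
      by (simp add: wmon_Cons mult.assoc der_letter_mult)
    also have "qs (bil i j) * (letter j * der i (wmon v * r)) =
        qs (bil i j) * (letter j * (der i (wmon v) * r)) +
        qs (bil i j + wt i (mset v)) * (letter j * (wmon v * der i r))"
      by (simp only: Cons) (simp add: distrib_left kap_wmon letter_scal mult.assoc qs_add)
    also have "(if i = j then wmon v * r else 0) + (qs (bil i j) * (letter j * (der i (wmon v) * r)) +
        qs (bil i j + wt i (mset v)) * (letter j * (wmon v * der i r)))
      = der i (wmon (j # v)) * r + kap 1 i (wmon (j # v)) * der i r"
    proof -
      have "kap 1 i (wmon (j # v)) = qs (bil i j + wt i (mset v)) * (letter j * wmon v)"
        using kap_wmon [of 1 i "j # v"] by (simp add: wmon_Cons)
      then show ?thesis
        by (simp add: distrib_right mult.assoc)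
    qed
    finally show ?case .
  qed simp
  show ?thesis
    by (rule lin_eqI [where \<phi> = "\<lambda>p. der i (p * r)"])
      (auto intro!: lin_intros lin_comp [OF lin_der] lin_kap lin_der simp: 1 simp del: der_wmon)
qed

lemma der_word_homog:
  "homog (mset w - {#i#}) (der_word i w) \<and> (i \<notin> set w \<longrightarrow> der_word i w = 0)"
proof (induction w)
  case (Cons j w)
  have "homog (mset (j # w) - {#i#}) (qs (bil i j) * (letter j * der_word i w))"
  proof (cases "i \<in> set w")
    case True
    then have "{#j#} + (mset w - {#i#}) = mset (j # w) - {#i#}"
      by simp
    then show ?thesis
      using homog_mult [of "{#j#}" "letter j" "mset w - {#i#}" "der_word i w"] Cons
        homog_wmon [of "{#j#}" "[j]"] by (auto intro!: homog_scal_mult)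
  qed (use Cons in simp)
  then show ?case
    using Cons by (auto intro: homog_add)
qed simp

lemma der_homog: "homog \<gamma> p \<Longrightarrow> homog (\<gamma> - {#i#}) (der i p)"
  unfolding der_def by (erule homog_lext) (use der_word_homog in blast)

lemma der_homog_0: "homog \<gamma> p \<Longrightarrow> i \<notin># \<gamma> \<Longrightarrow> der i p = 0"
proof -
  assume p: "homog \<gamma> p" "i \<notin># \<gamma>"
  have "der i p = lext (\<lambda>w. 0) p"
    unfolding der_def using p der_word_homog by (intro lext_cong) (force simp: homog_def)
  then show ?thesis by (simp add: lext_def)
qed

lemma der_over: "p \<in> over A \<Longrightarrow> der i p \<in> over A"
proof -
  have "der_word i w \<in> over A" if "set w \<subseteq> A" for w
    using that by (induction w) (auto intro!: over_add over_scal_mult over_mult)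
  then show "p \<in> over A \<Longrightarrow> der i p \<in> over A"
    unfolding der_def using over_lext by blast
qed

text \<open>\<open>der i\<close> deletes one letter \<open>i\<close> and thereby lowers the exponent
  used by \<open>kap c j\<close> by \<open>c * bil j i\<close>.\<close>

lemma der_kap: "der i (kap c j p) = qs (c * bil j i) * kap c j (der i p)"
proof (rule lin_eqI [where p = p and \<phi> = "\<lambda>p. der i (kap c j p)"])
  fix w
  show "der i (kap c j (wmon w)) = qs (c * bil j i) * kap c j (der i (wmon w))"
  proof (cases "i \<in> set w")
    case True
    have "kap c j (der_word i w) = qs (c * wt j (mset w - {#i#})) * der_word i w"
      using der_word_homog by (blast intro: kap_homog)
    with True show ?thesis
      by (simp add: kap_wmon wt_remove qs_qs algebra_simps)
  next
    case False
    then show ?thesis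
      using der_word_homog [of w i] by (simp add: kap_wmon)
  qed
qed (auto intro!: lin_intros lin_comp [OF lin_der] lin_comp [OF lin_kap] lin_kap lin_der)

lemma tau_kap: "tau (kap c i p) = kap c i (tau p)"
  by (rule lin_eqI [where p = p and \<phi> = "\<lambda>p. tau (kap c i p)"])
    (auto intro!: lin_comp [OF lin_tau] lin_comp [OF lin_kap] lin_kap lin_tau simp: kap_wmon)

lemma rder_mult: "rder i (p * r) = p * rder i r + rder i p * kap 1 i r"
  by (simp add: rder_def tau_mult der_mult lin_add [OF lin_tau] tau_kap)

lemma rder_letter [simp]: "rder i (letter j) = (if i = j then 1 else 0)"
  by (simp add: rder_def lin_0 [OF lin_tau])

lemma rder_1 [simp]: "rder i 1 = 0"
  by (simp add: rder_def lin_0 [OF lin_tau])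

lemma rder_scal [simp]: "rder i (scal c) = 0"
  using rder_scal_mult [of i c 1] by simp

lemma rder_homog: "homog \<gamma> p \<Longrightarrow> homog (\<gamma> - {#i#}) (rder i p)"
  unfolding rder_def by (intro tau_homog der_homog)

lemma rder_homog_0: "homog \<gamma> p \<Longrightarrow> i \<notin># \<gamma> \<Longrightarrow> rder i p = 0"
  unfolding rder_def by (simp add: der_homog_0 [OF tau_homog] lin_0 [OF lin_tau])

text \<open>The two operators enter a word from opposite ends. In either order the same pairs of
  letters are deleted, and the powers of \<open>q\<close> agree because \<open>bil\<close> is
  symmetric.\<close>

lemma der_rder: "der i (rder j p) = rder j (der i p)"
proof (rule lin_eqI [where p = p and \<phi> = "\<lambda>p. der i (rder j p)"])
  fix w
  show "der i (rder j (wmon w)) = rder j (der i (wmon w))"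
  proof (induction w)
    case (Cons k w)
    show ?case
      by (simp add: wmon_Cons rder_mult der_mult lin_add [OF lin_der] lin_add [OF lin_rder]
          mult.assoc der_kap Cons [symmetric] qs_qs bil_sym [of j i] scal_left_commute
          flip: der_wmon)
        (auto simp: qs_qs bil_sym letter_scal algebra_simps)
  qed (simp add: lin_0 [OF lin_rder])
qed (auto intro!: lin_comp [OF lin_der] lin_comp [OF lin_rder] lin_rder lin_der)

end

section \<open>The Serre ideal\<close>

definition qnum :: "Qq \<Rightarrow> nat \<Rightarrow> Qq" where
  "qnum v n = (v powi int n - v powi (- int n)) / (v powi 1 - v powi (-1))"

definition qfac :: "Qq \<Rightarrow> nat \<Rightarrow> Qq" where
  "qfac v n = (\<Prod>k = 1..n. qnum v k)"

lemma qfac_0 [simp]: "qfac v 0 = 1"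
  by (simp add: qfac_def)

lemma qfac_Suc: "qfac v (Suc n) = qfac v n * qnum v (Suc n)"
  by (simp add: qfac_def)

context
  fixes v :: Qq
  assumes v: "1 < v"
begin

lemma v_diff_pos: "0 < v powi 1 - v powi (-1)"
  using v by (simp add: inverse_less_1_iff order_less_trans [OF _ v])

lemma qnum_0 [simp]: "qnum v 0 = 0"
  by (simp add: qnum_def)

lemma qnum_1: "qnum v (Suc 0) = 1"
  using v_diff_pos by (simp add: qnum_def)

lemma qnum_add: "qnum v (a + b) = v powi int b * qnum v a + v powi (- int a) * qnum v b"
proof -
  have v0: "v \<noteq> 0" using v by auto
  have e: "v powi int (a + b) = v powi int a * v powi int b"
    by (simp only: power_int_of_nat power_add)
  have e': "v powi (- int (a + b)) = v powi (- int a) * v powi (- int b)"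
    by (simp only: power_int_minus e inverse_mult_distrib)
  show ?thesis
    unfolding qnum_def e e'
    by (simp add: add_divide_distrib [symmetric] algebra_simps del: power_int_of_nat)
qed

text \<open>For \<open>1 < v\<close> this form of the recursion has only nonnegative terms, so
  positivity follows by induction.\<close>

lemma qnum_Suc: "qnum v (Suc n) = v powi 1 * qnum v n + v powi (- int n)"
  using qnum_add [of n 1] by (simp add: qnum_1)

lemma qnum_nonneg: "0 \<le> qnum v n"
  using v by (induction n) (simp_all add: qnum_Suc)

lemma qnum_pos: "0 < n \<Longrightarrow> 0 < qnum v n"
  using v qnum_nonneg by (cases n) (auto simp: qnum_Suc intro!: add_nonneg_pos)

lemma qfac_pos: "0 < qfac v n"
  unfolding qfac_def by (rule prod_pos) (auto intro: qnum_pos)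

lemma qnum_nz: "qnum v (Suc n) \<noteq> 0" and qfac_nz: "qfac v n \<noteq> 0"
  using qnum_pos [of "Suc n"] qfac_pos [of n] by auto

text \<open>The alternating \<open>q\<close>-binomial sum is evaluated through a closed form of its
  partial sums, which is amenable to induction. At \<open>n = M\<close> it is the negative of the
  one remaining term, whence \<open>q_binomial_zero\<close>.\<close>

lemma q_binomial_partial:
  "n \<le> M \<Longrightarrow> (\<Sum>k = 0..n. (-1) ^ k * v powi (- (int k * int M)) / (qfac v k * qfac v (Suc M - k)))
    = (-1) ^ n * v powi (- (int n * int (Suc M))) / (qfac v n * qfac v (M - n) * qnum v (Suc M))"
proof (induction n)
  case 0
  show ?case by (simp add: qfac_Suc)
next
  case (Suc n)
  define B where "B = M - Suc n"
  have M: "M = Suc n + B" using Suc.prems by (simp add: B_def)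
  have v0: "v \<noteq> 0" using v by auto
  have nz: "qfac v n \<noteq> 0" "qfac v B \<noteq> 0" "qnum v (Suc n) \<noteq> 0" "qnum v (Suc B) \<noteq> 0" "qnum v (Suc M) \<noteq> 0"
    by (simp_all add: qnum_nz qfac_nz)
  \<comment> \<open>\<open>Suc M\<close> splits as \<open>Suc n + Suc B\<close>; the addition law
    for \<open>qnum\<close>, multiplied by a power of \<open>v\<close>, is what merges the old
    partial sum with the new term.\<close>
  have key: "v powi (int (Suc n)) * qnum v (Suc M) = v powi (int (Suc M)) * qnum v (Suc n) + qnum v (Suc B)"
  proof -
    have "qnum v (Suc M) = v powi int (Suc B) * qnum v (Suc n) + v powi (- int (Suc n)) * qnum v (Suc B)"
      using qnum_add [of "Suc n" "Suc B"] M by (simp del: of_nat_Suc)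
    moreover have "v powi int (Suc n) * v powi (int (Suc B)) = v powi int (Suc M)"
      using v0 M by (subst power_int_add [symmetric]) (auto simp: algebra_simps)
    moreover have "v powi int (Suc n) * v powi (- int (Suc n)) = 1"
      using v0 by (subst power_int_add [symmetric]) auto
    ultimately show ?thesis
      by (simp only: distrib_left mult.assoc [symmetric] mult_1_left)
  qed
  define X where "X = v powi (- (int (Suc n) * int (Suc M)))"
  have e1: "v powi (- (int n * int (Suc M))) = X * v powi (int (Suc M))"
    unfolding X_def using v0 by (simp add: power_int_add [symmetric] algebra_simps)
  have e2: "v powi (- (int (Suc n) * int M)) = X * v powi (int (Suc n))"
    unfolding X_def using v0 by (simp add: power_int_add [symmetric] algebra_simps)
  have s1: "M - n = Suc B" "Suc M - Suc n = Suc B" "M - Suc n = B" using M by auto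
  have "(\<Sum>k = 0..Suc n. (-1) ^ k * v powi (- (int k * int M)) / (qfac v k * qfac v (Suc M - k)))
    = (-1) ^ n * (X * v powi (int (Suc M))) / (qfac v n * qfac v (Suc B) * qnum v (Suc M))
      - (-1) ^ n * (X * v powi (int (Suc n))) / (qfac v (Suc n) * qfac v (Suc B))"
    using Suc by (simp add: e1 e2 s1 del: of_nat_Suc)
  also have "\<dots> = (-1) ^ n * X * (v powi (int (Suc M)) * qnum v (Suc n)
      - v powi (int (Suc n)) * qnum v (Suc M)) / (qfac v (Suc n) * qfac v (Suc B) * qnum v (Suc M))"
    using nz by (simp add: qfac_Suc field_simps del: of_nat_Suc)
  also have "\<dots> = (-1) ^ Suc n * X * qnum v (Suc B) / (qfac v (Suc n) * qfac v (Suc B) * qnum v (Suc M))"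
    by (simp only: key) simp
  also have "\<dots> = (-1) ^ Suc n * X / (qfac v (Suc n) * qfac v B * qnum v (Suc M))"
    using nz by (simp add: qfac_Suc field_simps)
  finally show ?case
    by (simp only: X_def s1)
qed

lemma q_binomial_zero:
  "(\<Sum>k = 0..Suc M. (-1) ^ k * v powi (- (int k * int M)) / (qfac v k * qfac v (Suc M - k))) = 0"
  using q_binomial_partial [of M M] by (simp add: qfac_Suc algebra_simps)

end

text \<open>Here \<open>d i\<close> is half the square length of a simple root, and
  \<open>m i j\<close> is one minus the Cartan entry, the degree of the Serre relation in the letter
  \<open>i\<close>. Only the letters in \<open>J\<close> are subject to Serre relations, and the
  type may contain others.\<close>

locale serre_data = twist bil for bil :: "'g \<Rightarrow> 'g \<Rightarrow> int" +
  fixes J :: "'g set" and d :: "'g \<Rightarrow> int" and m :: "'g \<Rightarrow> 'g \<Rightarrow> nat"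
  assumes finite_J: "finite J"
    and d_pos: "i \<in> J \<Longrightarrow> 0 < d i"
    and bil_self: "i \<in> J \<Longrightarrow> bil i i = 2 * d i"
    and bil_m: "\<lbrakk> i \<in> J; j \<in> J; i \<noteq> j \<rbrakk> \<Longrightarrow> bil i j = d i * (1 - int (m i j))"
    and m_pos: "\<lbrakk> i \<in> J; j \<in> J; i \<noteq> j \<rbrakk> \<Longrightarrow> 0 < m i j"
begin

definition vv :: "'g \<Rightarrow> Qq" where
  "vv i = q powi d i"

definition dpw :: "'g \<Rightarrow> nat \<Rightarrow> 'g word \<Rightarrow>\<^sub>0 Qq" where
  "dpw i n = scal (1 / qfac (vv i) n) * letter i ^ n"

definition serre_el :: "'g \<Rightarrow> 'g \<Rightarrow> 'g word \<Rightarrow>\<^sub>0 Qq" where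
  "serre_el i j = (\<Sum>k = 0..m i j. (-1) ^ k * dpw i k * letter j * dpw i (m i j - k))"

lemma vv_gt_1: "i \<in> J \<Longrightarrow> 1 < vv i"
  by (simp add: vv_def q_powi_gt_1 d_pos)

lemma vv_powi: "vv i powi n = q powi (d i * n)"
  by (simp add: vv_def power_int_mult)

lemma minus_one_power: "(-1) ^ k = scal ((-1) ^ k)"
  by (simp add: scal_power scal_minus)

lemma homog_letter [simp]: "homog \<gamma> (letter i) \<longleftrightarrow> \<gamma> = {#i#}"
  using homog_wmon [of \<gamma> "[i]"] by auto

lemma homog_power_letter: "homog (replicate_mset n i) (letter i ^ n)"
  by (metis homog_wmon mset_replicate wmon_replicate)

lemma homog_dpw: "homog (replicate_mset n i) (dpw i n)"
  unfolding dpw_def by (intro homog_scal_mult homog_power_letter)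

lemma homog_serre_el: "homog (replicate_mset (m i j) i + {#j#}) (serre_el i j)"
  unfolding serre_el_def
proof (intro homog_sum)
  fix k assume k: "k \<in> {0..m i j}"
  have "homog ({#} + replicate_mset k i + {#j#} + replicate_mset (m i j - k) i)
      ((-1) ^ k * dpw i k * letter j * dpw i (m i j - k))"
    unfolding minus_one_power by (intro homog_mult homog_scal homog_dpw) simp
  moreover have "{#} + replicate_mset k i + {#j#} + replicate_mset (m i j - k) i
      = replicate_mset (m i j) i + {#j#}"
    using k by (auto simp: multiset_eq_iff)
  ultimately show "homog (replicate_mset (m i j) i + {#j#})
      ((-1) ^ k * dpw i k * letter j * dpw i (m i j - k))"
    by simp
qed

text \<open>Reversal exchanges the summands \<open>k\<close> and \<open>m i j - k\<close>, whose
  signs differ by the parity of \<open>m i j\<close>.\<close>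

lemma tau_serre_el: "tau (serre_el i j) = scal ((-1) ^ m i j) * serre_el i j"
proof -
  have d: "tau (dpw i n) = dpw i n" for n
    by (simp add: dpw_def tau_power)
  have "tau (serre_el i j)
    = (\<Sum>k = 0..m i j. (-1) ^ k * dpw i (m i j - k) * letter j * dpw i k)"
    unfolding serre_el_def lin_sum [OF lin_tau] minus_one_power
    by (simp add: mult.assoc) (simp add: tau_mult d mult.assoc)
  also have "\<dots> = (\<Sum>k = 0..m i j. (-1) ^ (m i j - k) * dpw i k * letter j * dpw i (m i j - k))"
    by (subst sum.atLeastAtMost_rev) (intro sum.cong, auto)
  also have "\<dots> = scal ((-1) ^ m i j) * serre_el i j"
    unfolding serre_el_def sum_distrib_left
    by (intro sum.cong refl)
      (auto simp: minus_one_power mult.assoc scal_scal uminus_power_if scal_minus)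
  finally show ?thesis .
qed

lemma der_power_letter: "i \<in> J \<Longrightarrow>
  der i (letter i ^ Suc n) = scal (vv i powi int n * qnum (vv i) (Suc n)) * letter i ^ n"
proof (induction n)
  case 0
  then show ?case by (simp add: qnum_1 vv_gt_1)
next
  case (Suc n)
  have v: "1 < vv i" "vv i \<noteq> 0" using vv_gt_1 [OF Suc.prems] by auto
  have "der i (letter i ^ Suc (Suc n)) = letter i ^ Suc n
    + qs (bil i i) * (letter i * der i (letter i ^ Suc n))"
    by (simp only: power_Suc [of "letter i" "Suc n"] der_letter_mult) simp
  also have "\<dots> = scal (1 + vv i powi 2 * (vv i powi int n * qnum (vv i) (Suc n))) * letter i ^ Suc n"
  proof -
    have "q powi bil i i = (vv i)\<^sup>2"
      using vv_powi [of i 2] by (simp add: bil_self Suc.prems mult.commute)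
    then show ?thesis
      by (simp only: Suc) (simp add: letter_scal scal_scal scal_add distrib_right mult.assoc)
  qed
  also have "1 + vv i powi 2 * (vv i powi int n * qnum (vv i) (Suc n))
      = vv i powi int (Suc n) * qnum (vv i) (Suc (Suc n))"
  proof -
    have "vv i powi int (Suc n) * vv i powi (- int (Suc n)) = 1"
      using v by (subst power_int_minus) simp
    then show ?thesis
      unfolding qnum_Suc [OF v(1), of "Suc n"] distrib_left
      by (simp only:) (simp add: power2_eq_square ac_simps del: of_nat_Suc)
  qed
  finally show ?case .
qed

lemma der_power_letter_other: "i \<noteq> j \<Longrightarrow> der i (letter j ^ n) = 0"
  using der_homog_0 [OF homog_power_letter] by (metis in_replicate_mset)

lemma der_dpw: "i \<in> J \<Longrightarrow>
  der i (dpw i n) = (if n = 0 then 0 else scal (vv i powi (int n - 1)) * dpw i (n - 1))"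
proof (cases n)
  case (Suc k)
  assume i: "i \<in> J"
  show ?thesis
    using der_power_letter [OF i, of k] qnum_nz [OF vv_gt_1 [OF i], of k] qfac_nz [OF vv_gt_1 [OF i], of k]
    by (simp add: Suc dpw_def scal_scal qfac_Suc del: power_Suc)
qed (simp add: dpw_def)

lemma der_dpw_other: "i \<noteq> j \<Longrightarrow> der i (dpw j n) = 0"
  by (simp add: dpw_def der_power_letter_other)

lemma kap_dpw: "kap c i (dpw j n) = qs (c * (int n * bil i j)) * dpw j n"
  using kap_homog [OF homog_dpw] by simp

text \<open>As \<open>bil i j = - d i * M\<close>, the power of \<open>q\<close> from passing the
  first two factors combines with the one from differentiating the last to
  \<open>vv i powi k\<close>, independently of \<open>M\<close>. This makes the alternating sum over
  \<open>k\<close> telescope.\<close>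

lemma der_serre_term:
  assumes i: "i \<in> J" and M: "m i j = Suc M" and k: "k \<le> Suc M" and ij: "j \<in> J" "i \<noteq> j"
  shows "der i (dpw i k * letter j * dpw i (Suc M - k))
    = (if k = 0 then 0 else scal (vv i powi (int k - 1)) * (dpw i (k - 1) * letter j * dpw i (Suc M - k)))
    + (if k = Suc M then 0 else scal (vv i powi int k) * (dpw i k * letter j * dpw i (M - k)))"
proof -
  have b: "bil i j = d i * - int M"
    using bil_m [OF i ij] M by simp
  have "der i (dpw i k * letter j * dpw i (Suc M - k))
    = der i (dpw i k) * letter j * dpw i (Suc M - k)
      + scal (q powi (int k * bil i i + bil i j)) * (dpw i k * letter j) * der i (dpw i (Suc M - k))"
  proof -
    have "kap 1 i (dpw i k * letter j) = qs (int k * bil i i + bil i j) * (dpw i k * letter j)"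
      using kap_homog [OF homog_mult [OF homog_dpw, of "{#j#}" "letter j" k i], of 1 i]
      by (simp add: algebra_simps)
    moreover have "der i (dpw i k * letter j) = der i (dpw i k) * letter j"
      by (simp add: der_mult ij(2))
    ultimately show ?thesis
      by (simp only: der_mult [of i "dpw i k * letter j" "dpw i (Suc M - k)"])
  qed
  also have "der i (dpw i k) * letter j * dpw i (Suc M - k)
    = (if k = 0 then 0 else scal (vv i powi (int k - 1)) * (dpw i (k - 1) * letter j * dpw i (Suc M - k)))"
    by (simp add: der_dpw i mult.assoc)
  also have "scal (q powi (int k * bil i i + bil i j)) * (dpw i k * letter j) * der i (dpw i (Suc M - k))
    = (if k = Suc M then 0 else scal (vv i powi int k) * (dpw i k * letter j * dpw i (M - k)))"
  proof (cases "k = Suc M")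
    case False
    have e: "int k * bil i i + bil i j + d i * (int (Suc M - k) - 1) = d i * int k"
      using False k by (simp add: bil_self [OF i] b of_nat_diff algebra_simps)
    have "der i (dpw i (Suc M - k)) = qs (d i * (int (Suc M - k) - 1)) * dpw i (M - k)"
      using False k by (simp add: der_dpw i vv_powi Suc_diff_le)
    then show ?thesis
      using False e by (simp add: mult.assoc scal_left_commute [of "dpw i k"] qs_qs letter_scal
          vv_powi [of i "int k", simplified])
  qed (simp add: der_dpw i)
  finally show ?thesis .
qed

text \<open>For \<open>l = i\<close> the sum telescopes; for \<open>l = j\<close> it becomes a
  multiple of \<open>letter i ^ Suc M\<close> whose coefficient is the alternating
  \<open>q\<close>-binomial sum; other letters do not occur. Being killed by all derivations is what
  makes the ideal stable under them.\<close>

lemma der_serre_el: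
  assumes i: "i \<in> J" and j: "j \<in> J" and ij: "i \<noteq> j"
  shows "der l (serre_el i j) = 0"
proof -
  obtain M where M: "m i j = Suc M"
    using m_pos [OF i j ij] by (cases "m i j") auto
  have v: "1 < vv i" by (rule vv_gt_1 [OF i])
  have D: "der l (serre_el i j)
    = (\<Sum>k = 0..Suc M. scal ((-1) ^ k) * der l (dpw i k * letter j * dpw i (Suc M - k)))"
    unfolding serre_el_def lin_sum [OF lin_der] M minus_one_power by (simp add: mult.assoc)
  consider "l = i" | "l = j" | "l \<noteq> i" "l \<noteq> j" by blast
  then show ?thesis
  proof cases
    case 1
    define T where "T k = scal ((-1) ^ k * vv i powi int k) * (dpw i k * letter j * dpw i (M - k))" for k
    have "der l (serre_el i j)
      = (\<Sum>k = 0..Suc M. (if k = 0 then 0 else - T (k - 1)) + (if k = Suc M then 0 else T k))"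
      unfolding D
    proof (intro sum.cong refl)
      fix k assume "k \<in> {0..Suc M}"
      then have k: "k \<le> Suc M" by simp
      show "scal ((-1) ^ k) * der l (dpw i k * letter j * dpw i (Suc M - k))
        = (if k = 0 then 0 else - T (k - 1)) + (if k = Suc M then 0 else T k)"
        unfolding 1 der_serre_term [OF i M k j ij] T_def
        by (cases k) (auto simp: distrib_left scal_scal scal_minus)
    qed
    also have "\<dots> = (\<Sum>k = 0..Suc M. if k = 0 then 0 else - T (k - 1))
        + (\<Sum>k = 0..Suc M. if k = Suc M then 0 else T k)"
      by (rule sum.distrib)
    also have "(\<Sum>k = 0..Suc M. if k = 0 then 0 else - T (k - 1)) = - (\<Sum>k = 0..M. T k)"
      by (subst sum.atLeast0_atMost_Suc_shift) (simp add: sum_negf)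
    also have "(\<Sum>k = 0..Suc M. if k = Suc M then 0 else T k) = (\<Sum>k = 0..M. T k)"
      by simp
    finally show ?thesis by simp
  next
    case 2
    have b: "bil j i = d i * - int M"
      using bil_m [OF i j ij] M by (simp add: bil_sym)
    have t: "scal ((-1) ^ k) * der j (dpw i k * letter j * dpw i (Suc M - k))
      = scal ((-1) ^ k * vv i powi (- (int k * int M)) / (qfac (vv i) k * qfac (vv i) (Suc M - k)))
        * letter i ^ Suc M" if "k \<in> {0..Suc M}" for k
    proof -
      have "letter i ^ k * letter i ^ (Suc M - k) = letter i ^ Suc M"
        using that by (simp flip: power_add)
      then have "dpw i k * dpw i (Suc M - k)
          = scal (1 / qfac (vv i) k * (1 / qfac (vv i) (Suc M - k))) * letter i ^ Suc M"
        by (simp add: dpw_def mult.assoc scal_left_commute [of "letter i ^ k"] scal_scal)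
      moreover have "der j (dpw i k * letter j * dpw i (Suc M - k))
          = scal (vv i powi (- (int k * int M))) * (dpw i k * dpw i (Suc M - k))"
        using ij by (simp add: der_mult kap_dpw der_dpw_other b vv_powi mult.assoc algebra_simps)
      ultimately show ?thesis
        by (simp add: scal_scal)
    qed
    have "der l (serre_el i j)
      = (\<Sum>k = 0..Suc M. scal ((-1) ^ k * vv i powi (- (int k * int M)) / (qfac (vv i) k * qfac (vv i) (Suc M - k)))
        * letter i ^ Suc M)"
      unfolding D unfolding 2 by (rule sum.cong [OF refl t])
    also have "\<dots> = scal (\<Sum>k = 0..Suc M. (-1) ^ k * vv i powi (- (int k * int M)) / (qfac (vv i) k * qfac (vv i) (Suc M - k)))
        * letter i ^ Suc M"
      by (simp only: scal_sum sum_distrib_right)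
    finally show ?thesis
      unfolding q_binomial_zero [OF v] by simp
  next
    case 3
    then show ?thesis
      using der_homog_0 [OF homog_serre_el] by simp
  qed
qed

text \<open>The two-sided ideal, spanned explicitly by homogeneous elements: a generator between two
  words. A linear map needs to be examined only on these, and operators depending on the degree act
  on them by scalars.\<close>

inductive_set serre_ideal :: "('g word \<Rightarrow>\<^sub>0 Qq) set" where
  zero: "0 \<in> serre_ideal"
| add: "\<lbrakk> x \<in> serre_ideal; y \<in> serre_ideal \<rbrakk> \<Longrightarrow> x + y \<in> serre_ideal"
| gen: "\<lbrakk> i \<in> J; j \<in> J; i \<noteq> j \<rbrakk> \<Longrightarrow> scal c * (wmon u * serre_el i j * wmon w) \<in> serre_ideal"

lemma serre_ideal_lin:
  assumes "lin \<phi>"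
    and "\<And>i j u w. \<lbrakk> i \<in> J; j \<in> J; i \<noteq> j \<rbrakk> \<Longrightarrow> \<phi> (wmon u * serre_el i j * wmon w) \<in> A"
    and "0 \<in> A" "\<And>x y. x \<in> A \<Longrightarrow> y \<in> A \<Longrightarrow> x + y \<in> A" "\<And>c x. x \<in> A \<Longrightarrow> scal c * x \<in> A"
    and "x \<in> serre_ideal"
  shows "\<phi> x \<in> A"
  using assms(6) by induction (simp_all add: assms(2-5) lin_0 [OF assms(1)] lin_add [OF assms(1)] lin_scal [OF assms(1)])

lemma serre_ideal_scal: "x \<in> serre_ideal \<Longrightarrow> scal c * x \<in> serre_ideal"
  by (induction rule: serre_ideal.induct)
    (auto simp: distrib_left scal_scal intro: serre_ideal.intros)

lemma serre_ideal_lin_self: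
  assumes "lin \<phi>"
    and "\<And>i j u w. \<lbrakk> i \<in> J; j \<in> J; i \<noteq> j \<rbrakk> \<Longrightarrow> \<phi> (wmon u * serre_el i j * wmon w) \<in> serre_ideal"
    and "x \<in> serre_ideal"
  shows "\<phi> x \<in> serre_ideal"
  using serre_ideal_lin [OF assms(1,2)] serre_ideal.zero serre_ideal.add serre_ideal_scal assms(3) by blast

lemma serre_ideal_minus: "x \<in> serre_ideal \<Longrightarrow> - x \<in> serre_ideal"
  using serre_ideal_scal [of x "-1"] by (simp add: scal_minus)

lemma serre_ideal_diff: "x \<in> serre_ideal \<Longrightarrow> y \<in> serre_ideal \<Longrightarrow> x - y \<in> serre_ideal"
  using serre_ideal.add [of x "- y"] by (simp add: serre_ideal_minus)

lemma serre_ideal_sum: "(\<And>a. a \<in> A \<Longrightarrow> f a \<in> serre_ideal) \<Longrightarrow> (\<Sum>a\<in>A. f a) \<in> serre_ideal"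
  by (induction A rule: infinite_finite_induct) (auto intro: serre_ideal.intros)

lemma serre_ideal_left: "x \<in> serre_ideal \<Longrightarrow> z * x \<in> serre_ideal"
proof (induction z rule: falg_induct)
  case (word c v)
  have "wmon v * x \<in> serre_ideal"
    using word
  proof (rule serre_ideal_lin_self [rotated 2])
    fix i j u w assume *: "i \<in> J" "j \<in> J" "i \<noteq> j"
    show "wmon v * (wmon u * serre_el i j * wmon w) \<in> serre_ideal"
      using serre_ideal.gen [OF *, of 1 "v @ u" w] by (simp add: wmon_append mult.assoc)
  qed (intro lin_intros)
  then show ?case by (simp add: mult.assoc serre_ideal_scal)
qed (auto simp: distrib_right intro: serre_ideal.intros)

lemma serre_ideal_right: "x \<in> serre_ideal \<Longrightarrow> x * z \<in> serre_ideal"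
proof (induction z rule: falg_induct)
  case (word c v)
  have "x * wmon v \<in> serre_ideal"
    using word
  proof (rule serre_ideal_lin_self [rotated 2])
    fix i j u w assume *: "i \<in> J" "j \<in> J" "i \<noteq> j"
    show "wmon u * serre_el i j * wmon w * wmon v \<in> serre_ideal"
      using serre_ideal.gen [OF *, of 1 u "w @ v"] by (simp add: wmon_append mult.assoc)
  qed (intro lin_intros)
  then show ?case by (simp add: scal_left_commute serre_ideal_scal)
qed (auto simp: distrib_left intro: serre_ideal.intros)

lemma serre_el_in: "\<lbrakk> i \<in> J; j \<in> J; i \<noteq> j \<rbrakk> \<Longrightarrow> serre_el i j \<in> serre_ideal"
  using serre_ideal.gen [of i j 1 "[]" "[]"] by simp

lemma serre_gen_homog:
  "homog (mset u + (replicate_mset (m i j) i + {#j#}) + mset w) (wmon u * serre_el i j * wmon w)"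
  by (intro homog_mult homog_serre_el) simp_all

lemma serre_ideal_sandwich: "x \<in> serre_ideal \<Longrightarrow> z * x * z' \<in> serre_ideal"
  by (intro serre_ideal_left serre_ideal_right)

lemma serre_ideal_kap: "x \<in> serre_ideal \<Longrightarrow> kap c i x \<in> serre_ideal"
proof (erule serre_ideal_lin_self [OF lin_kap, rotated])
  fix k j u w assume *: "k \<in> J" "j \<in> J" "k \<noteq> j"
  show "kap c i (wmon u * serre_el k j * wmon w) \<in> serre_ideal"
    unfolding kap_homog [OF serre_gen_homog]
    by (intro serre_ideal_scal serre_ideal_sandwich serre_el_in *)
qed

text \<open>In the Leibniz expansion the term differentiating \<open>serre_el\<close> vanishes, and
  the others still contain the generator up to a power of \<open>q\<close>.\<close>

lemma serre_ideal_der: "x \<in> serre_ideal \<Longrightarrow> der i x \<in> serre_ideal"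
proof (erule serre_ideal_lin_self [OF lin_der, rotated])
  fix k j u w assume *: "k \<in> J" "j \<in> J" "k \<noteq> j"
  have "der i (wmon u * serre_el k j * wmon w) = der i (wmon u) * serre_el k j * wmon w
      + kap 1 i (wmon u) * kap 1 i (serre_el k j) * der i (wmon w)"
    by (simp add: der_mult kap_mult der_serre_el [OF *] del: der_wmon)
  then show "der i (wmon u * serre_el k j * wmon w) \<in> serre_ideal"
    by (simp only:) (intro serre_ideal.add serre_ideal_sandwich serre_ideal_kap serre_el_in *)
qed

lemma serre_ideal_tau: "x \<in> serre_ideal \<Longrightarrow> tau x \<in> serre_ideal"
proof (erule serre_ideal_lin_self [OF lin_tau, rotated])
  fix k j and u w :: "'g list" assume *: "k \<in> J" "j \<in> J" "k \<noteq> j"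
  have "tau (wmon u * serre_el k j * wmon w)
      = tau (wmon w) * (scal ((-1) ^ m k j) * serre_el k j) * tau (wmon u)"
    by (simp only: tau_mult tau_serre_el mult.assoc)
  then show "tau (wmon u * serre_el k j * wmon w) \<in> serre_ideal"
    by (simp only:) (intro serre_ideal_sandwich serre_ideal_scal serre_el_in *)
qed

lemma serre_ideal_rder: "x \<in> serre_ideal \<Longrightarrow> rder i x \<in> serre_ideal"
  by (simp add: rder_def serre_ideal_tau serre_ideal_der)

text \<open>Every generator has positive degree. Hence the ideal contains no nonzero constant, which
  in the end keeps the highest weight modules from vanishing.\<close>

lemma serre_ideal_const: "x \<in> serre_ideal \<Longrightarrow> Poly_Mapping.lookup x 0 = 0"
proof (induction rule: serre_ideal.induct)
  case (gen i j c u w)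
  have "0 \<notin> Poly_Mapping.keys (wmon u * serre_el i j * wmon w)"
    using serre_gen_homog [of u i j w] by (auto simp: homog_def zero_word_def)
  then show ?case
    by (simp add: lookup_scal_mult in_keys_iff)
qed (simp_all add: lookup_add)

lemma serre_ideal_scal_iff: "c \<noteq> 0 \<Longrightarrow> scal c * x \<in> serre_ideal \<longleftrightarrow> x \<in> serre_ideal"
  using serre_ideal_scal [of x c] serre_ideal_scal [of "scal c * x" "inverse c"]
  by (auto simp: scal_scal)

lemma scal_in_serre_ideal: "scal c \<in> serre_ideal \<longleftrightarrow> c = 0"
  using serre_ideal_const [of "scal c"] by (auto simp: scal_def serre_ideal.zero)

section \<open>The adjoint action of a generator\<close>

text \<open>A \<open>q\<close>-commutator with \<open>f_i\<close>. With the twist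
  \<open>kap (-1) i\<close> the powers of \<open>q\<close> cancel in \<open>rder_ad\<close>, and the
  Serre relation says that a power of \<open>ad i\<close> kills \<open>letter j\<close>.\<close>

definition ad :: "'g \<Rightarrow> ('g word \<Rightarrow>\<^sub>0 Qq) \<Rightarrow> 'g word \<Rightarrow>\<^sub>0 Qq" where
  "ad i y = letter i * y - kap (-1) i y * letter i"

lemma lin_ad: "lin (ad i)"
  unfolding ad_def by (intro lin_intros lin_kap)

lemma ad_scal_mult [simp]: "ad i (scal c * p) = scal c * ad i p"
  by (rule lin_scal [OF lin_ad])

lemma ad_1 [simp]: "ad i 1 = 0"
  by (simp add: ad_def)

lemma ad_mult: "ad i (y * z) = ad i y * z + kap (-1) i y * ad i z"
  by (simp add: ad_def kap_mult algebra_simps)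

lemma rder_kap: "rder i (kap c j p) = qs (c * bil j i) * kap c j (rder i p)"
  by (simp add: rder_def tau_kap der_kap)

text \<open>The two terms free of \<open>der i y\<close> cancel, so \<open>ad i\<close> preserves
  the kernel of \<open>der i\<close> modulo the Serre ideal.\<close>

lemma der_ad:
  "der i (ad i y) = qs (bil i i) * (letter i * der i y) - qs (- bil i i) * (kap (-1) i (der i y) * letter i)"
  by (simp add: ad_def lin_diff [OF lin_der] der_letter_mult)
    (simp add: der_mult der_kap kap_kap mult.assoc)

text \<open>Thus \<open>rder i\<close> and \<open>ad i\<close> act like the raising and lowering operators of a quantum \<open>sl\<^sub>2\<close>.\<close>

lemma rder_ad: "rder i (ad i y) = ad i (rder i y) + kap 1 i y - kap (-1) i y"
proof -
  have "rder i (kap (-1) i y * letter i)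
      = kap (-1) i y + qs (- bil i i) * (qs (bil i i) * (kap (-1) i (rder i y) * letter i))"
    by (simp add: rder_mult rder_kap mult.assoc scal_left_commute [of "kap (-1) i (rder i y)"])
  then show ?thesis
    by (simp add: ad_def lin_diff [OF lin_rder] rder_mult qs_qs)
qed

lemma kap_ad: "kap c i (ad i y) = qs (c * bil i i) * ad i (kap c i y)"
  by (simp add: ad_def lin_diff [OF lin_kap] kap_mult kap_kap algebra_simps scal_left_commute [of "kap (c - 1) i y"])

text \<open>The power of \<open>q\<close> is left unspecified because only membership in the Serre
  ideal is at stake.\<close>

lemma kap_ad_pow: "\<exists>e. kap c i ((ad i ^^ n) y) = qs e * (ad i ^^ n) (kap c i y)"
proof (induction n)
  case 0
  then show ?case by (intro exI [of _ 0]) simp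
next
  case (Suc n)
  then obtain e where "kap c i ((ad i ^^ n) y) = qs e * (ad i ^^ n) (kap c i y)" by blast
  then show ?case
    by (intro exI [of _ "c * bil i i + e"]) (simp add: kap_ad qs_qs)
qed

lemma serre_ideal_ad: "y \<in> serre_ideal \<Longrightarrow> ad i y \<in> serre_ideal"
  unfolding ad_def by (intro serre_ideal_diff serre_ideal_left serre_ideal_right serre_ideal_kap)

lemma serre_ideal_ad_pow: "y \<in> serre_ideal \<Longrightarrow> (ad i ^^ n) y \<in> serre_ideal"
  by (induction n) (auto intro: serre_ideal_ad)

lemma ad_homog: "homog \<gamma> y \<Longrightarrow> homog (add_mset i \<gamma>) (ad i y)"
proof -
  assume y: "homog \<gamma> y"
  have "homog ({#i#} + \<gamma>) (letter i * y)" "homog (\<gamma> + {#i#}) (kap (-1) i y * letter i)"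
    by (intro homog_mult homog_kap y; simp)+
  then show ?thesis
    unfolding ad_def by (intro homog_diff) simp_all
qed

lemma ad_pow_homog: "homog \<gamma> y \<Longrightarrow> homog (replicate_mset n i + \<gamma>) ((ad i ^^ n) y)"
  by (induction n) (auto dest: ad_homog)

lemma letter_mult_dpw: "i \<in> J \<Longrightarrow> letter i * dpw i n = scal (qnum (vv i) (Suc n)) * dpw i (Suc n)"
  using qnum_nz [OF vv_gt_1, of i n] qfac_nz [OF vv_gt_1, of i n]
  by (simp add: dpw_def qfac_Suc scal_scal letter_scal)

lemma dpw_mult_letter: "i \<in> J \<Longrightarrow> dpw i n * letter i = scal (qnum (vv i) (Suc n)) * dpw i (Suc n)"
  using letter_mult_dpw [of i n] by (simp add: dpw_def mult.assoc letter_scal power_commutes)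

text \<open>The exponent of \<open>vv i\<close> contains the factor \<open>n - m i j\<close>. It
  disappears at \<open>n = m i j\<close>, where the sum becomes the reversed Serre element up to a
  quantum factorial.\<close>

lemma ad_pow_letter:
  assumes i: "i \<in> J" and j: "j \<in> J" "i \<noteq> j"
  shows "(ad i ^^ n) (letter j) = scal (qfac (vv i) n) *
    (\<Sum>k = 0..n. scal ((-1) ^ k * vv i powi (- (int k * (int n - int (m i j))))) * (dpw i (n - k) * letter j * dpw i k))"
proof (induction n)
  case 0
  then show ?case by (simp add: dpw_def)
next
  case (Suc n)
  define v where "v = vv i"
  have v1: "1 < v" and v0: "v \<noteq> 0"
    using vv_gt_1 [OF i] by (auto simp: v_def)
  define M where "M = int (m i j)"
  define c where "c n k = (-1) ^ k * v powi (- (int k * (int n - M)))" for n k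
  define T where "T n k = dpw i (n - k) * letter j * dpw i k" for n k
  \<comment> \<open>The scalar by which \<open>kap (-1) i\<close> acts on \<open>T n k\<close>; the
    weight of that product does not depend on \<open>k\<close>.\<close>
  define e where "e = v powi (- (2 * int n + 1 - M))"
  have adT: "ad i (T n k) = scal (qnum v (Suc n - k)) * T (Suc n) k - scal (e * qnum v (Suc k)) * T (Suc n) (Suc k)"
    if k: "k \<le> n" for k
  proof -
    have h: "homog (replicate_mset (n - k) i + {#j#} + replicate_mset k i) (T n k)"
      unfolding T_def by (intro homog_mult homog_dpw) simp
    have wt: "wt i (replicate_mset (n - k) i + {#j#} + replicate_mset k i) = d i * (2 * int n + 1 - M)"
      using k by (simp add: wt_add bil_self [OF i] bil_m [OF i j] M_def of_nat_diff algebra_simps)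
    have "kap (-1) i (T n k) = scal e * T n k"
      unfolding kap_homog [OF h] wt e_def v_def vv_powi by (simp add: algebra_simps)
    moreover have "letter i * T n k = scal (qnum v (Suc n - k)) * T (Suc n) k"
      using k by (simp add: T_def mult.assoc [symmetric] letter_mult_dpw i v_def Suc_diff_le)
    moreover have "T n k * letter i = scal (qnum v (Suc k)) * T (Suc n) (Suc k)"
      by (simp add: T_def mult.assoc dpw_mult_letter i v_def)
        (simp add: scal_left_commute [of "letter j"] scal_left_commute [of "dpw i (n - k)"])
    ultimately show ?thesis
      by (simp add: ad_def mult.assoc scal_scal)
  qed
  \<comment> \<open>\<open>A\<close> and \<open>B\<close> collect the two halves of
    \<open>adT\<close> by the resulting word. Since \<open>A (Suc n)\<close> vanishes by
    \<open>qnum v 0 = 0\<close> and \<open>B 0\<close> is set to zero, both sums may run over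
    \<open>0..Suc n\<close>.\<close>
  define A where "A k = scal (c n k * qnum v (Suc n - k)) * T (Suc n) k" for k
  define B where "B k = (if k = 0 then 0 else - scal (c n (k - 1) * e * qnum v k) * T (Suc n) k)" for k
  have "(ad i ^^ Suc n) (letter j) = scal (qfac v n) * (\<Sum>k = 0..n. scal (c n k) * ad i (T n k))"
    by (simp add: Suc lin_sum [OF lin_ad] v_def c_def T_def M_def)
  also have "(\<Sum>k = 0..n. scal (c n k) * ad i (T n k)) = (\<Sum>k = 0..n. A k + B (Suc k))"
    by (intro sum.cong refl) (simp add: adT A_def B_def right_diff_distrib scal_scal mult.assoc)
  also have "\<dots> = (\<Sum>k = 0..n. A k) + (\<Sum>k = 0..n. B (Suc k))"
    by (rule sum.distrib)
  also have "(\<Sum>k = 0..n. A k) = (\<Sum>k = 0..Suc n. A k)"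
    by (simp add: A_def qnum_0 v1)
  also have "(\<Sum>k = 0..n. B (Suc k)) = (\<Sum>k = 0..Suc n. B k)"
    by (simp add: sum.atLeast0_atMost_Suc_shift B_def del: sum.cl_ivl_Suc)
  also have "(\<Sum>k = 0..Suc n. A k) + (\<Sum>k = 0..Suc n. B k) = (\<Sum>k = 0..Suc n. A k + B k)"
    by (rule sum.distrib [symmetric])
  also have "\<dots> = (\<Sum>k = 0..Suc n. scal (qnum v (Suc n)) * (scal (c (Suc n) k) * T (Suc n) k))"
  proof (intro sum.cong refl)
    fix k assume "k \<in> {0..Suc n}"
    then have k: "k \<le> Suc n" by simp
    have q: "qnum v (Suc n) = v powi int k * qnum v (Suc n - k) + v powi (- int (Suc n - k)) * qnum v k"
      using qnum_add [OF v1, of "Suc n - k" k] k by simp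
    have c1: "c n k = c (Suc n) k * v powi int k"
      unfolding c_def using v0
      by (simp add: power_int_add [symmetric] mult.assoc algebra_simps del: power_int_of_nat)
    have c2: "c n (k - 1) * e = - (c (Suc n) k * v powi (- int (Suc n - k)))" if "k \<noteq> 0"
    proof -
      have "- (int (k - 1) * (int n - M)) + - (2 * int n + 1 - M)
          = - (int k * (int (Suc n) - M)) + - int (Suc n - k)"
        using that k by (simp add: of_nat_diff algebra_simps)
      then have "v powi (- (int (k - 1) * (int n - M))) * v powi (- (2 * int n + 1 - M))
          = v powi (- (int k * (int (Suc n) - M))) * v powi (- int (Suc n - k))"
        using v0 by (simp only: power_int_add [symmetric] disj_not1 simp_thms)
      moreover have "(-1) ^ k = - ((-1) ^ (k - 1) :: Qq)"
        using that by (cases k) auto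
      ultimately show ?thesis
        by (simp only: c_def e_def mult.assoc)
    qed
    have "c n k * qnum v (Suc n - k) - (if k = 0 then 0 else c n (k - 1) * e * qnum v k)
        = c (Suc n) k * qnum v (Suc n)"
    proof (cases "k = 0")
      case True
      then show ?thesis by (simp add: c_def)
    next
      case False
      have "c n k * qnum v (Suc n - k) - c n (k - 1) * e * qnum v k = c (Suc n) k *
          (v powi int k * qnum v (Suc n - k) + v powi (- int (Suc n - k)) * qnum v k)"
        unfolding c1 c2 [OF False] by (simp only: distrib_left mult.assoc mult_minus_left mult_minus_right diff_minus_eq_add)
      then show ?thesis
        using False by (simp only: q if_False)
    qed
    then have "A k + B k = scal (c (Suc n) k * qnum v (Suc n)) * T (Suc n) k"
      unfolding A_def B_def
      by (cases "k = 0") (auto simp: scal_diff left_diff_distrib simp flip: \<open>_ = c (Suc n) k * qnum v (Suc n)\<close>)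
    then show "A k + B k = scal (qnum v (Suc n)) * (scal (c (Suc n) k) * T (Suc n) k)"
      by (simp add: scal_scal mult.commute)
  qed
  also have "\<dots> = scal (qnum v (Suc n)) * (\<Sum>k = 0..Suc n. scal (c (Suc n) k) * T (Suc n) k)"
    by (rule sum_distrib_left [symmetric])
  finally show ?case
    by (simp only: scal_scal qfac_Suc [symmetric] v_def c_def T_def M_def)
qed

lemma ad_pow_letter_in:
  assumes i: "i \<in> J" and j: "j \<in> J" "i \<noteq> j"
  shows "(ad i ^^ m i j) (letter j) \<in> serre_ideal"
proof -
  have d: "tau (dpw i n) = dpw i n" for n
    by (simp add: dpw_def tau_power)
  have "(ad i ^^ m i j) (letter j) = scal (qfac (vv i) (m i j)) * tau (serre_el i j)"
    unfolding ad_pow_letter [OF assms] serre_el_def lin_sum [OF lin_tau] minus_one_power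
    by (simp add: mult.assoc) (simp add: tau_mult d mult.assoc)
  then show ?thesis
    by (simp add: serre_ideal_scal serre_ideal_tau serre_el_in assms)
qed

text \<open>Words are sums of \<open>f\<^sub>i\<^sup>k u\<close> with \<open>u\<close> in \<open>nilp i\<close>, and modulo the Serre ideal the elements \<open>u\<close> are unique;
  hence the kernel of \<open>der i\<close> consists of \<open>ad i\<close>-nilpotent elements.\<close>

definition nilp :: "'g \<Rightarrow> ('g word \<Rightarrow>\<^sub>0 Qq) set" where
  "nilp i = {y. der i y \<in> serre_ideal \<and> (\<exists>n. (ad i ^^ n) y \<in> serre_ideal)}"

lemma ad_pow_mono: "(ad i ^^ a) y \<in> serre_ideal \<Longrightarrow> a \<le> b \<Longrightarrow> (ad i ^^ b) y \<in> serre_ideal"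
  using serre_ideal_ad_pow [where y = "(ad i ^^ a) y" and i = i and n = "b - a"]
    fun_cong [OF funpow_add [where f = "ad i" and m = "b - a" and n = a], of y] by simp

lemma nilp_1: "1 \<in> nilp i"
  unfolding nilp_def by (auto simp: serre_ideal.zero intro!: exI [of _ 1])

lemma nilp_letter: "i \<in> J \<Longrightarrow> j \<in> J \<Longrightarrow> i \<noteq> j \<Longrightarrow> letter j \<in> nilp i"
  unfolding nilp_def using ad_pow_letter_in by (auto simp: serre_ideal.zero)

lemma nilp_add: "x \<in> nilp i \<Longrightarrow> y \<in> nilp i \<Longrightarrow> x + y \<in> nilp i"
proof -
  assume "x \<in> nilp i" "y \<in> nilp i"
  then obtain a b where xy: "der i x \<in> serre_ideal" "(ad i ^^ a) x \<in> serre_ideal"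
    "der i y \<in> serre_ideal" "(ad i ^^ b) y \<in> serre_ideal"
    by (auto simp: nilp_def)
  have "(ad i ^^ max a b) (x + y) \<in> serre_ideal"
    using ad_pow_mono [OF xy(2), of "max a b"] ad_pow_mono [OF xy(4), of "max a b"]
    by (simp add: lin_add [OF lin_funpow [OF lin_ad]] serre_ideal.add)
  then show ?thesis
    using xy by (auto simp: nilp_def lin_add [OF lin_der] intro: serre_ideal.add)
qed

lemma nilp_scal: "x \<in> nilp i \<Longrightarrow> scal c * x \<in> nilp i"
  by (auto simp: nilp_def lin_scal [OF lin_funpow [OF lin_ad]] intro: serre_ideal_scal)

lemma nilp_kap: "x \<in> nilp i \<Longrightarrow> kap c i x \<in> nilp i"
proof -
  assume "x \<in> nilp i"
  then obtain a where x: "der i x \<in> serre_ideal" "(ad i ^^ a) x \<in> serre_ideal"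
    by (auto simp: nilp_def)
  obtain e where "kap c i ((ad i ^^ a) x) = qs e * (ad i ^^ a) (kap c i x)"
    using kap_ad_pow by blast
  with serre_ideal_kap [OF x(2), of c i] have "(ad i ^^ a) (kap c i x) \<in> serre_ideal"
    by (simp add: serre_ideal_scal_iff)
  with x(1) show ?thesis
    by (auto simp: nilp_def der_kap intro: serre_ideal_scal serre_ideal_kap)
qed

lemma nilp_ad: "x \<in> nilp i \<Longrightarrow> ad i x \<in> nilp i"
proof -
  assume "x \<in> nilp i"
  then obtain a where x: "der i x \<in> serre_ideal" "(ad i ^^ a) x \<in> serre_ideal"
    by (auto simp: nilp_def)
  have "(ad i ^^ a) (ad i x) \<in> serre_ideal"
    using serre_ideal_ad [OF x(2)] by (simp flip: funpow_swap1)
  moreover have "der i (ad i x) \<in> serre_ideal"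
    unfolding der_ad by (intro serre_ideal_diff serre_ideal_scal serre_ideal_left serre_ideal_right serre_ideal_kap x(1))
  ultimately show ?thesis
    by (auto simp: nilp_def)
qed

text \<open>By the twisted Leibniz rule each application of \<open>ad i\<close> lowers the exponent
  of one factor, and the twist \<open>kap (-1) i\<close> does no harm; induction on
  \<open>a + b\<close> thus replaces an explicit \<open>q\<close>-binomial formula.\<close>

lemma ad_pow_mult:
  "(ad i ^^ a) y \<in> serre_ideal \<Longrightarrow> (ad i ^^ b) z \<in> serre_ideal \<Longrightarrow> (ad i ^^ (a + b)) (y * z) \<in> serre_ideal"
proof (induction "a + b" arbitrary: a b y z)
  case 0
  then show ?case by (simp add: serre_ideal_left)
next
  case (Suc s)
  show ?case
  proof (cases "a = 0 \<or> b = 0")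
    case True
    then have "y * z \<in> serre_ideal"
      using Suc.prems by (auto intro: serre_ideal_left serre_ideal_right)
    then show ?thesis by (rule serre_ideal_ad_pow)
  next
    case False
    then obtain a' b' where ab: "a = Suc a'" "b = Suc b'"
      by (metis not0_implies_Suc)
    obtain e where "kap (-1) i ((ad i ^^ a) y) = qs e * (ad i ^^ a) (kap (-1) i y)"
      using kap_ad_pow by blast
    then have k: "(ad i ^^ a) (kap (-1) i y) \<in> serre_ideal"
      using serre_ideal_kap [OF Suc.prems(1), of "-1" i] by (simp add: serre_ideal_scal_iff)
    have 1: "(ad i ^^ (a' + b)) (ad i y * z) \<in> serre_ideal"
      using Suc.prems Suc.hyps(2) ab by (intro Suc.hyps(1)) (simp_all add: funpow_swap1)
    have 2: "(ad i ^^ (a + b')) (kap (-1) i y * ad i z) \<in> serre_ideal"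
      using Suc.prems Suc.hyps(2) ab k by (intro Suc.hyps(1)) (simp_all add: funpow_swap1)
    have "(ad i ^^ (a + b)) (y * z) = (ad i ^^ s) (ad i (y * z))"
      using Suc.hyps(2) by (simp add: funpow_swap1 flip: Suc.hyps(2))
    also have "\<dots> \<in> serre_ideal"
      using 1 2 Suc.hyps(2) ab
      by (simp add: ad_mult lin_add [OF lin_funpow [OF lin_ad]] lin_add [OF lin_ad] serre_ideal.add)
    finally show ?thesis .
  qed
qed

lemma nilp_mult: "x \<in> nilp i \<Longrightarrow> y \<in> nilp i \<Longrightarrow> x * y \<in> nilp i"
  unfolding nilp_def using ad_pow_mult
  by (fastforce simp: der_mult intro: serre_ideal.add serre_ideal_left serre_ideal_right)

inductive_set nilp_span :: "'g \<Rightarrow> ('g word \<Rightarrow>\<^sub>0 Qq) set" for i where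
  base: "u \<in> nilp i \<Longrightarrow> u \<in> nilp_span i"
| step: "t \<in> nilp_span i \<Longrightarrow> letter i * t \<in> nilp_span i"
| add: "s \<in> nilp_span i \<Longrightarrow> t \<in> nilp_span i \<Longrightarrow> s + t \<in> nilp_span i"

lemma nilp_span_scal: "t \<in> nilp_span i \<Longrightarrow> scal c * t \<in> nilp_span i"
  by (induction rule: nilp_span.induct)
    (auto simp: distrib_left simp flip: letter_scal intro: nilp_span.intros nilp_scal)

text \<open>A factor \<open>u\<close> moves past \<open>f_i\<close> at the cost of a term with
  \<open>ad i (kap 1 i u)\<close>, which again lies in \<open>nilp i\<close>; the induction then
  continues with the shorter \<open>t\<close>.\<close>

lemma nilp_mult_span: "t \<in> nilp_span i \<Longrightarrow> u \<in> nilp i \<Longrightarrow> u * t \<in> nilp_span i"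
proof (induction arbitrary: u rule: nilp_span.induct)
  case (base u')
  then show ?case by (intro nilp_span.base nilp_mult)
next
  case (step t)
  have "u * (letter i * t) = letter i * (kap 1 i u * t) + scal (-1) * (ad i (kap 1 i u) * t)"
    by (simp add: ad_def kap_kap algebra_simps scal_minus)
  moreover have "kap 1 i u * t \<in> nilp_span i" "ad i (kap 1 i u) * t \<in> nilp_span i"
    using step by (auto intro: nilp_ad nilp_kap)
  ultimately show ?case
    by (auto intro: nilp_span.intros nilp_span_scal)
qed (auto simp: distrib_left intro: nilp_span.add)

lemma over_nilp_span:
  assumes i: "i \<in> J" and x: "x \<in> over J"
  shows "x \<in> nilp_span i"
  using x
proof (induction rule: over_induct)
  case zero
  show ?case using nilp_span_scal [OF nilp_span.base [OF nilp_1], of 0] by simp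
next
  case (word c w)
  then have "wmon w \<in> nilp_span i"
  proof (induction w)
    case Nil
    show ?case by (simp add: nilp_span.base nilp_1)
  next
    case (Cons j w)
    then show ?case
      using i nilp_mult_span [OF _ nilp_letter, of "wmon w" i j] by (cases "i = j") (auto simp: wmon_Cons intro: nilp_span.step)
  qed
  then show ?case by (rule nilp_span_scal)
qed (rule nilp_span.add)

lemma nilp_0: "0 \<in> nilp i"
  using nilp_scal [OF nilp_1, of 0] by simp

lemma nilp_span_sum:
  "t \<in> nilp_span i \<Longrightarrow> \<exists>n u. (\<forall>k. u k \<in> nilp i) \<and> t = (\<Sum>k<n. letter i ^ k * u k)"
proof (induction rule: nilp_span.induct)
  case (base u)
  then show ?case
    by (intro exI [of _ 1] exI [of _ "\<lambda>_. u"]) simp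
next
  case (step t)
  then obtain n u where u: "\<And>k. u k \<in> nilp i" and t: "t = (\<Sum>k<n. letter i ^ k * u k)" by blast
  have "letter i * t = (\<Sum>k<Suc n. letter i ^ k * (case k of 0 \<Rightarrow> 0 | Suc k \<Rightarrow> u k))"
    unfolding t sum.lessThan_Suc_shift sum_distrib_left by (simp add: mult.assoc)
  then show ?case
    using u by (intro exI [of _ "Suc n"] exI [of _ "\<lambda>k. case k of 0 \<Rightarrow> 0 | Suc k \<Rightarrow> u k"])
      (auto split: nat.split simp: nilp_0)
next
  case (add s t)
  then obtain n u n' u' where u: "\<And>k. u k \<in> nilp i" and s: "s = (\<Sum>k<n. letter i ^ k * u k)"
    and u': "\<And>k. u' k \<in> nilp i" and t: "t = (\<Sum>k<n'. letter i ^ k * u' k)" by blast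
  define w where "w k = (if k < n then u k else 0) + (if k < n' then u' k else 0)" for k
  have ext: "(\<Sum>k<l. letter i ^ k * x k) = (\<Sum>k<max n n'. letter i ^ k * (if k < l then x k else 0))"
    if "l \<le> max n n'" for l and x :: "nat \<Rightarrow> 'g word \<Rightarrow>\<^sub>0 Qq"
    using that by (intro sum.mono_neutral_cong_left) auto
  have "s + t = (\<Sum>k<max n n'. letter i ^ k * w k)"
    unfolding s t w_def distrib_left sum.distrib by (simp add: ext [of n] ext [of n'])
  moreover have "\<forall>k. w k \<in> nilp i"
    using u u' by (auto simp: w_def intro: nilp_add nilp_0)
  ultimately show ?case by blast
qed

text \<open>Modulo the ideal the \<open>u k\<close> are constants for \<open>der i\<close>, so the
  sum is differentiated like a polynomial in \<open>f_i\<close> with coefficients written on the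
  right.\<close>

lemma der_nilp_sum:
  assumes i: "i \<in> J" and u: "\<And>k. u k \<in> nilp i"
  shows "der i (\<Sum>k<Suc n. letter i ^ k * u k)
    - (\<Sum>k<n. letter i ^ k * (scal (vv i powi int k * qnum (vv i) (Suc k)) * u (Suc k))) \<in> serre_ideal"
proof -
  have du: "der i (u k) \<in> serre_ideal" for k
    using u by (simp add: nilp_def)
  have "der i (\<Sum>k<Suc n. letter i ^ k * u k)
      - (\<Sum>k<n. letter i ^ k * (scal (vv i powi int k * qnum (vv i) (Suc k)) * u (Suc k)))
    = der i (u 0) + (\<Sum>k<n. kap 1 i (letter i ^ Suc k) * der i (u (Suc k)))"
    unfolding sum.lessThan_Suc_shift lin_add [OF lin_der] lin_sum [OF lin_der] der_mult
      der_power_letter [OF i] sum.distrib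
    by (simp add: mult.assoc scal_left_commute [of "letter i ^ _"])
  then show ?thesis
    by (simp only:) (intro serre_ideal.add serre_ideal_sum serre_ideal_left du)
qed

text \<open>Differentiation lowers the degree in \<open>f_i\<close>, so the induction hypothesis
  covers all coefficients but \<open>u 0\<close>, up to nonzero factors; subtracting their
  contributions leaves \<open>u 0\<close>.\<close>

lemma nilp_sum_indep:
  assumes i: "i \<in> J"
  shows "(\<And>k. u k \<in> nilp i) \<Longrightarrow> (\<Sum>k<n. letter i ^ k * u k) \<in> serre_ideal \<Longrightarrow> k < n \<Longrightarrow> u k \<in> serre_ideal"
proof (induction n arbitrary: u k)
  case (Suc n)
  have "der i (\<Sum>k<Suc n. letter i ^ k * u k) - (der i (\<Sum>k<Suc n. letter i ^ k * u k)
    - (\<Sum>k<n. letter i ^ k * (scal (vv i powi int k * qnum (vv i) (Suc k)) * u (Suc k)))) \<in> serre_ideal"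
    by (intro serre_ideal_diff [OF _ der_nilp_sum] serre_ideal_der Suc.prems i)
  then have "(\<Sum>k<n. letter i ^ k * (scal (vv i powi int k * qnum (vv i) (Suc k)) * u (Suc k))) \<in> serre_ideal"
    by simp
  then have "scal (vv i powi int k * qnum (vv i) (Suc k)) * u (Suc k) \<in> serre_ideal" if "k < n" for k
    using that Suc.prems by (intro Suc.IH [of "\<lambda>k. scal (vv i powi int k * qnum (vv i) (Suc k)) * u (Suc k)"] nilp_scal)
  then have S: "u (Suc k) \<in> serre_ideal" if "k < n" for k
    using that qnum_nz [OF vv_gt_1 [OF i]] vv_gt_1 [OF i] by (subst (asm) serre_ideal_scal_iff) auto
  have "(\<Sum>k<Suc n. letter i ^ k * u k) - (\<Sum>k<n. letter i ^ Suc k * u (Suc k)) \<in> serre_ideal"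
    using S by (intro serre_ideal_diff Suc.prems serre_ideal_sum serre_ideal_left) auto
  then have "u 0 \<in> serre_ideal"
    unfolding sum.lessThan_Suc_shift by simp
  then show ?case
    using S Suc.prems(3) by (cases k) auto
qed simp

text \<open>Independence applied to the derivative puts all coefficients except \<open>u 0\<close>
  into the ideal, and \<open>u 0\<close> is nilpotent by the definition of
  \<open>nilp\<close>.\<close>

lemma ad_nilpotent:
  assumes i: "i \<in> J" and x: "x \<in> over J" and der: "der i x \<in> serre_ideal"
  shows "\<exists>n. (ad i ^^ n) x \<in> serre_ideal"
proof -
  obtain n u where u: "\<And>k. u k \<in> nilp i" and xs: "x = (\<Sum>k<n. letter i ^ k * u k)"
    using nilp_span_sum [OF over_nilp_span [OF i x]] by blast
  show ?thesis
  proof (cases n)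
    case 0
    then show ?thesis using xs by (intro exI [of _ 0]) (simp add: serre_ideal.zero)
  next
    case (Suc l)
    have "der i x - (der i x
      - (\<Sum>k<l. letter i ^ k * (scal (vv i powi int k * qnum (vv i) (Suc k)) * u (Suc k)))) \<in> serre_ideal"
      unfolding xs Suc by (intro serre_ideal_diff [OF _ der_nilp_sum] i u) (use der xs Suc in simp)
    then have "(\<Sum>k<l. letter i ^ k * (scal (vv i powi int k * qnum (vv i) (Suc k)) * u (Suc k))) \<in> serre_ideal"
      by simp
    then have "scal (vv i powi int k * qnum (vv i) (Suc k)) * u (Suc k) \<in> serre_ideal" if "k < l" for k
      using that u by (intro nilp_sum_indep [OF i, of "\<lambda>k. scal (vv i powi int k * qnum (vv i) (Suc k)) * u (Suc k)"] nilp_scal)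
    then have S: "u (Suc k) \<in> serre_ideal" if "k < l" for k
      using that qnum_nz [OF vv_gt_1 [OF i]] vv_gt_1 [OF i] by (subst (asm) serre_ideal_scal_iff) auto
    have r: "(\<Sum>k<l. letter i ^ Suc k * u (Suc k)) \<in> serre_ideal"
      using S by (intro serre_ideal_sum serre_ideal_left) auto
    obtain a where "(ad i ^^ a) (u 0) \<in> serre_ideal"
      using u [of 0] by (auto simp: nilp_def)
    then have "(ad i ^^ a) (u 0 + (\<Sum>k<l. letter i ^ Suc k * u (Suc k))) \<in> serre_ideal"
      using serre_ideal_ad_pow [OF r]
      by (simp add: lin_add [OF lin_funpow [OF lin_ad]] serre_ideal.add del: power_Suc)
    moreover have "x = u 0 + (\<Sum>k<l. letter i ^ Suc k * u (Suc k))"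
      unfolding xs Suc sum.lessThan_Suc_shift by simp
    ultimately show ?thesis by blast
  qed
qed

text \<open>Iterating the commutation rule contributes one summand for each weight \<beta> + k
  \<alpha>_i of the string. The sum is not condensed into quantum integers, since only its sign
  matters later.\<close>

lemma rder_ad_pow:
  assumes i: "i \<in> J" and h: "homog \<beta> x" and r: "rder i x \<in> serre_ideal"
  shows "rder i ((ad i ^^ Suc n) x) - scal (\<Sum>k\<le>n. q powi (wt i \<beta> + int k * bil i i) - q powi (- (wt i \<beta> + int k * bil i i)))
    * (ad i ^^ n) x \<in> serre_ideal"
proof (induction n)
  case 0
  show ?case
    using serre_ideal_ad [OF r]
    by (simp add: rder_ad kap_homog [OF h] scal_diff left_diff_distrib)
next
  case (Suc n)
  define s where "s n = (\<Sum>k\<le>n. q powi (wt i \<beta> + int k * bil i i) - q powi (- (wt i \<beta> + int k * bil i i)))" for n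
  define y where "y = (ad i ^^ Suc n) x"
  define p where "p = wt i \<beta> + int (Suc n) * bil i i"
  have hy: "homog (replicate_mset (Suc n) i + \<beta>) y"
    unfolding y_def by (rule ad_pow_homog [OF h])
  have w: "wt i (replicate_mset (Suc n) i + \<beta>) = p"
    by (simp add: wt_add p_def algebra_simps)
  have "ad i (rder i y - scal (s n) * (ad i ^^ n) x) \<in> serre_ideal"
    using Suc by (intro serre_ideal_ad) (simp add: s_def y_def)
  then have "ad i (rder i y) - scal (s n) * y \<in> serre_ideal"
    by (simp add: lin_diff [OF lin_ad] y_def)
  moreover have "ad i (rder i y) - scal (s n) * y = rder i ((ad i ^^ Suc (Suc n)) x) - scal (s (Suc n)) * y"
  proof -
    have "(ad i ^^ Suc (Suc n)) x = ad i y"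
      by (simp add: y_def)
    then have "rder i ((ad i ^^ Suc (Suc n)) x) = ad i (rder i y) + qs p * y - qs (- p) * y"
      by (simp only: rder_ad kap_homog [OF hy] w) simp
    moreover have "s (Suc n) = s n + (q powi p - q powi (- p))"
      by (simp add: s_def p_def)
    ultimately show ?thesis
      by (simp only: scal_add scal_diff distrib_right left_diff_distrib) (simp only: algebra_simps)
  qed
  ultimately show ?case
    unfolding s_def y_def by simp
qed

text \<open>Here \<open>x\<close> is a highest weight vector of a locally finite representation of quantum \<open>sl\<^sub>2\<close>.\<close>

lemma wt_nonpos:
  assumes i: "i \<in> J" and h: "homog \<beta> x" and x: "x \<in> over J" "x \<notin> serre_ideal"
    and der: "der i x \<in> serre_ideal" and rder: "rder i x \<in> serre_ideal"
  shows "wt i \<beta> \<le> 0"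
proof (rule ccontr)
  assume "\<not> wt i \<beta> \<le> 0"
  then have pos: "0 < wt i \<beta> + int k * bil i i" for k
    using d_pos [OF i] bil_self [OF i] by (simp add: add_pos_nonneg)
  define P where "P n \<longleftrightarrow> (ad i ^^ n) x \<in> serre_ideal" for n
  have "\<exists>n. P n"
    using ad_nilpotent [OF i x(1) der] by (simp add: P_def)
  moreover have "\<not> P 0"
    using x(2) by (simp add: P_def)
  \<comment> \<open>A last power of \<open>ad i\<close> that does not vanish modulo the ideal:
    applying \<open>rder i\<close> to the next power returns a positive multiple of it, which is
    absurd.\<close>
  ultimately obtain n where n: "\<not> P n" "P (Suc n)"
    using nat_induct [of "\<lambda>n. \<not> P n"] by blast
  define c where "c = (\<Sum>k\<le>n. q powi (wt i \<beta> + int k * bil i i) - q powi (- (wt i \<beta> + int k * bil i i)))"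
  have "0 < c"
    unfolding c_def
  proof (rule sum_pos)
    fix k
    show "0 < q powi (wt i \<beta> + int k * bil i i) - q powi (- (wt i \<beta> + int k * bil i i))"
    proof -
      have 1: "1 < q powi (wt i \<beta> + int k * bil i i)"
        by (rule q_powi_gt_1 [OF pos])
      then have "inverse (q powi (wt i \<beta> + int k * bil i i)) < 1"
        by (simp add: inverse_less_1_iff)
      with 1 show ?thesis
        unfolding power_int_minus by linarith
    qed
  qed auto
  have "rder i ((ad i ^^ Suc n) x) - (rder i ((ad i ^^ Suc n) x) - scal c * (ad i ^^ n) x) \<in> serre_ideal"
    unfolding c_def using n(2)
    by (intro serre_ideal_diff [OF serre_ideal_rder rder_ad_pow [OF i h rder]]) (simp add: P_def)
  then have "(ad i ^^ n) x \<in> serre_ideal"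
    using \<open>0 < c\<close> by (simp add: serre_ideal_scal_iff del: funpow.simps)
  with n(1) show False by (simp add: P_def)
qed

end

section \<open>Nondegeneracy of the form\<close>

lemma sum_fun_apply: "(\<Sum>x\<in>X. f x) y = (\<Sum>x\<in>X. f x y)"
  by (induction X rule: infinite_finite_induct) simp_all

text \<open>Any linear map \<open>g\<close> has a linear \<open>h\<close> with
  \<open>g (h (g v)) = g v\<close>, and \<open>H\<close> is the matrix of \<open>h\<close>. This
  suffices for expanding words through their pairings even when the Gram matrix is singular.\<close>

lemma generalized_inverse:
  fixes G :: "'a \<Rightarrow> 'a \<Rightarrow> 'k::field"
  assumes fin: "finite W"
  shows "\<exists>H. \<forall>w\<in>W. \<forall>w'\<in>W. (\<Sum>a\<in>W. \<Sum>b\<in>W. G w a * H a b * G b w') = G w w'"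
proof -
  define s :: "'k \<Rightarrow> ('a \<Rightarrow> 'k) \<Rightarrow> 'a \<Rightarrow> 'k" where "s c f = (\<lambda>x. c * f x)" for c f
  interpret vs: vector_space s
    by unfold_locales (auto simp: s_def fun_eq_iff algebra_simps)
  interpret vp: vector_space_pair s s ..
  define g where "g f = (\<lambda>w. if w \<in> W then \<Sum>a\<in>W. G w a * f a else 0)" for f
  have g: "Vector_Spaces.linear s s g"
    by unfold_locales (auto simp: s_def g_def fun_eq_iff sum.distrib sum_distrib_left algebra_simps)
  obtain h where h: "Vector_Spaces.linear s s h" and gh: "\<And>v. g (h (g v)) = g v"
    using vp.linear_exists_right_inverse_on [OF g vs.subspace_UNIV] by auto
  define e :: "'a \<Rightarrow> 'a \<Rightarrow> 'k" where "e b = (\<lambda>x. if x = b then 1 else 0)" for b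
  have ge: "g (e w') = (\<Sum>b\<in>W. s (G b w') (e b))" if "w' \<in> W" for w'
  proof
    fix x
    have "(\<Sum>b\<in>W. s (G b w') (e b)) x = (\<Sum>b\<in>W. if b = x then G b w' else 0)"
      unfolding sum_fun_apply by (intro sum.cong refl) (auto simp: s_def e_def)
    moreover have "(\<Sum>a\<in>W. G x a * e w' a) = (\<Sum>a\<in>W. if a = w' then G x a else 0)"
      by (intro sum.cong refl) (auto simp: e_def)
    ultimately show "g (e w') x = (\<Sum>b\<in>W. s (G b w') (e b)) x"
      using that fin by (simp add: g_def)
  qed
  have "(\<Sum>a\<in>W. \<Sum>b\<in>W. G w a * h (e b) a * G b w') = G w w'" if w: "w \<in> W" "w' \<in> W" for w w'
  proof -
    have hs: "h (\<Sum>b\<in>W. s (G b w') (e b)) = (\<Sum>b\<in>W. s (G b w') (h (e b)))"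
      by (simp add: vp.linear_sum [OF h] vp.linear_scale [OF h])
    have "G w w' = g (e w') w"
      using w fin by (simp add: g_def e_def if_distrib [of "\<lambda>x. _ * x"] cong: if_cong)
    also have "\<dots> = g (h (g (e w'))) w"
      by (simp add: gh)
    also have "\<dots> = (\<Sum>a\<in>W. G w a * (\<Sum>b\<in>W. G b w' * h (e b) a))"
      unfolding ge [OF w(2)] hs using w by (simp add: g_def sum_fun_apply s_def)
    also have "\<dots> = (\<Sum>a\<in>W. \<Sum>b\<in>W. G w a * h (e b) a * G b w')"
      by (simp add: sum_distrib_left mult_ac)
    finally show ?thesis by simp
  qed
  then show ?thesis
    by (intro exI [of _ "\<lambda>a b. h (e b) a"]) blast
qed

text \<open>As \<open>G\<close> is block diagonal along \<open>f\<close>, deleting the entries of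
  \<open>H\<close> outside the blocks does not affect the triple product. With \<open>f\<close> the
  letter content, expansions through \<open>H\<close> stay homogeneous.\<close>

lemma generalized_inverse_block:
  fixes G :: "'a \<Rightarrow> 'a \<Rightarrow> 'k::field"
  assumes fin: "finite W" and G: "\<And>a b. G a b \<noteq> 0 \<Longrightarrow> f a = f b"
  obtains H where "\<And>a b. H a b \<noteq> 0 \<Longrightarrow> f a = f b"
    and "\<And>w w'. w \<in> W \<Longrightarrow> w' \<in> W \<Longrightarrow> (\<Sum>a\<in>W. \<Sum>b\<in>W. G w a * H a b * G b w') = G w w'"
proof -
  obtain H where H: "\<And>w w'. w \<in> W \<Longrightarrow> w' \<in> W \<Longrightarrow> (\<Sum>a\<in>W. \<Sum>b\<in>W. G w a * H a b * G b w') = G w w'"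
    using generalized_inverse [OF fin, of G] by blast
  define H' where "H' a b = (if f a = f b then H a b else 0)" for a b
  have "(\<Sum>a\<in>W. \<Sum>b\<in>W. G w a * H' a b * G b w') = G w w'" if w: "w \<in> W" "w' \<in> W" for w w'
  proof (cases "f w = f w'")
    case True
    have "G w a * H' a b * G b w' = G w a * H a b * G b w'" for a b
      using G [of w a] G [of b w'] True by (cases "G w a = 0"; cases "G b w' = 0") (auto simp: H'_def)
    then have "(\<Sum>a\<in>W. \<Sum>b\<in>W. G w a * H' a b * G b w') = (\<Sum>a\<in>W. \<Sum>b\<in>W. G w a * H a b * G b w')"
      by (intro sum.cong refl)
    then show ?thesis using H [OF w] by simp
  next
    case False
    have "G w a * H' a b * G b w' = 0" for a b
      using G [of w a] G [of b w'] False by (cases "G w a = 0"; cases "G b w' = 0") (auto simp: H'_def)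
    then have "(\<Sum>a\<in>W. \<Sum>b\<in>W. G w a * H' a b * G b w') = 0"
      by (intro sum.neutral ballI)
    then show ?thesis using G [of w w'] False by auto
  qed
  then show ?thesis
    by (intro that [of H']) (simp_all add: H'_def split: if_splits)
qed

section \<open>Pairing, braided coproduct and antipode on words\<close>

context twist
begin

text \<open>The first letter acts first, which makes \<open>coef v\<close> the pairing with the word
  \<open>v\<close>. As a product of operators the letters appear in reversed order, hence the
  \<open>rev\<close> in later translations.\<close>

primrec ewd :: "'g list \<Rightarrow> ('g word \<Rightarrow>\<^sub>0 Qq) \<Rightarrow> 'g word \<Rightarrow>\<^sub>0 Qq" where
  "ewd [] p = p"
| "ewd (i # v) p = ewd v (der i p)"

definition coef :: "'g list \<Rightarrow> ('g word \<Rightarrow>\<^sub>0 Qq) \<Rightarrow> Qq" where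
  "coef v p = Poly_Mapping.lookup (ewd v p) 0"

lemma lin_ewd: "lin (ewd v)"
proof (induction v)
  case (Cons i v)
  then show ?case
    using lin_comp [OF Cons lin_der [of i]] by simp
qed (simp add: lin_id)

lemma ewd_append: "ewd (u @ v) p = ewd v (ewd u p)"
  by (induction u arbitrary: p) auto

lemma ewd_homog:
  "homog \<gamma> p \<Longrightarrow> (if mset v \<subseteq># \<gamma> then homog (\<gamma> - mset v) (ewd v p) else ewd v p = 0)"
proof (induction v arbitrary: \<gamma> p)
  case (Cons i v)
  show ?case
  proof (cases "i \<in># \<gamma>")
    case True
    then have "mset (i # v) \<subseteq># \<gamma> \<longleftrightarrow> mset v \<subseteq># \<gamma> - {#i#}"
      by (simp add: insert_subset_eq_iff)
    then show ?thesis
      using Cons.IH [OF der_homog [OF Cons.prems], of i] by auto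
  next
    case False
    then have "\<not> mset (i # v) \<subseteq># \<gamma>"
      by (auto dest: mset_subset_eq_insertD)
    then show ?thesis
      using der_homog_0 [OF Cons.prems False] by (simp add: lin_0 [OF lin_ewd])
  qed
qed simp

lemma coef_scal_mult: "coef v (scal c * p) = c * coef v p"
  by (simp add: coef_def lin_scal [OF lin_ewd] lookup_scal_mult)

lemma coef_add: "coef v (p + r) = coef v p + coef v r"
  by (simp add: coef_def lin_add [OF lin_ewd] lookup_add)

lemma coef_diff: "coef v (p - r) = coef v p - coef v r"
  by (simp add: coef_def lin_diff [OF lin_ewd] lookup_minus)

lemma coef_sum: "coef v (\<Sum>x\<in>A. f x) = (\<Sum>x\<in>A. coef v (f x))"
  by (simp add: coef_def lin_sum [OF lin_ewd] lookup_sum)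

lemma coef_Cons: "coef (i # v) p = coef v (der i p)"
  by (simp add: coef_def)

lemma coef_homog: "homog \<gamma> p \<Longrightarrow> coef v p \<noteq> 0 \<Longrightarrow> mset v = \<gamma>"
proof -
  assume p: "homog \<gamma> p" and c: "coef v p \<noteq> 0"
  then have v: "mset v \<subseteq># \<gamma>" and h: "homog (\<gamma> - mset v) (ewd v p)"
    using ewd_homog [OF p, of v] by (auto simp: coef_def split: if_splits)
  have "0 \<in> Poly_Mapping.keys (ewd v p)"
    using c by (simp add: coef_def in_keys_iff)
  then have "\<gamma> - mset v = {#}"
    using h by (auto simp: homog_def zero_word_def)
  with v show ?thesis
    by (metis Diff_eq_empty_iff_mset subset_mset.antisym)
qed

lemma coef_wmon_mset: "coef v (wmon w) \<noteq> 0 \<Longrightarrow> mset v = mset w"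
  by (rule coef_homog [of _ "wmon w"]) simp_all

lemma lin_scal_coef: "lin (\<lambda>p. scal (coef v p))"
  by (rule linI) (simp_all add: coef_add coef_scal_mult scal_add scal_mult)

lemma scal_coef_lext: "scal (coef v p) = lext (\<lambda>a. scal (coef v (wmon a))) p"
  by (rule lext_eqI [OF lin_scal_coef]) simp

lemma ewd_eq_coef: "homog (mset w) p \<Longrightarrow> ewd w p = scal (coef w p)"
  using ewd_homog [of "mset w" p w] homog_empty_scal by (simp add: coef_def)

text \<open>The form for which left multiplication by a letter and \<open>der\<close> are adjoint.
  Its values are constants of the free algebra rather than scalars, which makes it accessible to the
  rules for \<open>lin\<close>.\<close>

definition bform :: "('g word \<Rightarrow>\<^sub>0 Qq) \<Rightarrow> ('g word \<Rightarrow>\<^sub>0 Qq) \<Rightarrow> 'g word \<Rightarrow>\<^sub>0 Qq" where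
  "bform p r = lext (\<lambda>u. scal (coef u r)) p"

lemma bform_wmon [simp]: "bform (wmon u) r = scal (coef u r)"
  by (simp add: bform_def)

lemma lin_bform_left: "lin (\<lambda>p. bform p r)"
  unfolding bform_def by (rule lin_lext)

lemma lin_bform_right: "lin (bform p)"
  unfolding bform_def lext_def
  by (intro lin_setsum lin_mult_left lin_scal_coef)

lemma bform_letter_left: "bform (letter i * p) r = bform p (der i r)"
  by (rule lin_eqI [where p = p and \<phi> = "\<lambda>p. bform (letter i * p) r"])
    (auto intro!: lin_intros lin_comp [OF lin_bform_left] lin_bform_left
      simp: coef_Cons simp flip: wmon_Cons)

lemma bform_1_left [simp]: "bform 1 r = scal (Poly_Mapping.lookup r 0)"
  using bform_wmon [of "[]" r] by (simp add: coef_def del: bform_wmon)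

text \<open>By construction letters can be moved only out of the first argument. The same for the
  second argument is obtained by pushing \<open>der\<close> through the word in the first, and the
  two together give symmetry of the form.\<close>

lemma bform_letter_right: "bform r (letter i * z) = bform (der i r) z"
proof (rule lin_eqI [where p = r and \<phi> = "\<lambda>r. bform r (letter i * z)"])
  fix w
  show "bform (wmon w) (letter i * z) = bform (der i (wmon w)) z"
  proof (induction w arbitrary: z)
    case Nil
    have "0 \<notin> Poly_Mapping.keys (letter i * z)"
      using keys_mult [of "letter i" z] by (auto simp: letter_def plus_word_def zero_word_def)
    then show ?case
      by (simp add: lin_0 [OF lin_bform_left] in_keys_iff del: bform_wmon)
  next
    case (Cons j w)
    have "bform (wmon (j # w)) (letter i * z) = bform (wmon w) (if j = i then z else 0)
        + qs (bil j i) * bform (wmon w) (letter i * der j z)"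
      by (simp add: wmon_Cons bform_letter_left der_letter_mult lin_add [OF lin_bform_right]
          lin_scal [OF lin_bform_right] del: bform_wmon)
    also have "\<dots> = bform (der i (wmon (j # w))) z"
      by (simp add: Cons wmon_Cons der_letter_mult lin_add [OF lin_bform_left] bil_sym [of j i]
          lin_scal [OF lin_bform_left] bform_letter_left lin_0 [OF lin_bform_left]
          lin_0 [OF lin_bform_right] del: bform_wmon der_wmon)
    finally show ?case .
  qed
qed (auto intro!: lin_comp [OF lin_bform_left] lin_bform_left lin_der)

lemma bform_1_right [simp]: "bform r 1 = scal (Poly_Mapping.lookup r 0)"
proof (rule lin_eqI [where p = r and \<phi> = "\<lambda>r. bform r 1"])
  show "lin (\<lambda>p. scal (Poly_Mapping.lookup p 0))"
    by (rule linI) (simp_all add: lookup_add scal_add lookup_scal_mult scal_mult)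
  show "bform (wmon w) 1 = scal (Poly_Mapping.lookup (wmon w) 0)" for w
    by (cases w) (simp_all add: coef_def lookup_wmon zero_word_def lin_0 [OF lin_ewd])
qed (rule lin_bform_left)

lemma bform_sym: "bform p r = bform r p"
proof (rule lin_eqI [where p = p and \<phi> = "\<lambda>p. bform p r"])
  fix w
  show "bform (wmon w) r = bform r (wmon w)"
    by (induction w arbitrary: r)
      (simp_all add: wmon_Cons bform_letter_left bform_letter_right del: bform_wmon)
qed (rule lin_bform_left lin_bform_right)+

lemma bform_wmon_mult: "bform (wmon u * p) r = bform p (ewd u r)"
  by (induction u arbitrary: r) (simp_all add: wmon_Cons mult.assoc bform_letter_left)

text \<open>For the braided coproduct with primitive letters, \<open>conv A w\<close> is \<open>\<Sum> A(w\<^sub>1) w\<^sub>2\<close>; peeling off the first letter of \<open>w\<close>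
  from the left avoids tensor products.\<close>

fun conv :: "('g list \<Rightarrow> ('g word \<Rightarrow>\<^sub>0 Qq)) \<Rightarrow> 'g list \<Rightarrow> 'g word \<Rightarrow>\<^sub>0 Qq" where
  "conv A [] = A []"
| "conv A (i # w) = conv (\<lambda>a. A (i # a) + qs (wt i (mset a)) * (A a * letter i)) w"

lemma conv_zero: "conv (\<lambda>a. 0) w = 0"
  by (induction w) simp_all

lemma conv_add: "conv (\<lambda>a. A a + B a) w = conv A w + conv B w"
proof (induction w arbitrary: A B)
  case (Cons i w)
  show ?case
    by (simp add: Cons [symmetric]) (simp add: algebra_simps)
qed simp

lemma conv_sum: "conv (\<lambda>a. \<Sum>x\<in>X. A x a) w = (\<Sum>x\<in>X. conv (A x) w)"
  by (induction X rule: infinite_finite_induct) (simp_all add: conv_zero conv_add)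

lemma conv_left: "conv (\<lambda>a. z * A a) w = z * conv A w"
proof (induction w arbitrary: A)
  case (Cons i w)
  have "conv (\<lambda>a. z * A a) (i # w)
      = conv (\<lambda>a. z * (A (i # a) + qs (wt i (mset a)) * (A a * letter i))) w"
    by (simp add: distrib_left scal_left_commute [of z] mult.assoc)
  then show ?case
    by (simp add: Cons)
qed simp

text \<open>For \<open>z = 1\<close> this is the counit law.\<close>

lemma conv_unit: "conv (\<lambda>a. if a = [] then z else 0) w = z * wmon w"
proof (induction w arbitrary: z)
  case (Cons i w)
  have "(\<lambda>a. (if i # a = [] then z else 0) + qs (wt i (mset a)) * ((if a = [] then z else 0) * letter i))
      = (\<lambda>a. if a = [] then z * letter i else 0)"
    by auto
  then show ?case
    by (simp add: Cons wmon_Cons mult.assoc)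
qed simp

text \<open>Only the summand \<open>w \<otimes> 1\<close> of the coproduct has a first factor as
  long as \<open>w\<close>.\<close>

lemma conv_top: "(\<And>a. length a < length w \<Longrightarrow> A a = 0) \<Longrightarrow> conv A w = A w"
proof (induction w arbitrary: A)
  case (Cons i w)
  have "conv A (i # w) = A (i # w) + qs (wt i (mset w)) * (A w * letter i)"
    using Cons.prems by (simp add: Cons.IH)
  then show ?case
    using Cons.prems by simp
qed simp

text \<open>Coassociativity in disguise: \<open>der i\<close> contracts the first tensor factor with
  the dual of the letter \<open>i\<close>, which can be done before or after splitting the
  rest.\<close>

lemma conv_der: "conv (\<lambda>a. lext A (der_word i a)) w = lext (conv A) (der_word i w)"
proof (induction w arbitrary: A)
  case Nil
  then show ?case by (simp add: lin_0 [OF lin_lext])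
next
  case (Cons k w)
  define A' where "A' a = A (k # a) + qs (wt k (mset a)) * (A a * letter k)" for a
  have shift: "lext B (letter k * y) = lext (\<lambda>a. B (k # a)) y" for y and B :: "'g list \<Rightarrow> 'g word \<Rightarrow>\<^sub>0 Qq"
    by (rule lext_eqI [where \<phi> = "\<lambda>y. lext B (letter k * y)"])
      (auto intro!: lin_intros lin_comp [OF lin_lext] simp flip: wmon_Cons)
  \<comment> \<open>Every word in \<open>der_word i a\<close> has lost one letter \<open>i\<close>,
    hence the correction by \<open>bil k i\<close>.\<close>
  have tw: "lext (\<lambda>b. qs (wt k (mset b)) * (A b * letter k)) (der_word i a)
      = qs (wt k (mset a) - bil k i) * (lext A (der_word i a) * letter k)" for a
  proof (cases "i \<in> set a")
    case True
    have "lext (\<lambda>b. qs (wt k (mset b)) * (A b * letter k)) (der_word i a)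
      = lext (\<lambda>b. qs (wt k (mset a) - bil k i) * (A b * letter k)) (der_word i a)"
      using der_word_homog [of a i] True
      by (intro lext_cong) (auto simp: homog_def wt_remove)
    also have "\<dots> = qs (wt k (mset a) - bil k i) * (lext A (der_word i a) * letter k)"
      by (rule lext_eqI [symmetric, where \<phi> = "\<lambda>y. qs (wt k (mset a) - bil k i) * (lext A y * letter k)"])
        (auto intro!: lin_intros lin_lext)
    finally show ?thesis .
  next
    case False
    then show ?thesis
      using der_word_homog [of a i] by (simp add: lin_0 [OF lin_lext])
  qed
  have lA': "lext A' y = lext (\<lambda>b. A (k # b)) y + lext (\<lambda>b. qs (wt k (mset b)) * (A b * letter k)) y" for y
    by (rule lext_eqI [symmetric, where \<phi> = "\<lambda>y. lext (\<lambda>b. A (k # b)) y + lext (\<lambda>b. qs (wt k (mset b)) * (A b * letter k)) y"])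
      (auto intro!: lin_intros lin_lext simp: A'_def)
  have "lext A (der_word i (k # a)) + qs (wt k (mset a)) * (lext A (der_word i a) * letter k)
      = (if i = k then A a else 0) + qs (bil i k) * lext A' (der_word i a)" for a
    by (simp add: lA' tw lin_add [OF lin_lext] lin_scal [OF lin_lext] shift distrib_left qs_qs
        lin_0 [OF lin_lext] bil_sym [of i k] add.assoc)
  then have "conv (\<lambda>a. lext A (der_word i a)) (k # w)
      = conv (\<lambda>a. (if i = k then A a else 0) + qs (bil i k) * lext A' (der_word i a)) w"
    by simp
  also have "\<dots> = (if i = k then conv A w else 0) + qs (bil i k) * lext (conv A') (der_word i w)"
    unfolding conv_add conv_left Cons by (simp add: conv_zero)
  also have "lext (conv A') (der_word i w) = lext (conv A) (letter k * der_word i w)"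
  proof -
    have "A' = (\<lambda>a. A (k # a) + qs (wt k (mset a)) * (A a * letter k))"
      by (simp add: fun_eq_iff A'_def)
    then show ?thesis
      unfolding shift by simp
  qed
  finally show ?case
    by (simp add: lin_add [OF lin_lext] lin_scal [OF lin_lext] lin_0 [OF lin_lext])
qed

text \<open>Contracting the left factor of the coproduct with the functional of \<open>v\<close>
  gives the iterated derivation. This turns the middle terms of the antipode identity into
  derivatives.\<close>

lemma conv_coef: "conv (\<lambda>a. scal (coef v (wmon a))) w = ewd v (wmon w)"
proof (induction v arbitrary: w)
  case Nil
  have F: "(\<lambda>a. scal (coef [] (wmon a))) = (\<lambda>a. if a = [] then 1 else 0)"
    by (auto simp: coef_def lookup_wmon zero_word_def)
  show ?case
    unfolding F conv_unit by simp
next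
  case (Cons i v)
  have "conv (\<lambda>a. scal (coef (i # v) (wmon a))) w
      = conv (\<lambda>a. lext (\<lambda>b. scal (coef v (wmon b))) (der_word i a)) w"
    by (simp add: coef_Cons flip: scal_coef_lext)
  also have "\<dots> = lext (\<lambda>w. ewd v (wmon w)) (der_word i w)"
    unfolding conv_der by (intro lext_cong Cons)
  also have "\<dots> = ewd v (der_word i w)"
    by (rule lext_eqI [symmetric, OF lin_ewd]) simp
  finally show ?case by simp
qed

primrec pairs :: "'g list \<Rightarrow> int" where
  "pairs [] = 0"
| "pairs (i # w) = wt i (mset w) + pairs w"

text \<open>\<open>pairs_mset \<beta>\<close> is \<open>(\<beta>, \<beta>) - 2 (\<rho>, \<beta>)\<close>, the exponent of the scalar by which the square of the antipode acts.\<close>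

definition pairs_mset :: "'g multiset \<Rightarrow> int" where
  "pairs_mset \<beta> = (\<Sum>i\<in>#\<beta>. wt i \<beta> - bil i i)"

text \<open>\<open>pairs_mset\<close> counts every unordered pair of positions twice. Hence
  \<open>pairs\<close> depends only on the letter content, and the later division by 2 is
  exact.\<close>

lemma pairs_mset_double: "pairs_mset (mset w) = 2 * pairs w"
proof (induction w)
  case (Cons i w)
  have "(\<Sum>k\<in>#mset w. bil k i + wt k (mset w) - bil k k)
      = (\<Sum>k\<in>#mset w. bil k i) + (\<Sum>k\<in>#mset w. wt k (mset w) - bil k k)"
    unfolding sum_mset.distrib [symmetric] by (simp add: algebra_simps)
  also have "(\<Sum>k\<in>#mset w. bil k i) = wt i (mset w)"
    by (simp add: wt_def bil_sym [of i])
  finally show ?case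
    using Cons by (simp add: pairs_mset_def)
qed (simp add: pairs_mset_def)

text \<open>The antipode of the braided Hopf algebra: it negates letters and is an anti-homomorphism
  up to the power of \<open>q\<close> given by the pairing of the weights of the two
  factors.\<close>

definition antip_word :: "'g list \<Rightarrow> 'g word \<Rightarrow>\<^sub>0 Qq" where
  "antip_word w = scal ((-1) ^ length w * q powi pairs w) * wmon (rev w)"

definition antip :: "('g word \<Rightarrow>\<^sub>0 Qq) \<Rightarrow> 'g word \<Rightarrow>\<^sub>0 Qq" where
  "antip = lext antip_word"

lemma lin_antip: "lin antip"
  by (simp add: antip_def lin_lext)

lemma antip_homog:
  assumes "homog \<beta> p"
  shows "antip p = scal ((-1) ^ size \<beta> * q powi (pairs_mset \<beta> div 2)) * tau p"
proof -
  have "antip p = lext (\<lambda>w. scal ((-1) ^ size \<beta> * q powi (pairs_mset \<beta> div 2)) * wmon (rev w)) p"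
    unfolding antip_def
  proof (rule lext_cong)
    fix w assume "Word w \<in> Poly_Mapping.keys p"
    then have "mset w = \<beta>"
      using assms by (auto simp: homog_def)
    then show "antip_word w = scal ((-1) ^ size \<beta> * q powi (pairs_mset \<beta> div 2)) * wmon (rev w)"
      by (auto simp: antip_word_def pairs_mset_double)
  qed
  also have "\<dots> = scal ((-1) ^ size \<beta> * q powi (pairs_mset \<beta> div 2)) * tau p"
    by (rule lext_eqI [symmetric]) (auto intro!: lin_intros lin_tau)
  finally show ?thesis .
qed

text \<open>Once the first letter is peeled off, the function under \<open>conv\<close> is
  identically zero, as the extra power of \<open>q\<close> in \<open>pairs\<close> matches the
  braiding and the sign is opposite.\<close>

lemma conv_antip: "conv antip_word w = (if w = [] then 1 else 0)"
proof (cases w)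
  case (Cons i v)
  have "antip_word (i # a) + qs (wt i (mset a)) * (antip_word a * letter i) = 0" for a
    by (simp add: antip_word_def wmon_append mult.assoc scal_scal q_powi_add scal_minus mult_ac)
  then show ?thesis
    by (simp add: Cons conv_zero)
qed (simp add: antip_word_def)

end

section \<open>The Serre ideal is the radical of the form\<close>

context serre_data
begin

lemma serre_ideal_ewd: "x \<in> serre_ideal \<Longrightarrow> ewd v x \<in> serre_ideal"
  by (induction v arbitrary: x) (auto intro: serre_ideal_der)

lemma serre_ideal_coef: "x \<in> serre_ideal \<Longrightarrow> coef v x = 0"
  unfolding coef_def by (intro serre_ideal_const serre_ideal_ewd)

lemma serre_ideal_antip: "x \<in> serre_ideal \<Longrightarrow> antip x \<in> serre_ideal"
proof (erule serre_ideal_lin_self [OF lin_antip, rotated])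
  fix k j u w assume *: "k \<in> J" "j \<in> J" "k \<noteq> j"
  show "antip (wmon u * serre_el k j * wmon w) \<in> serre_ideal"
    unfolding antip_homog [OF serre_gen_homog]
    by (intro serre_ideal_scal serre_ideal_tau serre_ideal_sandwich serre_el_in *)
qed

lemma conv_in_serre_ideal:
  "(\<And>a. mset a \<subseteq># mset w \<Longrightarrow> A a \<in> serre_ideal) \<Longrightarrow> conv A w \<in> serre_ideal"
proof (induction w arbitrary: A)
  case (Cons i w)
  have "A (i # a) + qs (wt i (mset a)) * (A a * letter i) \<in> serre_ideal" if "mset a \<subseteq># mset w" for a
  proof -
    have "mset (i # a) \<subseteq># mset (i # w)" "mset a \<subseteq># mset (i # w)"
      using that by (auto intro: subset_mset.order_trans)
    then show ?thesis
      by (intro serre_ideal.add serre_ideal_scal serre_ideal_right Cons.prems)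
  qed
  then show ?case
    using Cons.IH by simp
qed simp

text \<open>The identity \<open>\<Sum> S(x\<^sub>1) x\<^sub>2 = 0\<close> of the braided Hopf algebra: its middle terms are expressed through
  the skew derivatives of \<open>x\<close>, because the form is nondegenerate in lower degrees.\<close>

lemma antip_primitive:
  assumes h: "homog \<beta> x" and ne: "\<beta> \<noteq> {#}" and J: "set_mset \<beta> \<subseteq> J"
    and der: "\<And>i. i \<in> J \<Longrightarrow> der i x \<in> serre_ideal"
    and IH: "\<And>\<gamma> y. \<lbrakk> size \<gamma> < size \<beta>; set_mset \<gamma> \<subseteq> J; homog \<gamma> y; \<And>w. mset w = \<gamma> \<Longrightarrow> coef w y = 0 \<rbrakk>
      \<Longrightarrow> y \<in> serre_ideal"
  shows "x + antip x \<in> serre_ideal"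
proof -
  define n where "n = size \<beta>"
  have n: "0 < n" using ne by (simp add: n_def nonempty_has_size)
  \<comment> \<open>The possible first factors of middle terms of the coproduct: neither empty nor
    of full length, so that the induction hypothesis is available.\<close>
  define W where "W = {w. set w \<subseteq> J \<and> 0 < length w \<and> length w < n}"
  have "W \<subseteq> {w. set w \<subseteq> J \<and> length w \<le> n}" by (auto simp: W_def)
  then have fin: "finite W"
    using finite_lists_length_le [OF finite_J, of n] by (rule finite_subset)
  obtain H where H0: "\<And>a b. H a b \<noteq> 0 \<Longrightarrow> mset a = mset b"
    and H: "\<And>w w'. w \<in> W \<Longrightarrow> w' \<in> W \<Longrightarrow>
      (\<Sum>a\<in>W. \<Sum>b\<in>W. coef w (wmon a) * H a b * coef b (wmon w')) = coef w (wmon w')"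
    using generalized_inverse_block [OF fin, of "\<lambda>v w. coef v (wmon w)" mset, OF coef_wmon_mset] by blast
  \<comment> \<open>The expansion of the word \<open>a\<close> through its pairings. Because
    \<open>G H G = G\<close>, it pairs like \<open>a\<close> with all words of that degree, so the
    two agree modulo the ideal by the induction hypothesis.\<close>
  define cmb where "cmb a = (\<Sum>b\<in>W. \<Sum>c\<in>W. scal (H b c * coef c (wmon a)) * wmon b)" for a
  have cmb: "wmon a - cmb a \<in> serre_ideal" if a: "a \<in> W" for a
  proof (rule IH [of "mset a"])
    show "size (mset a) < size \<beta>" "set_mset (mset a) \<subseteq> J"
      using a by (auto simp: W_def n_def)
    have "homog (mset a) (scal (H b c * coef c (wmon a)) * wmon b)" for b c
    proof (cases "H b c * coef c (wmon a) = 0")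
      case False
      then have "mset b = mset a"
        using H0 [of b c] coef_wmon_mset [of c a] by simp
      then show ?thesis by (simp add: homog_scal_mult)
    qed auto
    then show "homog (mset a) (wmon a - cmb a)"
      unfolding cmb_def by (intro homog_diff homog_sum) simp_all
    fix w assume "mset w = mset a"
    then have w: "w \<in> W"
      using a mset_eq_setD [of w a] mset_eq_length [of w a] by (auto simp: W_def)
    have "coef w (cmb a) = (\<Sum>b\<in>W. \<Sum>c\<in>W. coef w (wmon b) * H b c * coef c (wmon a))"
      unfolding cmb_def coef_sum by (intro sum.cong refl) (simp add: coef_scal_mult mult_ac)
    then show "coef w (wmon a - cmb a) = 0"
      by (simp add: coef_diff H [OF w a])
  qed
  \<comment> \<open>The antipode is split by its argument: \<open>A0\<close> (empty word) will yield
    \<open>x\<close>, \<open>A1\<close> (full length) will yield \<open>antip x\<close>,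
    \<open>A2\<close> expands the middle terms, and the error \<open>A3\<close> lies in the
    ideal.\<close>
  define A0 :: "'g list \<Rightarrow> 'g word \<Rightarrow>\<^sub>0 Qq" where "A0 a = (if a = [] then 1 else 0)" for a
  define A1 where "A1 a = (if n \<le> length a then antip_word a else 0)" for a
  define A2 where "A2 a = (\<Sum>b\<in>W. \<Sum>c\<in>W. (scal (H b c) * antip_word b) * scal (coef c (wmon a)))" for a
  define A3 where "A3 a = antip_word a - A0 a - A1 a - A2 a" for a
  have A2_0: "A2 a = 0" if "a \<notin> W" "set a \<subseteq> J" for a
    unfolding A2_def
  proof (intro sum.neutral ballI)
    fix b c assume c: "c \<in> W"
    have "coef c (wmon a) = 0"
    proof (rule ccontr)
      assume "coef c (wmon a) \<noteq> 0"
      then have "mset c = mset a" by (rule coef_wmon_mset)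
      then have "a \<in> W"
        using c mset_eq_setD [of c a] mset_eq_length [of c a] by (auto simp: W_def)
      with that show False by simp
    qed
    then show "scal (H b c) * antip_word b * scal (coef c (wmon a)) = 0" by simp
  qed
  have A2_1: "antip_word a - A2 a \<in> serre_ideal" if a: "a \<in> W" for a
  proof -
    have "antip (wmon a - cmb a) = antip_word a - A2 a"
      unfolding lin_diff [OF lin_antip] cmb_def A2_def lin_sum [OF lin_antip] lin_scal [OF lin_antip]
      by (simp add: antip_def scal_commute [of "_ * _" "coef _ _"] scal_scal mult.commute)
    then show ?thesis
      using serre_ideal_antip [OF cmb [OF a]] by simp
  qed
  have A3: "A3 a \<in> serre_ideal" if "set a \<subseteq> J" for a
  proof (cases "a \<in> W")
    case True
    then have "A3 a = antip_word a - A2 a"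
      by (auto simp: A3_def A0_def A1_def W_def)
    with A2_1 [OF True] show ?thesis by simp
  next
    case False
    then have "a = [] \<or> n \<le> length a"
      using that by (auto simp: W_def not_less)
    then consider "a = []" | "n \<le> length a" by blast
    then have "A3 a = 0"
      using n A2_0 [OF False that] by cases (auto simp: A3_def A0_def A1_def antip_word_def)
    then show ?thesis by (simp add: serre_ideal.zero)
  qed
  have keys: "mset w = \<beta>" if "Word w \<in> Poly_Mapping.keys x" for w
    using h that by (auto simp: homog_def)
  have "lext (conv antip_word) x = lext (\<lambda>w. 0) x"
    using keys [of "[]"] ne by (intro lext_cong) (auto simp: conv_antip)
  then have "lext (conv antip_word) x = 0"
    by (simp add: lext_def)
  moreover have "lext (conv antip_word) x
      = lext (\<lambda>w. wmon w + antip_word w + (\<Sum>b\<in>W. \<Sum>c\<in>W. (scal (H b c) * antip_word b) * ewd c (wmon w)) + conv A3 w) x"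
  proof (rule lext_cong)
    fix w assume "Word w \<in> Poly_Mapping.keys x"
    then have "length w = n"
      using keys by (metis n_def size_mset)
    have "conv antip_word w = conv (\<lambda>a. A0 a + A1 a + A2 a + A3 a) w"
      by (simp add: A3_def)
    also have "\<dots> = conv A0 w + conv A1 w + conv A2 w + conv A3 w"
      by (simp only: conv_add)
    also have "conv A0 w = wmon w"
      unfolding A0_def conv_unit by simp
    also have "conv A1 w = antip_word w"
      using \<open>length w = n\<close> by (subst conv_top) (auto simp: A1_def)
    also have "conv A2 w = (\<Sum>b\<in>W. \<Sum>c\<in>W. (scal (H b c) * antip_word b) * ewd c (wmon w))"
      unfolding A2_def conv_sum conv_left conv_coef ..
    finally show "conv antip_word w = wmon w + antip_word w
      + (\<Sum>b\<in>W. \<Sum>c\<in>W. (scal (H b c) * antip_word b) * ewd c (wmon w)) + conv A3 w" .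
  qed
  moreover have "\<dots> = x + antip x + (\<Sum>b\<in>W. \<Sum>c\<in>W. (scal (H b c) * antip_word b) * ewd c x) + lext (conv A3) x"
    by (rule lext_eqI [symmetric]) (auto intro!: lin_intros lin_antip lin_ewd lin_lext simp: antip_def)
  \<comment> \<open>Each \<open>c\<close> in \<open>W\<close> is nonempty, so its first derivation
    already sends \<open>x\<close> into the ideal.\<close>
  moreover have "ewd c x \<in> serre_ideal" if "c \<in> W" for c
    using that der by (cases c) (auto simp: W_def intro: serre_ideal_ewd)
  then have "(\<Sum>b\<in>W. \<Sum>c\<in>W. (scal (H b c) * antip_word b) * ewd c x) \<in> serre_ideal"
    by (intro serre_ideal_sum serre_ideal_left)
  moreover have "lext (conv A3) x \<in> serre_ideal"
  proof (rule lext_in [OF serre_ideal.zero serre_ideal.add serre_ideal_scal])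
    fix w assume "Word w \<in> Poly_Mapping.keys x"
    then have w: "mset w = \<beta>" by (rule keys)
    show "conv A3 w \<in> serre_ideal"
    proof (rule conv_in_serre_ideal)
      fix a assume "mset a \<subseteq># mset w"
      then have "set a \<subseteq> J"
        using J w set_mset_mono [of "mset a" "mset w"] by auto
      then show "A3 a \<in> serre_ideal" by (rule A3)
    qed
  qed
  ultimately show ?thesis
    using serre_ideal_minus [OF serre_ideal.add]
    by (metis (no_types, lifting) add.assoc eq_neg_iff_add_eq_0)
qed

text \<open>An element \<open>y\<close> of minimal degree in the radical but not in the Serre ideal is primitive on both sides. Then
  \<open>(\<alpha>\<^sub>i, \<beta>) \<le> 0\<close> for all \<open>i\<close>, so \<open>(\<beta>, \<beta>) - 2 (\<rho>, \<beta>) < 0\<close>, whereas the antipode maps \<open>y\<close> to \<open>-y\<close> and its square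
  multiplies \<open>y\<close> by \<open>q\<close> to this power.\<close>

theorem nondegenerate_homog:
  "\<lbrakk> set_mset \<beta> \<subseteq> J; homog \<beta> y; \<And>w. mset w = \<beta> \<Longrightarrow> coef w y = 0 \<rbrakk> \<Longrightarrow> y \<in> serre_ideal"
proof (induction "size \<beta>" arbitrary: \<beta> y rule: less_induct)
  case less
  show ?case
  proof (cases "\<beta> = {#}")
    case True
    then have "y = scal (Poly_Mapping.lookup y 0)"
      using less.prems(2) by (intro homog_empty_scal) simp
    moreover have "Poly_Mapping.lookup y 0 = 0"
      using less.prems(3) [of "[]"] True by (simp add: coef_def)
    ultimately show ?thesis
      by (metis scal_0 serre_ideal.zero)
  next
    case False
    have sub: "size (\<beta> - {#i#}) < size \<beta>" "set_mset (\<beta> - {#i#}) \<subseteq> J" if "i \<in># \<beta>" for i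
      using that less.prems(1) by (auto simp: size_Diff1_less dest: in_diffD)
    have der: "der i y \<in> serre_ideal" for i
    proof (cases "i \<in># \<beta>")
      case True
      show ?thesis
      proof (rule less.hyps [OF sub [OF True] der_homog [OF less.prems(2)]])
        fix w assume "mset w = \<beta> - {#i#}"
        then have "mset (i # w) = \<beta>" using True by simp
        then show "coef w (der i y) = 0"
          using less.prems(3) by (metis coef_Cons)
      qed
    next
      case False
      then show ?thesis
        using der_homog_0 [OF less.prems(2)] by (simp add: serre_ideal.zero)
    qed
    show ?thesis
    proof (rule ccontr)
      assume y: "y \<notin> serre_ideal"
      have rder: "rder j y \<in> serre_ideal" for j
      proof (cases "j \<in># \<beta>")
        case True
        show ?thesis
        proof (rule less.hyps [OF sub [OF True] rder_homog [OF less.prems(2)]])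
          fix w assume w: "mset w = \<beta> - {#j#}"
          show "coef w (rder j y) = 0"
          \<comment> \<open>The first letter of \<open>w\<close> gives a left derivation, which
            commutes with \<open>rder j\<close> and sends \<open>y\<close> into the ideal. An empty
            \<open>w\<close> has no such letter; then \<open>y\<close> is a multiple of one letter,
            and its pairing with that letter forces it to vanish.\<close>
          proof (cases w)
            case Nil
            then have "\<beta> = {#j#}"
              using w True by (metis add.left_neutral insert_DiffM mset.simps(1))
            then have "y = lext (\<lambda>v. letter j) y"
              using less.prems(2) lext_id [of y]
              by (subst lext_cong [where g = wmon]) (auto simp: homog_def mset_single_iff)
            also have "lext (\<lambda>v. letter j) y = lext (\<lambda>v. scal 1) y * letter j"
              by (rule lext_eqI [symmetric]) (auto intro!: lin_intros lin_lext)
            finally have yl: "y = lext (\<lambda>v. scal 1) y * letter j" .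
            have "lext (\<lambda>v. scal 1) y \<in> (range scal :: ('g word \<Rightarrow>\<^sub>0 Qq) set)"
              by (rule lext_in) (auto simp flip: scal_add scal_mult intro: image_eqI [of _ _ 0] simp del: scal_1)
            then obtain c where cc: "lext (\<lambda>v. scal 1) y = (scal c :: 'g word \<Rightarrow>\<^sub>0 Qq)" by blast
            have c: "y = scal c * letter j" by (rule yl [unfolded cc])
            have "coef [j] y = c"
              by (simp add: c coef_Cons) (simp add: coef_def scal_def)
            then have "c = 0"
              using less.prems(3) [of "[j]"] \<open>\<beta> = {#j#}\<close> by simp
            then show ?thesis
              using y c by (simp add: serre_ideal.zero)
          next
            case (Cons i v)
            then show ?thesis
              by (simp add: coef_Cons der_rder serre_ideal_coef serre_ideal_rder der)
          qed
        qed
      next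
        case False
        then show ?thesis
          using rder_homog_0 [OF less.prems(2)] by (simp add: serre_ideal.zero)
      qed
      have wt: "wt i \<beta> - bil i i < 0" if "i \<in># \<beta>" for i
      proof -
        have i: "i \<in> J" using that less.prems(1) by auto
        have "wt i \<beta> \<le> 0"
          using wt_nonpos [OF i less.prems(2) homog_over [OF less.prems(2,1)] y der rder] .
        then show ?thesis
          using d_pos [OF i] bil_self [OF i] by simp
      qed
      have neg: "(\<Sum>i\<in>#\<gamma>. wt i \<beta> - bil i i) < 0" if "\<gamma> \<noteq> {#}" "\<gamma> \<subseteq># \<beta>" for \<gamma>
        using that
      proof (induction \<gamma>)
        case (add i \<gamma>)
        have "i \<in># \<beta>" "\<gamma> \<subseteq># \<beta>"
          using add.prems(2) by (auto dest: mset_subset_eq_insertD)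
        then show ?case
          using add.IH wt [of i] by (cases "\<gamma> = {#}") auto
      qed simp
      have pneg: "pairs_mset \<beta> < 0"
        unfolding pairs_mset_def using neg False by blast
      define c where "c = (-1) ^ size \<beta> * q powi (pairs_mset \<beta> div 2)"
      have a: "y + antip y \<in> serre_ideal"
        using less.hyps by (intro antip_primitive [OF less.prems(2) False less.prems(1) der]) blast
      have S: "antip y = scal c * tau y"
        unfolding c_def by (rule antip_homog [OF less.prems(2)])
      \<comment> \<open>In this degree \<open>antip\<close> is the scalar \<open>c\<close> times
        reversal, and reversal is an involution.\<close>
      have "antip (antip y) = scal (c * c) * y"
        using antip_homog [OF tau_homog [OF less.prems(2)]] S
        by (simp add: lin_scal [OF lin_antip] scal_scal c_def)
      then have "antip y + scal (c * c) * y \<in> serre_ideal"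
        using serre_ideal_antip [OF a] by (simp add: lin_add [OF lin_antip])
      from serre_ideal_diff [OF a this] have "scal (1 - c * c) * y \<in> serre_ideal"
        by (simp add: scal_diff left_diff_distrib)
      then have "c * c = 1"
        using y by (cases "1 - c * c = 0") (simp_all add: serre_ideal_scal_iff)
      moreover have "c * c = q powi (2 * (pairs_mset \<beta> div 2))"
        by (simp add: c_def power_int_add [symmetric] mult_ac flip: power_add mult_2)
      ultimately have "2 * (pairs_mset \<beta> div 2) = 0"
        by (intro q_powi_eq_1) simp
      then show False
        using pneg by simp
    qed
  qed
qed

text \<open>Among the homogeneous components outside the ideal one of maximal size is chosen,
  together with a word pairing nontrivially with it. That word kills every other component outside
  the ideal, which is too small or has different letters.\<close>

theorem nondegenerate:
  assumes y: "y \<in> over J" "y \<notin> serre_ideal"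
  obtains w c where "set w \<subseteq> J" "c \<noteq> 0" "ewd w y - scal c \<in> serre_ideal"
proof -
  define C where "C = (\<lambda>w. mset (letters w)) ` Poly_Mapping.keys y"
  have finC: "finite C" by (simp add: C_def)
  define B where "B = {\<gamma>\<in>C. hpart \<gamma> y \<notin> serre_ideal}"
  have ys: "y = (\<Sum>\<gamma>\<in>C. hpart \<gamma> y)"
    unfolding C_def by (rule sum_hpart)
  have "B \<noteq> {}"
  proof
    assume "B = {}"
    then have "(\<Sum>\<gamma>\<in>C. hpart \<gamma> y) \<in> serre_ideal"
      by (intro serre_ideal_sum) (auto simp: B_def)
    then show False using y(2) ys by simp
  qed
  moreover have "finite B" using finC by (simp add: B_def)
  ultimately have "Max (size ` B) \<in> size ` B"
    by (intro Max_in) auto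
  then obtain \<gamma> where "Max (size ` B) = size \<gamma>" and \<gamma>: "\<gamma> \<in> B"
    by (rule imageE)
  then have max: "\<And>\<delta>. \<delta> \<in> B \<Longrightarrow> size \<delta> \<le> size \<gamma>"
    using \<open>finite B\<close> by (metis Max_ge finite_imageI imageI)
  have \<gamma>J: "set_mset \<gamma> \<subseteq> J"
    using \<gamma> y(1) unfolding B_def C_def over_def by fastforce
  obtain w where w: "mset w = \<gamma>" and c: "coef w (hpart \<gamma> y) \<noteq> 0"
    using nondegenerate_homog [OF \<gamma>J homog_hpart] \<gamma> by (auto simp: B_def)
  have w0: "ewd w (hpart \<delta> y) \<in> serre_ideal" if \<delta>: "\<delta> \<in> C - {\<gamma>}" for \<delta>
  proof (cases "\<delta> \<in> B")
    case True
    have "\<not> mset w \<subseteq># \<delta>"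
    proof
      assume "mset w \<subseteq># \<delta>"
      moreover have "size \<delta> \<le> size (mset w)"
        using max [OF True] w by simp
      ultimately have "mset w = \<delta>"
        by (metis mset_subset_size not_le subset_mset.le_imp_less_or_eq)
      then show False using \<delta> w by simp
    qed
    then have "ewd w (hpart \<delta> y) = 0"
      using ewd_homog [OF homog_hpart, of w \<delta> y] by simp
    then show ?thesis by (simp add: serre_ideal.zero)
  next
    case False
    then show ?thesis
      using \<delta> by (auto simp: B_def intro: serre_ideal_ewd)
  qed
  have "ewd w y = (\<Sum>\<delta>\<in>C. ewd w (hpart \<delta> y))"
    by (subst ys) (simp add: lin_sum [OF lin_ewd])
  also have "\<dots> = ewd w (hpart \<gamma> y) + (\<Sum>\<delta>\<in>C - {\<gamma>}. ewd w (hpart \<delta> y))"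
    using \<gamma> finC by (intro sum.remove) (auto simp: B_def)
  finally have "ewd w y - scal (coef w (hpart \<gamma> y)) = (\<Sum>\<delta>\<in>C - {\<gamma>}. ewd w (hpart \<delta> y))"
    using ewd_eq_coef [of w "hpart \<gamma> y"] w homog_hpart [of \<gamma> y] by simp
  then have "ewd w y - scal (coef w (hpart \<gamma> y)) \<in> serre_ideal"
    by (simp only:) (intro serre_ideal_sum w0)
  then show ?thesis
    using that [of w] c w \<gamma>J by auto
qed

corollary radical:
  assumes y: "y \<in> over J" and coef: "\<And>w. set w \<subseteq> J \<Longrightarrow> coef w y = 0"
  shows "y \<in> serre_ideal"
proof (rule ccontr)
  assume "y \<notin> serre_ideal"
  then obtain w c where w: "set w \<subseteq> J" and c: "c \<noteq> 0" and i: "ewd w y - scal c \<in> serre_ideal"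
    using nondegenerate [OF y] by blast
  have "Poly_Mapping.lookup (ewd w y - scal c) 0 = 0"
    by (rule serre_ideal_const [OF i])
  then show False
    using coef [OF w] c by (simp add: coef_def lookup_minus scal_def)
qed

end

section \<open>The boson algebra\<close>

lemma scal_eq_iff: "(scal a :: 'g word \<Rightarrow>\<^sub>0 Qq) = scal b \<longleftrightarrow> a = b"
  by (metis lookup_single_eq scal_def)

context serre_data
begin

text \<open>The outer words of a spanning element of the ideal may contain foreign letters. Applying
  \<open>restrict_letters J\<close> removes such summands and fixes \<open>x\<close>.\<close>

lemma serre_ideal_over:
  assumes x: "x \<in> serre_ideal" "x \<in> over J"
    and X: "0 \<in> X" "\<And>x y. x \<in> X \<Longrightarrow> y \<in> X \<Longrightarrow> x + y \<in> X" "\<And>c x. x \<in> X \<Longrightarrow> scal c * x \<in> X"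
    and gen: "\<And>i j u w. \<lbrakk> i \<in> J; j \<in> J; i \<noteq> j; set u \<subseteq> J; set w \<subseteq> J \<rbrakk> \<Longrightarrow> wmon u * serre_el i j * wmon w \<in> X"
  shows "x \<in> X"
proof -
  have "restrict_letters J x \<in> X"
  proof (rule serre_ideal_lin [OF lin_restrict_letters _ X x(1)])
    fix i j u w assume *: "i \<in> J" "j \<in> J" "i \<noteq> j"
    have "serre_el i j \<in> over J"
      using * by (intro homog_over [OF homog_serre_el]) (auto simp: set_mset_replicate_mset_subset)
    then have "restrict_letters J (wmon u * serre_el i j * wmon w) = restrict_letters J (wmon u) * serre_el i j * restrict_letters J (wmon w)"
      by (simp add: restrict_letters_mult restrict_letters_over)
    then show "restrict_letters J (wmon u * serre_el i j * wmon w) \<in> X"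
      using gen [OF *] X(1) by (simp add: restrict_letters_wmon)
  qed
  then show ?thesis
    by (simp add: restrict_letters_over [OF x(2)])
qed

lemma ewd_over: "y \<in> over A \<Longrightarrow> ewd w y \<in> over A"
  by (induction w arbitrary: y) (auto intro: der_over)

text \<open>The skew derivations satisfy the Serre relations modulo the Serre ideal: by symmetry of the form
  they are adjoint to multiplication by elements of the ideal, which lies in the radical.\<close>

lemma serre_ideal_acts_zero:
  assumes p: "p \<in> serre_ideal" and y: "y \<in> over J"
  shows "lext (\<lambda>u. ewd u y) p \<in> serre_ideal"
proof (rule radical)
  show "lext (\<lambda>u. ewd u y) p \<in> over J"
    by (rule lext_in [OF over_0 over_add over_scal_mult]) (simp_all add: ewd_over y)
  fix w
  \<comment> \<open>The operators given by \<open>p\<close> are adjoint to multiplication by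
    \<open>p\<close>. Symmetry then moves \<open>p * wmon w\<close>, an element of the ideal, to the
    side where \<open>coef\<close> annihilates it.\<close>
  have "bform z (lext (\<lambda>u. ewd u y) p) = bform (p * z) y" for z
    by (rule lin_eqI [where \<phi> = "\<lambda>p. bform z (lext (\<lambda>u. ewd u y) p)"])
      (auto intro!: lin_intros lin_comp [OF lin_bform_right] lin_comp [OF lin_bform_left] lin_lext
        simp: bform_wmon_mult)
  then have "scal (coef w (lext (\<lambda>u. ewd u y) p)) = bform y (p * wmon w)"
    by (metis bform_wmon bform_sym)
  also have "\<dots> = lext (\<lambda>u. 0) y"
    unfolding bform_def using p by (intro lext_cong) (simp add: serre_ideal_coef serre_ideal_right)
  also have "\<dots> = (0 :: 'g word \<Rightarrow>\<^sub>0 Qq)"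
    by (simp add: lext_def)
  finally have "Poly_Mapping.lookup (scal (coef w (lext (\<lambda>u. ewd u y) p)) :: 'g word \<Rightarrow>\<^sub>0 Qq) 0 = 0"
    by simp
  then show "coef w (lext (\<lambda>u. ewd u y) p) = 0"
    by (simp add: scal_def)
qed

text \<open>A generalized inverse of the Gram matrix plays the role of dual bases of \<open>B\<^sup>-\<close> and \<open>B\<^sup>+\<close>.\<close>

lemma words_generalized_inverse:
  defines "W \<equiv> \<lambda>l. {w. set w \<subseteq> J \<and> length w = l}"
  obtains H where "\<And>a b. H a b \<noteq> 0 \<Longrightarrow> mset a = mset b"
    and "\<And>w. w \<in> W l \<Longrightarrow> wmon w - (\<Sum>a\<in>W l. \<Sum>b\<in>W l. scal (coef w (wmon a) * H a b) * wmon b) \<in> serre_ideal"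
proof -
  have fin: "finite (W l)"
    unfolding W_def using finite_lists_length_eq [OF finite_J] by simp
  obtain H where H0: "\<And>a b. H a b \<noteq> 0 \<Longrightarrow> mset a = mset b"
    and H: "\<And>w w'. w \<in> W l \<Longrightarrow> w' \<in> W l \<Longrightarrow>
      (\<Sum>a\<in>W l. \<Sum>b\<in>W l. coef w (wmon a) * H a b * coef b (wmon w')) = coef w (wmon w')"
    using generalized_inverse_block [OF fin, of "\<lambda>v w. coef v (wmon w)" mset, OF coef_wmon_mset] by blast
  \<comment> \<open>Symmetry of the Gram matrix turns pairings of \<open>v\<close> with the words
    \<open>b\<close> into entries to which the identity for \<open>H\<close> applies.\<close>
  have sym: "coef v (wmon w) = coef w (wmon v)" for v w
  proof -
    have "(scal (coef v (wmon w)) :: 'g word \<Rightarrow>\<^sub>0 Qq) = scal (coef w (wmon v))"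
      by (metis bform_sym bform_wmon)
    then show ?thesis by (simp add: scal_eq_iff)
  qed
  have "wmon w - (\<Sum>a\<in>W l. \<Sum>b\<in>W l. scal (coef w (wmon a) * H a b) * wmon b) \<in> serre_ideal"
    if w: "w \<in> W l" for w
  proof (rule radical)
    show "wmon w - (\<Sum>a\<in>W l. \<Sum>b\<in>W l. scal (coef w (wmon a) * H a b) * wmon b) \<in> over J"
      using w by (intro over_diff over_sum over_scal_mult) (auto simp: W_def)
    fix v assume v: "set v \<subseteq> J"
    have e: "coef v (wmon w - (\<Sum>a\<in>W l. \<Sum>b\<in>W l. scal (coef w (wmon a) * H a b) * wmon b))
        = coef w (wmon v) - (\<Sum>a\<in>W l. \<Sum>b\<in>W l. coef w (wmon a) * H a b * coef b (wmon v))"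
      by (simp add: coef_diff coef_sum coef_scal_mult sym [of v])
    show "coef v (wmon w - (\<Sum>a\<in>W l. \<Sum>b\<in>W l. scal (coef w (wmon a) * H a b) * wmon b)) = 0"
    proof (cases "length v = l")
      case True
      then show ?thesis
        unfolding e using H [OF w, of v] v by (simp add: W_def)
    next
      case False
      then have "coef b (wmon v) = 0" if "b \<in> W l" for b
        using that coef_wmon_mset [of b v] mset_eq_length [of b v] by (auto simp: W_def)
      then show ?thesis
        unfolding e using w by simp
    qed
  qed
  with H0 show ?thesis
    by (rule that)
qed

end

section \<open>Weight lattices and the Cartan data as an instance\<close>

lemma vector_space_fun_scale: "vector_space fun_scale"
  by unfold_locales (auto simp: fun_scale_def fun_eq_iff algebra_simps)

context kac_moody_data
begin

abbreviation "I \<equiv> index_set D"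
abbreviation "P \<equiv> weight_lattice D"
abbreviation "Q \<equiv> coweight_lattice D"
abbreviation "R0 \<equiv> free_algebra (boson_gens D)"
abbreviation "BI \<equiv> boson_ideal D"
abbreviation "B \<equiv> boson_algebra D"

lemma weight_linear:
  assumes "\<phi> \<in> P"
  shows "Vector_Spaces.linear (tscale D) (*) \<phi>"
proof -
  interpret vf: vector_space "fun_scale :: rat \<Rightarrow> ('t \<Rightarrow> rat) \<Rightarrow> _"
    by (rule vector_space_fun_scale)
  obtain S where S: "module.span fun_scale S = t_dual D"
    and P: "P = {\<Sum>s\<in>S. fun_scale (of_int (c s)) s | c :: ('t \<Rightarrow> rat) \<Rightarrow> int. True}"
    using lattice by (auto simp: is_lattice_def)
  obtain c :: "('t \<Rightarrow> rat) \<Rightarrow> int" where c: "\<phi> = (\<Sum>s\<in>S. fun_scale (of_int (c s)) s)"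
    using assms unfolding P by auto
  have "\<phi> \<in> module.span fun_scale S"
    unfolding c by (intro vf.span_sum vf.span_scale vf.span_base)
  then show ?thesis
    by (simp add: S t_dual_def)
qed

lemma weight_add: "\<phi> \<in> P \<Longrightarrow> \<phi> (x + y) = \<phi> x + \<phi> y"
  using weight_linear by (simp add: Vector_Spaces.linear_iff)

lemma weight_0: "\<phi> \<in> P \<Longrightarrow> \<phi> 0 = 0"
  using weight_add [of \<phi> 0 0] by simp

lemma weight_minus: "\<phi> \<in> P \<Longrightarrow> \<phi> (- x) = - \<phi> x"
  using weight_add [of \<phi> x "- x"] by (simp add: weight_0)

lemma weight_int: "\<phi> \<in> P \<Longrightarrow> h \<in> Q \<Longrightarrow> \<phi> h \<in> \<int>"
  by (simp add: coweight_lattice_def)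

lemma coweight_0: "0 \<in> Q"
  by (simp add: coweight_lattice_def weight_0)

lemma coweight_add: "h \<in> Q \<Longrightarrow> h' \<in> Q \<Longrightarrow> h + h' \<in> Q"
  by (simp add: coweight_lattice_def weight_add)

lemma coweight_minus: "h \<in> Q \<Longrightarrow> - h \<in> Q"
  by (simp add: coweight_lattice_def weight_minus)

lemma weight_lattice_add: "\<phi> \<in> P \<Longrightarrow> \<psi> \<in> P \<Longrightarrow> \<phi> + \<psi> \<in> P"
proof -
  obtain S where P: "P = {\<Sum>s\<in>S. fun_scale (of_int (c s)) s | c :: ('t \<Rightarrow> rat) \<Rightarrow> int. True}"
    using lattice by (auto simp: is_lattice_def)
  assume "\<phi> \<in> P" "\<psi> \<in> P"
  then obtain c c' :: "('t \<Rightarrow> rat) \<Rightarrow> int" where "\<phi> = (\<Sum>s\<in>S. fun_scale (of_int (c s)) s)"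
    "\<psi> = (\<Sum>s\<in>S. fun_scale (of_int (c' s)) s)"
    unfolding P by auto
  then have "\<phi> + \<psi> = (\<Sum>s\<in>S. fun_scale (of_int (c s + c' s)) s)"
    by (simp add: fun_eq_iff sum_fun_apply fun_scale_def sum.distrib distrib_right)
  then show ?thesis
    unfolding P by (intro CollectI exI [of _ "\<lambda>s. c s + c' s"]) simp
qed

lemma weight_lattice_uminus: "\<phi> \<in> P \<Longrightarrow> - \<phi> \<in> P"
proof -
  obtain S where P: "P = {\<Sum>s\<in>S. fun_scale (of_int (c s)) s | c :: ('t \<Rightarrow> rat) \<Rightarrow> int. True}"
    using lattice by (auto simp: is_lattice_def)
  assume "\<phi> \<in> P"
  then obtain c :: "('t \<Rightarrow> rat) \<Rightarrow> int" where "\<phi> = (\<Sum>s\<in>S. fun_scale (of_int (c s)) s)"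
    unfolding P by auto
  then have "- \<phi> = (\<Sum>s\<in>S. fun_scale (of_int (- c s)) s)"
    by (simp add: fun_eq_iff sum_fun_apply fun_scale_def sum_negf)
  then show ?thesis
    unfolding P by (intro CollectI exI [of _ "\<lambda>s. - c s"]) simp
qed

text \<open>Some \<open>x\<close> in the Cartan subalgebra distinguishes the two functions.
  Multiplying it by a common denominator \<open>N\<close> of the values at \<open>x\<close> of a
  lattice basis moves it into \<open>Q\<close>.\<close>

lemma weight_separation:
  assumes "\<phi> \<in> P" "\<psi> \<in> P" "\<phi> \<noteq> \<psi>"
  obtains h where "h \<in> Q" "\<phi> h \<noteq> \<psi> h"
proof -
  obtain S where finS: "finite S" and P: "P = {\<Sum>s\<in>S. fun_scale (of_int (c s)) s | c :: ('t \<Rightarrow> rat) \<Rightarrow> int. True}"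
    using lattice by (auto simp: is_lattice_def)
  obtain x where x: "\<phi> x \<noteq> \<psi> x"
    using assms(3) by (auto simp: fun_eq_iff)
  define N where "N = (\<Prod>s\<in>S. snd (quotient_of (s x)))"
  have N: "N \<noteq> 0"
    using finS quotient_of_denom_pos' by (simp add: N_def) (metis less_irrefl)
  have sN: "of_int N * s x \<in> \<int>" if "s \<in> S" for s
  proof -
    have "N = snd (quotient_of (s x)) * (\<Prod>s\<in>S - {s}. snd (quotient_of (s x)))"
      unfolding N_def using that finS by (intro prod.remove)
    moreover have "of_int (snd (quotient_of (s x))) * s x = of_int (fst (quotient_of (s x)))"
      using quotient_of_div [of "s x" "fst (quotient_of (s x))" "snd (quotient_of (s x))"]
        quotient_of_denom_pos' [of "s x"] by (simp add: field_simps)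
    ultimately have "of_int N * s x = of_int (fst (quotient_of (s x)) * (\<Prod>s\<in>S - {s}. snd (quotient_of (s x))))"
      by (simp add: mult_ac)
    then show ?thesis by (simp only: Ints_of_int)
  qed
  define h where "h = tscale D (of_int N) x"
  have sc: "\<chi> h = of_int N * \<chi> x" if "\<chi> \<in> P" for \<chi>
    using weight_linear [OF that] by (simp add: Vector_Spaces.linear_iff h_def)
  have "h \<in> Q"
    unfolding coweight_lattice_def
  proof safe
    fix \<chi> assume \<chi>: "\<chi> \<in> P"
    then obtain c :: "('t \<Rightarrow> rat) \<Rightarrow> int" where c: "\<chi> = (\<Sum>s\<in>S. fun_scale (of_int (c s)) s)"
      unfolding P by auto
    have "\<chi> h = (\<Sum>s\<in>S. of_int (c s) * (of_int N * s x))"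
      unfolding sc [OF \<chi>] by (simp add: c sum_fun_apply fun_scale_def sum_distrib_left mult_ac)
    also have "\<dots> \<in> \<int>"
      by (intro Ints_sum Ints_mult sN) auto
    finally show "\<chi> h \<in> \<int>" .
  qed
  moreover have "\<phi> h \<noteq> \<psi> h"
    using sc [OF assms(1)] sc [OF assms(2)] x N by simp
  ultimately show ?thesis by (rule that)
qed

text \<open>The letters of the preceding sections are the generators of \<open>B\<close> themselves, with \<open>F ` I\<close> as the set \<open>J\<close>: words in
  the \<open>f\<^sub>i\<close> then need no translation into elements of the free algebra presenting \<open>B\<close>.\<close>

fun bil :: "('i, 't) boson_gen \<Rightarrow> ('i, 't) boson_gen \<Rightarrow> int" where
  "bil (F i) (F j) = (if i \<in> I \<and> j \<in> I then \<lfloor>inner_prod D (simple_root D i) (simple_root D j)\<rfloor> else 0)"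
| "bil _ _ = 0"

fun dd :: "('i, 't) boson_gen \<Rightarrow> int" where
  "dd (F i) = \<lfloor>inner_prod D (simple_root D i) (simple_root D i) / 2\<rfloor>"
| "dd _ = 0"

fun mm :: "('i, 't) boson_gen \<Rightarrow> ('i, 't) boson_gen \<Rightarrow> nat" where
  "mm (F i) (F j) = nat \<lfloor>1 - cartan_entry D i j\<rfloor>"
| "mm _ _ = 0"

lemma inner_dd: "i \<in> I \<Longrightarrow> inner_prod D (simple_root D i) (simple_root D i) = 2 * of_int (dd (F i))"
  using inner_root [of i] by auto

lemma dd_pos: "i \<in> I \<Longrightarrow> 0 < dd (F i)"
  using inner_root [of i] by auto

lemma cartan_int: "i \<in> I \<Longrightarrow> j \<in> I \<Longrightarrow> cartan_entry D i j = of_int \<lfloor>cartan_entry D i j\<rfloor>"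
  using gcm by (auto simp: generalized_cartan_matrix_def elim!: Ints_cases)

lemma inner_cartan:
  assumes "i \<in> I" "j \<in> I"
  shows "inner_prod D (simple_root D i) (simple_root D j) = of_int (dd (F i) * \<lfloor>cartan_entry D i j\<rfloor>)"
proof -
  have "cartan_entry D i j = 2 * inner_prod D (simple_root D i) (simple_root D j) / (2 * of_int (dd (F i)))"
    using inner_coroot [OF assms(1) simple_root_dual [OF assms(2)]] inner_dd [OF assms(1)]
    by (simp only: cartan_entry_def)
  then have "inner_prod D (simple_root D i) (simple_root D j) = of_int (dd (F i)) * cartan_entry D i j"
    using dd_pos [OF assms(1)] by (simp del: dd.simps)
  then show ?thesis
    using cartan_int [OF assms] by (simp del: dd.simps)
qed

lemma bil_cartan: "i \<in> I \<Longrightarrow> j \<in> I \<Longrightarrow> bil (F i) (F j) = dd (F i) * \<lfloor>cartan_entry D i j\<rfloor>"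
  by (simp only: bil.simps inner_cartan simp_thms if_True floor_of_int)

text \<open>Symmetry of \<open>bil\<close> is required for all letters, whereas the inner product is
  known to be symmetric only on the dual space; this is why \<open>bil\<close> is cut off to zero
  away from the \<open>f_i\<close> with \<open>i\<close> in \<open>I\<close>.\<close>

sublocale SD: serre_data bil "F ` I" dd mm
proof
  fix g h
  show "bil g h = bil h g"
    by (cases g; cases h) (auto simp: inner_sym simple_root_dual)
next
  show "finite (F ` I)" using finite_index by simp
next
  fix g :: "('i, 't) boson_gen" assume "g \<in> F ` I"
  then obtain i where g: "g = F i" "i \<in> I" by auto
  show "0 < dd g" using dd_pos g by simp
  have "cartan_entry D i i = 2"
    using gcm g by (simp add: generalized_cartan_matrix_def)
  then show "bil g g = 2 * dd g"
    using bil_cartan [of i i] g by simp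
next
  fix g h :: "('i, 't) boson_gen" assume "g \<in> F ` I" "h \<in> F ` I" "g \<noteq> h"
  then obtain i j where g: "g = F i" "i \<in> I" "h = F j" "j \<in> I" "i \<noteq> j" by auto
  have "cartan_entry D i j \<le> 0"
    using gcm g by (simp add: generalized_cartan_matrix_def)
  then have le: "\<lfloor>cartan_entry D i j\<rfloor> \<le> 0" by linarith
  have m: "\<lfloor>1 - cartan_entry D i j\<rfloor> = 1 - \<lfloor>cartan_entry D i j\<rfloor>"
  proof -
    obtain k where "cartan_entry D i j = of_int k"
      using cartan_int [OF g(2,4)] by blast
    then show ?thesis by (simp add: floor_unique)
  qed
  show "bil g h = dd g * (1 - int (mm g h))" "0 < mm g h"
    using bil_cartan [OF g(2,4)] le by (simp_all add: g(1,3) m del: bil.simps dd.simps)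
qed

lemma q_at_eq: "q_at D i = SD.vv (F i)"
  by (simp add: q_at_def qpow_def SD.vv_def)

lemma divided_power_eq: "divided_power D i (letter (F i)) n = SD.dpw (F i) n"
  by (simp add: divided_power_def SD.dpw_def qfact_def qfac_def qint_def qnum_def q_at_eq)

lemma serre_F: "serre D F i j = SD.serre_el (F i) (F j)"
  by (simp add: serre_def SD.serre_el_def divided_power_eq Let_def)

lemma q_at_powi: "i \<in> I \<Longrightarrow> j \<in> I \<Longrightarrow> q_at D i powi \<lfloor>cartan_entry D i j\<rfloor> = q powi bil (F i) (F j)"
  unfolding q_at_eq SD.vv_powi bil_cartan ..

fun f_to_e :: "('i, 't) boson_gen \<Rightarrow> ('i, 't) boson_gen" where
  "f_to_e (F i) = E i"
| "f_to_e g = g"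

text \<open>The homomorphism replacing \<open>f_i\<close> by \<open>e''_i\<close>. Both families
  obey Serre relations of the same shape, so membership in the Serre ideal transfers to relations
  among the \<open>e''_i\<close> in \<open>B\<close>.\<close>

definition emap :: "('i, 't) boson_free \<Rightarrow> ('i, 't) boson_free" where
  "emap = lext (\<lambda>w. wmon (map f_to_e w))"

lemma lin_emap: "lin emap"
  by (simp add: emap_def lin_lext)

lemma emap_wmon [simp]: "emap (wmon w) = wmon (map f_to_e w)"
  by (simp add: emap_def)

lemma emap_1 [simp]: "emap 1 = 1"
  using emap_wmon [of "[]"] by (simp del: emap_wmon)

lemma emap_letter [simp]: "emap (letter g) = letter (f_to_e g)"
  using emap_wmon [of "[g]"] by (simp del: emap_wmon)

lemma emap_scal [simp]: "emap (scal c) = scal c"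
  using lin_scal [OF lin_emap, of c 1] by simp

lemma emap_mult: "emap (p * r) = emap p * emap r"
proof -
  have 1: "emap (wmon v * r) = emap (wmon v) * emap r" for v
    by (rule lin_eqI [where \<phi> = "\<lambda>r. emap (wmon v * r)"])
      (auto intro!: lin_intros lin_comp [OF lin_emap] lin_emap simp: wmon_append [symmetric])
  show ?thesis
    by (rule lin_eqI [where \<phi> = "\<lambda>p. emap (p * r)"])
      (auto intro!: lin_intros lin_comp [OF lin_emap] lin_emap simp: 1 simp del: emap_wmon)
qed

lemma emap_power: "emap (p ^ n) = emap p ^ n"
  by (induction n) (simp_all add: emap_mult)

lemma serre_E: "serre D E i j = emap (SD.serre_el (F i) (F j))"
  by (simp add: serre_F [symmetric] serre_def Let_def lin_sum [OF lin_emap] SD.minus_one_power mult.assoc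
      lin_scal [OF lin_emap] emap_mult emap_power divided_power_def)

lemma R0_carrier: "carrier R0 = over (boson_gens D)"
  by (simp add: free_algebra_def over_def)

lemma R0_simps [simp]: "mult R0 = (*)" "one R0 = 1" "zero R0 = 0" "add R0 = (+)"
  by (simp_all add: free_algebra_def)

lemma gens_F [simp]: "F i \<in> boson_gens D \<longleftrightarrow> i \<in> I"
  and gens_E [simp]: "E i \<in> boson_gens D \<longleftrightarrow> i \<in> I"
  and gens_K [simp]: "K h \<in> boson_gens D \<longleftrightarrow> h \<in> Q"
  by (auto simp: boson_gens_def)

lemma R0_ring: "ring R0"
proof (rule ringI)
  show "abelian_group R0"
  proof (rule abelian_groupI)
    fix x assume "x \<in> carrier R0"
    then show "\<exists>y\<in>carrier R0. y \<oplus>\<^bsub>R0\<^esub> x = \<zero>\<^bsub>R0\<^esub>"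
      by (intro bexI [of _ "- x"]) (simp_all add: R0_carrier over_minus)
  qed (simp_all add: R0_carrier over_add add_ac)
  show "Group.monoid R0"
    by (rule monoidI) (simp_all add: R0_carrier over_mult mult.assoc)
qed (simp_all add: distrib_left distrib_right)

lemma over_gens_serre: "i \<in> I \<Longrightarrow> j \<in> I \<Longrightarrow> X i \<in> boson_gens D \<Longrightarrow> X j \<in> boson_gens D \<Longrightarrow>
  serre D X i j \<in> over (boson_gens D)"
  unfolding serre_def Let_def divided_power_def SD.minus_one_power
  by (intro over_sum over_mult over_scal over_power) simp_all

lemma relations_over: "boson_relations D \<subseteq> over (boson_gens D)"
  unfolding boson_relations_def
  by (auto intro!: over_diff over_mult over_add over_gens_serre coweight_0 coweight_add coweight_minus)

lemma BI_ideal: "ideal BI R0"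
  unfolding boson_ideal_def
  using relations_over ring.genideal_ideal [OF R0_ring] by (simp add: R0_carrier)

lemma BI_relations: "boson_relations D \<subseteq> BI"
  unfolding boson_ideal_def
  using relations_over ring.genideal_self [OF R0_ring] by (simp add: R0_carrier)

lemma BI_K_0: "letter (K 0) - 1 \<in> BI"
  by (rule subsetD [OF BI_relations]) (simp add: boson_relations_def)

lemma BI_K_add: "h \<in> Q \<Longrightarrow> h' \<in> Q \<Longrightarrow> letter (K h) * letter (K h') - letter (K (h + h')) \<in> BI"
  by (rule subsetD [OF BI_relations]) (unfold boson_relations_def, blast)

lemma BI_K_E: "h \<in> Q \<Longrightarrow> i \<in> I \<Longrightarrow> letter (K h) * letter (E i) * letter (K (- h))
    - scal (qpow (simple_root D i h)) * letter (E i) \<in> BI"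
  by (rule subsetD [OF BI_relations]) (unfold boson_relations_def, blast)

lemma BI_K_F: "h \<in> Q \<Longrightarrow> i \<in> I \<Longrightarrow> letter (K h) * letter (F i) * letter (K (- h))
    - scal (qpow (- simple_root D i h)) * letter (F i) \<in> BI"
  by (rule subsetD [OF BI_relations]) (unfold boson_relations_def, blast)

lemma BI_E_F: "i \<in> I \<Longrightarrow> j \<in> I \<Longrightarrow> letter (E i) * letter (F j)
    - (scal (q_at D i powi \<lfloor>cartan_entry D i j\<rfloor>) * letter (F j) * letter (E i) + (if i = j then 1 else 0)) \<in> BI"
  by (rule subsetD [OF BI_relations]) (unfold boson_relations_def, blast)

lemma BI_serre_E: "i \<in> I \<Longrightarrow> j \<in> I \<Longrightarrow> i \<noteq> j \<Longrightarrow> serre D E i j \<in> BI"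
  by (rule subsetD [OF BI_relations]) (unfold boson_relations_def, blast)

lemma BI_serre_F: "i \<in> I \<Longrightarrow> j \<in> I \<Longrightarrow> i \<noteq> j \<Longrightarrow> serre D F i j \<in> BI"
  by (rule subsetD [OF BI_relations]) (unfold boson_relations_def, blast)

lemma BI_over: "BI \<subseteq> over (boson_gens D)"
  using additive_subgroup.a_subset [OF ideal.axioms(1) [OF BI_ideal]] by (simp add: R0_carrier)

lemma BI_0: "0 \<in> BI"
  using additive_subgroup.zero_closed [OF ideal.axioms(1) [OF BI_ideal]] by simp

lemma BI_add: "x \<in> BI \<Longrightarrow> y \<in> BI \<Longrightarrow> x + y \<in> BI"
  using additive_subgroup.a_closed [OF ideal.axioms(1) [OF BI_ideal]] by simp

lemma BI_left: "x \<in> BI \<Longrightarrow> z \<in> over (boson_gens D) \<Longrightarrow> z * x \<in> BI"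
  using ideal.I_l_closed [OF BI_ideal] by (simp add: R0_carrier)

lemma BI_right: "x \<in> BI \<Longrightarrow> z \<in> over (boson_gens D) \<Longrightarrow> x * z \<in> BI"
  using ideal.I_r_closed [OF BI_ideal] by (simp add: R0_carrier)

lemma BI_scal: "x \<in> BI \<Longrightarrow> scal c * x \<in> BI"
  by (rule BI_left) simp_all

lemma BI_minus: "x \<in> BI \<Longrightarrow> - x \<in> BI"
  using BI_scal [of x "-1"] by (simp add: scal_minus)

lemma over_F: "p \<in> over (F ` I) \<Longrightarrow> p \<in> over (boson_gens D)"
  unfolding over_def boson_gens_def by blast

lemma serre_ideal_F_BI:
  assumes "x \<in> SD.serre_ideal" "x \<in> over (F ` I)"
  shows "x \<in> BI"
proof (rule SD.serre_ideal_over [OF assms BI_0 BI_add BI_scal])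
  fix g h :: "('i, 't) boson_gen" and u w :: "('i, 't) boson_gen list" assume *: "g \<in> F ` I" "h \<in> F ` I" "g \<noteq> h" and uw: "set u \<subseteq> F ` I" "set w \<subseteq> F ` I"
  from * obtain i j where "g = F i" "h = F j" "i \<in> I" "j \<in> I" "i \<noteq> j" by auto
  then have "SD.serre_el g h \<in> BI"
    using BI_serre_F by (simp add: serre_F)
  then show "wmon u * SD.serre_el g h * wmon w \<in> BI"
    using uw by (intro BI_right BI_left over_F) simp_all
qed

lemma serre_ideal_E_BI:
  assumes "x \<in> SD.serre_ideal" "x \<in> over (F ` I)"
  shows "emap x \<in> BI"
proof -
  have "x \<in> {x. emap x \<in> BI}"
  proof (rule SD.serre_ideal_over [OF assms])
    fix g h :: "('i, 't) boson_gen" and u w :: "('i, 't) boson_gen list" assume *: "g \<in> F ` I" "h \<in> F ` I" "g \<noteq> h" and uw: "set u \<subseteq> F ` I" "set w \<subseteq> F ` I"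
    from * obtain i j where "g = F i" "h = F j" "i \<in> I" "j \<in> I" "i \<noteq> j" by auto
    then have "emap (SD.serre_el g h) \<in> BI"
      using BI_serre_E by (simp add: serre_E)
    moreover have "wmon (map f_to_e u) \<in> over (boson_gens D)" if "set u \<subseteq> F ` I" for u
      using that by auto
    ultimately show "wmon u * SD.serre_el g h * wmon w \<in> {x. emap x \<in> BI}"
      using uw unfolding mem_Collect_eq emap_mult emap_wmon by (intro BI_right BI_left)
  qed (auto simp: lin_0 [OF lin_emap] lin_add [OF lin_emap] lin_scal [OF lin_emap] BI_0 BI_add BI_scal)
  then show ?thesis by simp
qed

section \<open>The action of the boson algebra on words\<close>

text \<open>\<open>rho \<phi>\<close> is the action of the free algebra on \<open>H(\<phi>)\<close>, lifted from \<open>B\<^sup>-\<close> to words.\<close>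

fun root_at :: "'t \<Rightarrow> ('i, 't) boson_gen \<Rightarrow> int" where
  "root_at h (F i) = (if i \<in> I then \<lfloor>simple_root D i h\<rfloor> else 0)"
| "root_at h _ = 0"

definition roots_at :: "'t \<Rightarrow> ('i, 't) boson_gen multiset \<Rightarrow> int" where
  "roots_at h \<gamma> = (\<Sum>g\<in>#\<gamma>. root_at h g)"

definition kop :: "('t \<Rightarrow> rat) \<Rightarrow> 't \<Rightarrow> ('i, 't) boson_free \<Rightarrow> ('i, 't) boson_free" where
  "kop \<phi> h = lext (\<lambda>w. qs (\<lfloor>\<phi> h\<rfloor> - roots_at h (mset w)) * wmon w)"

fun gop :: "('t \<Rightarrow> rat) \<Rightarrow> ('i, 't) boson_gen \<Rightarrow> ('i, 't) boson_free \<Rightarrow> ('i, 't) boson_free" where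
  "gop \<phi> (E i) y = SD.der (F i) y"
| "gop \<phi> (F i) y = letter (F i) * y"
| "gop \<phi> (K h) y = kop \<phi> h y"

primrec wop :: "('t \<Rightarrow> rat) \<Rightarrow> ('i, 't) boson_gen list \<Rightarrow> ('i, 't) boson_free \<Rightarrow> ('i, 't) boson_free" where
  "wop \<phi> [] y = y"
| "wop \<phi> (g # w) y = gop \<phi> g (wop \<phi> w y)"

definition rho :: "('t \<Rightarrow> rat) \<Rightarrow> ('i, 't) boson_free \<Rightarrow> ('i, 't) boson_free \<Rightarrow> ('i, 't) boson_free" where
  "rho \<phi> p y = lext (\<lambda>w. wop \<phi> w y) p"

lemma lin_kop: "lin (kop \<phi> h)"
  by (simp add: kop_def lin_lext)

lemma kop_wmon: "kop \<phi> h (wmon w) = qs (\<lfloor>\<phi> h\<rfloor> - roots_at h (mset w)) * wmon w"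
  by (simp add: kop_def)

lemma kop_homog: "homog \<gamma> p \<Longrightarrow> kop \<phi> h p = qs (\<lfloor>\<phi> h\<rfloor> - roots_at h \<gamma>) * p"
proof -
  assume p: "homog \<gamma> p"
  have "kop \<phi> h p = lext (\<lambda>w. qs (\<lfloor>\<phi> h\<rfloor> - roots_at h \<gamma>) * wmon w) p"
    unfolding kop_def using p by (intro lext_cong) (auto simp: homog_def)
  also have "\<dots> = qs (\<lfloor>\<phi> h\<rfloor> - roots_at h \<gamma>) * p"
    by (rule lext_eqI [symmetric]) (auto intro!: lin_intros)
  finally show ?thesis .
qed

lemma lin_gop: "lin (gop \<phi> g)"
  by (cases g) (auto intro: linI simp: SD.lin_der [THEN lin_add] lin_kop [THEN lin_add]
      lin_kop [THEN lin_scal] distrib_left letter_scal)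

lemma lin_wop: "lin (wop \<phi> w)"
proof (induction w)
  case (Cons g w)
  then show ?case
    using lin_comp [OF lin_gop Cons, of \<phi> g] by simp
qed (simp add: lin_id)

lemma lin_rho_left: "lin (\<lambda>p. rho \<phi> p y)"
  unfolding rho_def by (rule lin_lext)

lemma lin_rho_right: "lin (rho \<phi> p)"
  unfolding rho_def lext_def by (intro lin_setsum lin_mult_left lin_wop)

lemma rho_wmon [simp]: "rho \<phi> (wmon w) y = wop \<phi> w y"
  by (simp add: rho_def)

lemma rho_letter [simp]: "rho \<phi> (letter g) y = gop \<phi> g y"
  using rho_wmon [of \<phi> "[g]"] by (simp del: rho_wmon)

lemma rho_1 [simp]: "rho \<phi> 1 y = y"
  using rho_wmon [of \<phi> "[]"] by (simp del: rho_wmon)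

lemma rho_scal [simp]: "rho \<phi> (scal c) y = scal c * y"
  using lin_scal [OF lin_rho_left, of \<phi> c 1] by simp

lemma rho_mult: "rho \<phi> (p * r) y = rho \<phi> p (rho \<phi> r y)"
proof -
  have w: "wop \<phi> (u @ v) y = wop \<phi> u (wop \<phi> v y)" for u v
    by (induction u) auto
  have 1: "rho \<phi> (wmon u * r) y = wop \<phi> u (rho \<phi> r y)" for u
    by (rule lin_eqI [where \<phi> = "\<lambda>r. rho \<phi> (wmon u * r) y"])
      (auto intro!: lin_intros lin_comp [OF lin_rho_left] lin_comp [OF lin_wop] lin_rho_left
        simp: w simp flip: wmon_append)
  show ?thesis
    by (rule lin_eqI [where \<phi> = "\<lambda>p. rho \<phi> (p * r) y"])
      (auto intro!: lin_intros lin_comp [OF lin_rho_left] lin_rho_left simp: 1)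
qed

lemma rho_F:
  assumes "p \<in> over (F ` I)"
  shows "rho \<phi> p y = p * y"
  using assms
proof (induction rule: over_induct)
  case (word c w)
  then have "wop \<phi> w y = wmon w * y"
    by (induction w) (auto simp: wmon_Cons mult.assoc)
  then show ?case
    by (simp add: lin_scal [OF lin_rho_left] mult.assoc)
qed (simp_all add: lin_0 [OF lin_rho_left] lin_add [OF lin_rho_left] distrib_right)

lemma gop_over: "g \<in> boson_gens D \<Longrightarrow> y \<in> over (F ` I) \<Longrightarrow> gop \<phi> g y \<in> over (F ` I)"
proof (cases g)
  case (K h)
  assume "y \<in> over (F ` I)"
  then have "kop \<phi> h y \<in> over (F ` I)"
    unfolding kop_def by (rule over_lext) (auto intro: over_scal_mult)
  then show ?thesis using K by simp
qed (auto intro: SD.der_over over_mult)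

lemma rho_over: "p \<in> over (boson_gens D) \<Longrightarrow> y \<in> over (F ` I) \<Longrightarrow> rho \<phi> p y \<in> over (F ` I)"
  unfolding rho_def
proof (rule lext_in [OF over_0 over_add over_scal_mult])
  fix w assume "p \<in> over (boson_gens D)" and y: "y \<in> over (F ` I)" and "Word w \<in> Poly_Mapping.keys p"
  then have "set (letters (Word w)) \<subseteq> boson_gens D"
    unfolding over_def by blast
  then have "set w \<subseteq> boson_gens D" by simp
  then show "wop \<phi> w y \<in> over (F ` I)"
    by (induction w) (auto intro: gop_over y)
qed

lemma gop_serre_ideal: "y \<in> SD.serre_ideal \<Longrightarrow> gop \<phi> g y \<in> SD.serre_ideal"
proof (cases g)
  case (K h)
  assume "y \<in> SD.serre_ideal"
  then have "kop \<phi> h y \<in> SD.serre_ideal"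
  proof (rule SD.serre_ideal_lin_self [OF lin_kop, rotated])
    fix k j :: "('i, 't) boson_gen" and u w :: "('i, 't) boson_gen list"
    assume *: "k \<in> F ` I" "j \<in> F ` I" "k \<noteq> j"
    show "kop \<phi> h (wmon u * SD.serre_el k j * wmon w) \<in> SD.serre_ideal"
      unfolding kop_homog [OF SD.serre_gen_homog]
      by (intro SD.serre_ideal_scal SD.serre_ideal_sandwich SD.serre_el_in *)
  qed
  then show ?thesis using K by simp
qed (auto intro: SD.serre_ideal_der SD.serre_ideal_left)

lemma rho_serre_ideal: "y \<in> SD.serre_ideal \<Longrightarrow> rho \<phi> p y \<in> SD.serre_ideal"
  unfolding rho_def
proof (rule lext_in [OF SD.serre_ideal.zero SD.serre_ideal.add SD.serre_ideal_scal])
  fix w assume y: "y \<in> SD.serre_ideal"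
  show "wop \<phi> w y \<in> SD.serre_ideal"
    by (induction w) (auto intro: gop_serre_ideal y)
qed

text \<open>In a product the last letter acts first, in \<open>ewd\<close> the first one
  does.\<close>

lemma rho_emap: "set w \<subseteq> F ` I \<Longrightarrow> wop \<phi> (map f_to_e w) y = SD.ewd (rev w) y"
  by (induction w) (auto simp: SD.ewd_append)

text \<open>The reversal caused by \<open>rho_emap\<close> is harmless because the Serre ideal is
  stable under \<open>tau\<close>.\<close>

lemma rho_serre_E:
  assumes "i \<in> I" "j \<in> I" "i \<noteq> j" and y: "y \<in> over (F ` I)"
  shows "rho \<phi> (serre D E i j) y \<in> SD.serre_ideal"
proof -
  let ?s = "SD.serre_el (F i) (F j)"
  have s: "?s \<in> SD.serre_ideal" "?s \<in> over (F ` I)"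
    using assms by (auto intro!: SD.serre_el_in homog_over [OF SD.homog_serre_el] simp: set_mset_replicate_mset_subset split: if_splits)
  have "rho \<phi> (emap p) y = lext (\<lambda>u. SD.ewd u y) (tau p)" if "p \<in> over (F ` I)" for p
    using that
  proof (induction rule: over_induct)
    case (word c w)
    then show ?case
      by (simp add: lin_scal [OF lin_emap] lin_scal [OF lin_rho_left] lin_scal [OF lin_lext] rho_emap)
  qed (simp_all add: lin_0 [OF lin_emap] lin_0 [OF lin_rho_left] lin_0 [OF lin_lext] lin_0 [OF lin_tau]
      lin_add [OF lin_emap] lin_add [OF lin_rho_left] lin_add [OF lin_lext] lin_add [OF lin_tau])
  then have "rho \<phi> (serre D E i j) y = lext (\<lambda>u. SD.ewd u y) (tau ?s)"
    unfolding serre_E using s(2) by blast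
  also have "\<dots> \<in> SD.serre_ideal"
    by (intro SD.serre_ideal_acts_zero SD.serre_ideal_tau s(1) y)
  finally show ?thesis .
qed

lemma weight_floor_add: "\<phi> \<in> P \<Longrightarrow> h \<in> Q \<Longrightarrow> h' \<in> Q \<Longrightarrow> \<lfloor>\<phi> (h + h')\<rfloor> = \<lfloor>\<phi> h\<rfloor> + \<lfloor>\<phi> h'\<rfloor>"
  using weight_int [of \<phi> h] weight_int [of \<phi> h'] by (auto simp: weight_add elim!: Ints_cases simp flip: of_int_add)

lemma weight_floor_minus: "\<phi> \<in> P \<Longrightarrow> h \<in> Q \<Longrightarrow> \<lfloor>\<phi> (- h)\<rfloor> = - \<lfloor>\<phi> h\<rfloor>"
  using weight_int [of \<phi> h] by (auto simp: weight_minus elim!: Ints_cases simp flip: of_int_minus)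

lemma root_at_add: "h \<in> Q \<Longrightarrow> h' \<in> Q \<Longrightarrow> root_at (h + h') g = root_at h g + root_at h' g"
  by (cases g) (auto simp: weight_floor_add simple_root_lattice)

lemma root_at_minus: "h \<in> Q \<Longrightarrow> root_at (- h) g = - root_at h g"
  by (cases g) (auto simp: weight_floor_minus simple_root_lattice)

lemma roots_at_add: "h \<in> Q \<Longrightarrow> h' \<in> Q \<Longrightarrow> roots_at (h + h') \<gamma> = roots_at h \<gamma> + roots_at h' \<gamma>"
  by (simp add: roots_at_def root_at_add sum_mset.distrib)

lemma roots_at_minus: "h \<in> Q \<Longrightarrow> roots_at (- h) \<gamma> = - roots_at h \<gamma>"
  by (induction \<gamma>) (simp_all add: roots_at_def root_at_minus)

lemma roots_at_add_mset [simp]: "roots_at h (add_mset g \<gamma>) = root_at h g + roots_at h \<gamma>"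
  by (simp add: roots_at_def)

lemma roots_at_empty [simp]: "roots_at h {#} = 0"
  by (simp add: roots_at_def)

lemma roots_at_zero: "roots_at 0 \<gamma> = 0"
  using roots_at_add [OF coweight_0 coweight_0, of \<gamma>] by simp

lemma kop_kop_minus: "\<phi> \<in> P \<Longrightarrow> h \<in> Q \<Longrightarrow> kop \<phi> h (kop \<phi> (- h) y) = y"
  by (rule lin_eqI [where p = y and \<phi> = "\<lambda>y. kop \<phi> h (kop \<phi> (- h) y)"])
    (auto intro!: lin_comp [OF lin_kop] lin_kop lin_id
      simp: kop_wmon lin_scal [OF lin_kop] weight_floor_minus roots_at_minus qs_qs)

lemma kop_der: 
  assumes "i \<in> I"
  shows "kop \<phi> h (SD.der (F i) y) = qs \<lfloor>simple_root D i h\<rfloor> * SD.der (F i) (kop \<phi> h y)"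
proof (rule lin_eqI [where p = y and \<phi> = "\<lambda>y. kop \<phi> h (SD.der (F i) y)"])
  fix w
  show "kop \<phi> h (SD.der (F i) (wmon w)) = qs \<lfloor>simple_root D i h\<rfloor> * SD.der (F i) (kop \<phi> h (wmon w))"
  proof (cases "F i \<in> set w")
    case True
    then have "roots_at h (mset w) = \<lfloor>simple_root D i h\<rfloor> + roots_at h (mset w - {#F i#})"
      using roots_at_add_mset [of h "F i" "mset w - {#F i#}"] assms by (simp del: roots_at_add_mset)
    moreover have "kop \<phi> h (SD.der_word (F i) w)
        = qs (\<lfloor>\<phi> h\<rfloor> - roots_at h (mset w - {#F i#})) * SD.der_word (F i) w"
      using SD.der_word_homog by (blast intro: kop_homog)
    ultimately show ?thesis
      by (simp add: kop_wmon qs_qs)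
  next
    case False
    then show ?thesis
      using SD.der_word_homog [of w "F i"] by (simp add: kop_wmon lin_0 [OF lin_kop])
  qed
qed (auto intro!: lin_intros lin_comp [OF SD.lin_der] lin_comp [OF lin_kop] lin_kop SD.lin_der)

lemma kop_F:
  assumes "i \<in> I"
  shows "kop \<phi> h (letter (F i) * y) = qs (- \<lfloor>simple_root D i h\<rfloor>) * (letter (F i) * kop \<phi> h y)"
proof (rule lin_eqI [where p = y and \<phi> = "\<lambda>y. kop \<phi> h (letter (F i) * y)"])
  fix w
  show "kop \<phi> h (letter (F i) * wmon w) = qs (- \<lfloor>simple_root D i h\<rfloor>) * (letter (F i) * kop \<phi> h (wmon w))"
    using assms by (simp add: kop_wmon letter_scal qs_qs algebra_simps flip: wmon_Cons)
qed (auto intro!: lin_intros lin_comp [OF lin_kop] lin_kop)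

text \<open>The elements acting by maps into the Serre ideal form a two-sided ideal, since
  \<open>rho\<close> preserves both the span of words in the \<open>f_i\<close> and the Serre ideal.
  Of the relations only the two Serre families need the ideal; the others act exactly by
  zero.\<close>

lemma rho_BI:
  assumes \<phi>: "\<phi> \<in> P" and p: "p \<in> BI" and y: "y \<in> over (F ` I)"
  shows "rho \<phi> p y \<in> SD.serre_ideal"
proof -
  define X where "X = {p \<in> over (boson_gens D). \<forall>y\<in>over (F ` I). rho \<phi> p y \<in> SD.serre_ideal}"
  interpret R0: ring R0 by (rule R0_ring)
  have minv: "\<ominus>\<^bsub>R0\<^esub> x = - x" if "x \<in> over (boson_gens D)" for x
    using that by (intro R0.minus_equality) (simp_all add: R0_carrier over_minus)
  have "ideal X R0"
  proof (rule idealI [OF R0_ring])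
    show "subgroup X (add_monoid R0)"
    proof
      show "inv\<^bsub>add_monoid R0\<^esub> x \<in> X" if "x \<in> X" for x
        using minv [of x] that
        by (auto simp: X_def a_inv_def over_minus lin_minus [OF lin_rho_left] SD.serre_ideal_minus)
    qed (auto simp: X_def R0_carrier over_add lin_add [OF lin_rho_left] lin_0 [OF lin_rho_left]
        intro: SD.serre_ideal.intros)
  next
    fix a x assume "a \<in> X" "x \<in> carrier R0"
    then show "x \<otimes>\<^bsub>R0\<^esub> a \<in> X" "a \<otimes>\<^bsub>R0\<^esub> x \<in> X"
      by (auto simp: X_def R0_carrier over_mult rho_mult rho_over rho_serre_ideal)
  qed
  moreover have "boson_relations D \<subseteq> X"
  proof
    fix r assume r: "r \<in> boson_relations D"
    have "rho \<phi> r y \<in> SD.serre_ideal" if y: "y \<in> over (F ` I)" for y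
      using r unfolding boson_relations_def
    proof (elim UnE)
      assume "r \<in> {letter (K 0) - 1}"
      moreover have "kop \<phi> 0 y = y"
        by (rule lin_eqI [OF lin_kop lin_id]) (simp add: kop_wmon weight_0 \<phi> roots_at_zero)
      ultimately show ?thesis
        by (simp add: lin_diff [OF lin_rho_left] SD.serre_ideal.zero)
    next
      assume "r \<in> {letter (K h) * letter (K h') - letter (K (h + h')) | h h'. h \<in> Q \<and> h' \<in> Q}"
      then obtain h h' where rr: "r = letter (K h) * letter (K h') - letter (K (h + h'))" and h: "h \<in> Q" "h' \<in> Q"
        by blast
      have "kop \<phi> h (kop \<phi> h' y) = kop \<phi> (h + h') y"
        by (rule lin_eqI [OF lin_comp [OF lin_kop lin_kop] lin_kop])
          (simp add: kop_wmon lin_scal [OF lin_kop] qs_qs weight_floor_add roots_at_add \<phi> h algebra_simps)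
      then show ?thesis
        by (simp add: rr lin_diff [OF lin_rho_left] rho_mult SD.serre_ideal.zero)
    next
      assume "r \<in> {letter (K h) * letter (E i) * letter (K (- h)) - scal (qpow (simple_root D i h)) * letter (E i) | h i. h \<in> Q \<and> i \<in> I}"
      then obtain h i where rr: "r = letter (K h) * letter (E i) * letter (K (- h)) - scal (qpow (simple_root D i h)) * letter (E i)"
        and h: "h \<in> Q" "i \<in> I"
        by blast
      show ?thesis
        by (simp add: rr lin_diff [OF lin_rho_left] rho_mult kop_der h kop_kop_minus \<phi> qpow_def SD.serre_ideal.zero)
    next
      assume "r \<in> {letter (K h) * letter (F i) * letter (K (- h)) - scal (qpow (- simple_root D i h)) * letter (F i) | h i. h \<in> Q \<and> i \<in> I}"
      then obtain h i where rr: "r = letter (K h) * letter (F i) * letter (K (- h)) - scal (qpow (- simple_root D i h)) * letter (F i)"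
        and h: "h \<in> Q" "i \<in> I"
        by blast
      have "\<lfloor>- simple_root D i h\<rfloor> = - \<lfloor>simple_root D i h\<rfloor>"
        using weight_floor_minus [OF simple_root_lattice h(1)] weight_minus [OF simple_root_lattice] h by simp
      then show ?thesis
        by (simp add: rr lin_diff [OF lin_rho_left] rho_mult kop_F h kop_kop_minus \<phi> qpow_def SD.serre_ideal.zero)
    next
      assume "r \<in> {letter (E i) * letter (F j) - (scal (q_at D i powi \<lfloor>cartan_entry D i j\<rfloor>) * letter (F j) * letter (E i)
           + (if i = j then 1 else 0)) | i j. i \<in> I \<and> j \<in> I}"
      then obtain i j where rr: "r = letter (E i) * letter (F j) - (scal (q_at D i powi \<lfloor>cartan_entry D i j\<rfloor>) * letter (F j) * letter (E i)
           + (if i = j then 1 else 0))" and i: "i \<in> I" "j \<in> I"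
        by blast
      have "rho \<phi> r y = 0"
        unfolding rr q_at_powi [OF i] using i
        by (auto simp: lin_diff [OF lin_rho_left] lin_add [OF lin_rho_left] lin_0 [OF lin_rho_left] rho_mult SD.der_letter_mult
            simp del: bil.simps)
      then show ?thesis by (simp add: SD.serre_ideal.zero)
    next
      assume "r \<in> {serre D E i j | i j. i \<in> I \<and> j \<in> I \<and> i \<noteq> j}"
      then show ?thesis
        using rho_serre_E y by blast
    next
      assume "r \<in> {serre D F i j | i j. i \<in> I \<and> j \<in> I \<and> i \<noteq> j}"
      then obtain i j where rr: "r = SD.serre_el (F i) (F j)" and i: "i \<in> I" "j \<in> I" "i \<noteq> j"
        by (auto simp: serre_F)
      then have "r \<in> SD.serre_ideal" "r \<in> over (F ` I)"
        by (auto intro!: SD.serre_el_in homog_over [OF SD.homog_serre_el] simp: set_mset_replicate_mset_subset split: if_splits)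
      then show ?thesis
        by (simp add: rho_F SD.serre_ideal_right)
    qed
    then show "r \<in> X"
      using r relations_over by (auto simp: X_def)
  qed
  ultimately have "BI \<subseteq> X"
    unfolding boson_ideal_def by (rule R0.genideal_minimal)
  then show ?thesis
    using p y by (auto simp: X_def)
qed

section \<open>Modules over the boson algebra\<close>

abbreviation "free_B \<equiv> over (boson_gens D)"
abbreviation "free_F \<equiv> over (F ` I)"
abbreviation "cls \<equiv> boson_class D"

lemma B_ring: "ring B"
  unfolding boson_algebra_def by (rule ideal.quotient_is_ring [OF BI_ideal])

lemma cls_hom: "cls \<in> ring_hom R0 B"
  using ideal.rcos_ring_hom [OF BI_ideal] by (simp add: boson_class_def [abs_def] boson_algebra_def)

lemma cls_closed: "p \<in> free_B \<Longrightarrow> cls p \<in> carrier B"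
  using ring_hom_closed [OF cls_hom] by (simp add: R0_carrier)

lemma cls_add: "p \<in> free_B \<Longrightarrow> r \<in> free_B \<Longrightarrow> cls (p + r) = cls p \<oplus>\<^bsub>B\<^esub> cls r"
  using ring_hom_add [OF cls_hom] by (simp add: R0_carrier)

lemma cls_mult: "p \<in> free_B \<Longrightarrow> r \<in> free_B \<Longrightarrow> cls (p * r) = cls p \<otimes>\<^bsub>B\<^esub> cls r"
  using ring_hom_mult [OF cls_hom] by (simp add: R0_carrier)

lemma cls_1: "cls 1 = \<one>\<^bsub>B\<^esub>"
  using ring_hom_one [OF cls_hom] by simp

lemma cls_BI: "p \<in> BI \<Longrightarrow> cls p = \<zero>\<^bsub>B\<^esub>"
  using ring.a_rcos_zero [OF R0_ring BI_ideal] by (simp add: boson_class_def boson_algebra_def FactRing_def)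

lemma cls_0: "cls 0 = \<zero>\<^bsub>B\<^esub>"
  by (rule cls_BI [OF BI_0])

lemma cls_minus: "p \<in> free_B \<Longrightarrow> cls (- p) = \<ominus>\<^bsub>B\<^esub> cls p"
proof -
  assume p: "p \<in> free_B"
  interpret B: ring B by (rule B_ring)
  have "cls (- p) \<oplus>\<^bsub>B\<^esub> cls p = \<zero>\<^bsub>B\<^esub>"
    using cls_add [of "- p" p] p by (simp add: over_minus cls_0)
  then show ?thesis
    using p by (metis B.minus_equality cls_closed over_minus)
qed

lemma cls_eq: "p \<in> free_B \<Longrightarrow> r \<in> free_B \<Longrightarrow> p - r \<in> BI \<Longrightarrow> cls p = cls r"
proof -
  assume p: "p \<in> free_B" "r \<in> free_B" "p - r \<in> BI"
  interpret B: ring B by (rule B_ring)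
  have "cls (p - r + r) = cls (p - r) \<oplus>\<^bsub>B\<^esub> cls r"
    using p by (intro cls_add over_diff)
  then show ?thesis
    using p by (simp add: cls_BI cls_closed)
qed

lemma cls_0_iff: "p \<in> free_B \<Longrightarrow> cls p = \<zero>\<^bsub>B\<^esub> \<longleftrightarrow> p \<in> BI"
  using cls_BI ideal.rcos_const_imp_mem [OF BI_ideal, of p]
  by (auto simp: boson_class_def boson_algebra_def FactRing_def R0_carrier)

lemma cls_surj: "b \<in> carrier B \<Longrightarrow> \<exists>p\<in>free_B. b = cls p"
  by (auto simp: boson_algebra_def FactRing_def A_RCOSETS_def' boson_class_def R0_carrier)

lemma K_minus_K: "h \<in> Q \<Longrightarrow> letter (K (- h)) * letter (K h) - 1 \<in> BI"
  using BI_add [OF BI_K_add [of "- h" h] BI_K_0] by (simp add: coweight_minus)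

text \<open>The conjugation relation multiplied by \<open>q^h\<close> on the right, where
  \<open>q^(-h) q^h\<close> is 1 modulo the relations.\<close>

lemma K_F_commute:
  assumes "h \<in> Q" "i \<in> I"
  shows "letter (K h) * letter (F i) - scal (qpow (- simple_root D i h)) * letter (F i) * letter (K h) \<in> BI"
proof -
  have 1: "(letter (K h) * letter (F i) * letter (K (- h)) - scal (qpow (- simple_root D i h)) * letter (F i)) * letter (K h) \<in> BI"
    using assms by (intro BI_right BI_K_F) simp_all
  have 2: "(letter (K h) * letter (F i)) * (letter (K (- h)) * letter (K h) - 1) \<in> BI"
    using assms by (intro BI_left K_minus_K over_mult) simp_all
  show ?thesis
    using BI_add [OF 1 BI_minus [OF 2]] by (simp add: algebra_simps)
qed

lemma K_E_commute:
  assumes "h \<in> Q" "i \<in> I"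
  shows "letter (K h) * letter (E i) - scal (qpow (simple_root D i h)) * letter (E i) * letter (K h) \<in> BI"
proof -
  have 1: "(letter (K h) * letter (E i) * letter (K (- h)) - scal (qpow (simple_root D i h)) * letter (E i)) * letter (K h) \<in> BI"
    using assms by (intro BI_right BI_K_E) simp_all
  have 2: "(letter (K h) * letter (E i)) * (letter (K (- h)) * letter (K h) - 1) \<in> BI"
    using assms by (intro BI_left K_minus_K over_mult) simp_all
  show ?thesis
    using BI_add [OF 1 BI_minus [OF 2]] by (simp add: algebra_simps)
qed

lemma weight_lattice_diff: "\<phi> \<in> P \<Longrightarrow> \<psi> \<in> P \<Longrightarrow> \<phi> - \<psi> \<in> P"
proof -
  assume "\<phi> \<in> P" "\<psi> \<in> P"
  then have "\<phi> + - \<psi> \<in> P"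
    by (intro weight_lattice_add weight_lattice_uminus)
  moreover have "\<phi> + - \<psi> = \<phi> - \<psi>"
    by (simp add: fun_eq_iff)
  ultimately show ?thesis by simp
qed

lemma qpow_add: "a \<in> \<int> \<Longrightarrow> b \<in> \<int> \<Longrightarrow> qpow (a + b) = qpow a * qpow b"
  by (auto simp: qpow_def q_powi_add elim!: Ints_cases simp flip: of_int_add)

lemma qpow_inj: "a \<in> \<int> \<Longrightarrow> b \<in> \<int> \<Longrightarrow> qpow a = qpow b \<Longrightarrow> a = b"
  by (auto simp: qpow_def elim!: Ints_cases dest!: q_powi_inj)

end

locale boson_module = kac_moody_data D for D :: "('i, 't::ab_group_add) cartan_data" +
  fixes M :: "(('i, 't) boson, 'm) module"
  assumes left_mod: "left_module (boson_algebra D) M"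
begin

sublocale LM: left_module "boson_algebra D" M
  by (rule left_mod)

abbreviation "CM \<equiv> carrier M"

text \<open>Elements of \<open>B\<close> act through representatives in the free algebra, so that
  module computations can be done with words; \<open>act_cong\<close> gives independence of the
  representative.\<close>

definition act :: "('i, 't) boson_free \<Rightarrow> 'm \<Rightarrow> 'm" where
  "act p m = boson_class D p \<odot>\<^bsub>M\<^esub> m"

lemma act_closed [intro, simp]: "p \<in> free_B \<Longrightarrow> m \<in> CM \<Longrightarrow> act p m \<in> CM"
  unfolding act_def by (intro LM.smult_closed cls_closed)

lemma act_add: "p \<in> free_B \<Longrightarrow> r \<in> free_B \<Longrightarrow> m \<in> CM \<Longrightarrow> act (p + r) m = act p m \<oplus>\<^bsub>M\<^esub> act r m"
  by (simp add: act_def cls_add LM.smult_l_distr cls_closed)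

lemma act_mult: "p \<in> free_B \<Longrightarrow> r \<in> free_B \<Longrightarrow> m \<in> CM \<Longrightarrow> act (p * r) m = act p (act r m)"
  by (simp add: act_def cls_mult LM.smult_assoc cls_closed)

lemma act_1 [simp]: "m \<in> CM \<Longrightarrow> act 1 m = m"
  by (simp add: act_def cls_1 LM.smult_one)

lemma act_radd: "p \<in> free_B \<Longrightarrow> m \<in> CM \<Longrightarrow> n \<in> CM \<Longrightarrow> act p (m \<oplus>\<^bsub>M\<^esub> n) = act p m \<oplus>\<^bsub>M\<^esub> act p n"
  by (simp add: act_def LM.smult_r_distr cls_closed)

lemma act_cong: "p \<in> free_B \<Longrightarrow> r \<in> free_B \<Longrightarrow> p - r \<in> BI \<Longrightarrow> act p m = act r m"
  by (simp add: act_def cls_eq [of p r])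

lemma act_0 [simp]: "m \<in> CM \<Longrightarrow> act 0 m = \<zero>\<^bsub>M\<^esub>"
proof -
  assume m: "m \<in> CM"
  have "act 0 m \<oplus>\<^bsub>M\<^esub> act 0 m = act 0 m"
    using act_add [of 0 0 m] m by simp
  then show ?thesis
    using m act_closed [of 0 m] LM.M.add.r_cancel_one by simp
qed

lemma act_BI: "p \<in> BI \<Longrightarrow> m \<in> CM \<Longrightarrow> act p m = \<zero>\<^bsub>M\<^esub>"
  using act_cong [of p 0 m] BI_over by auto

lemma act_zero [simp]: "p \<in> free_B \<Longrightarrow> act p \<zero>\<^bsub>M\<^esub> = \<zero>\<^bsub>M\<^esub>"
  using act_mult [of p 0 "\<zero>\<^bsub>M\<^esub>"] by simp

lemma act_minus: "p \<in> free_B \<Longrightarrow> m \<in> CM \<Longrightarrow> act (- p) m = \<ominus>\<^bsub>M\<^esub> act p m"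
  using act_add [of "- p" p m]
  by (intro LM.M.minus_equality [symmetric]) (simp_all add: over_minus)

lemma act_diff: "p \<in> free_B \<Longrightarrow> r \<in> free_B \<Longrightarrow> m \<in> CM \<Longrightarrow> act (p - r) m = act p m \<ominus>\<^bsub>M\<^esub> act r m"
  using act_add [of p "- r" m] by (simp add: over_minus act_minus a_minus_def)

lemma act_scal_0: "c \<noteq> 0 \<Longrightarrow> m \<in> CM \<Longrightarrow> act (scal c) m = \<zero>\<^bsub>M\<^esub> \<Longrightarrow> m = \<zero>\<^bsub>M\<^esub>"
  using act_mult [of "scal (1 / c)" "scal c" m] by (simp flip: scal_mult)

lemma act_sum_cong:
  assumes "finite A" "m \<in> CM" "\<And>x. x \<in> A \<Longrightarrow> p x \<in> free_B" "\<And>x. x \<in> A \<Longrightarrow> r x \<in> free_B"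
    and "\<And>x. x \<in> A \<Longrightarrow> act (p x) m = act (r x) m"
  shows "act (\<Sum>x\<in>A. p x) m = act (\<Sum>x\<in>A. r x) m"
  using assms by (induction A rule: finite_induct) (simp_all add: act_add over_sum)

lemma act_sum_in:
  assumes "finite A" "m \<in> CM" "\<And>x. x \<in> A \<Longrightarrow> p x \<in> free_B" "\<And>x. x \<in> A \<Longrightarrow> act (p x) m \<in> N"
    and "\<zero>\<^bsub>M\<^esub> \<in> N" "\<And>x y. x \<in> N \<Longrightarrow> y \<in> N \<Longrightarrow> x \<oplus>\<^bsub>M\<^esub> y \<in> N"
  shows "act (\<Sum>x\<in>A. p x) m \<in> N"
  using assms by (induction A rule: finite_induct) (simp_all add: act_add over_sum)

definition sub :: "'m set \<Rightarrow> bool" where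
  "sub N \<longleftrightarrow> N \<subseteq> CM \<and> \<zero>\<^bsub>M\<^esub> \<in> N \<and> (\<forall>x\<in>N. \<forall>y\<in>N. x \<oplus>\<^bsub>M\<^esub> y \<in> N) \<and> (\<forall>p\<in>free_B. \<forall>x\<in>N. act p x \<in> N)"

lemma sub_neg: "sub N \<Longrightarrow> x \<in> N \<Longrightarrow> \<ominus>\<^bsub>M\<^esub> x \<in> N"
proof -
  assume N: "sub N" "x \<in> N"
  then have "act (- 1) x \<in> N" "x \<in> CM"
    by (auto simp: sub_def over_minus)
  then show ?thesis
    using act_minus [of 1 x] by simp
qed

lemma sub_minus: "sub N \<Longrightarrow> x \<in> N \<Longrightarrow> y \<in> N \<Longrightarrow> x \<ominus>\<^bsub>M\<^esub> y \<in> N"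
  using sub_neg [of N y] by (auto simp: a_minus_def sub_def)

lemma submodule_iff_sub: "submodule N B M \<longleftrightarrow> sub N"
proof
  assume N: "submodule N B M"
  then interpret N: submodule N B M .
  show "sub N"
    unfolding sub_def act_def
    using N.subset N.one_closed N.m_closed N.smult_closed cls_closed by auto
next
  assume N: "sub N"
  show "submodule N B M"
  proof (intro submodule.intro submodule_axioms.intro)
    show "subgroup N (add_monoid M)"
      using N sub_neg [OF N]
      by unfold_locales (auto simp: sub_def a_inv_def)
    show "a \<odot>\<^bsub>M\<^esub> x \<in> N" if "a \<in> carrier B" "x \<in> N" for a x
      using cls_surj [OF that(1)] that(2) N by (auto simp: sub_def act_def)
  qed
qed

lemma weight_space_act:
  "u \<in> weight_space D M \<phi> \<longleftrightarrow> u \<in> CM \<and> (\<forall>h\<in>Q. act (letter (K h)) u = act (scal (qpow (\<phi> h))) u)"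
  by (simp add: weight_space_def act_def)

lemma weight_space_carrier: "u \<in> weight_space D M \<phi> \<Longrightarrow> u \<in> CM"
  by (simp add: weight_space_act)

lemma weight_space_zero: "\<zero>\<^bsub>M\<^esub> \<in> weight_space D M \<phi>"
  by (simp add: weight_space_act)

lemma weight_space_add:
  "u \<in> weight_space D M \<phi> \<Longrightarrow> v \<in> weight_space D M \<phi> \<Longrightarrow> u \<oplus>\<^bsub>M\<^esub> v \<in> weight_space D M \<phi>"
  by (simp add: weight_space_act act_radd)

lemma weight_space_scal: "u \<in> weight_space D M \<phi> \<Longrightarrow> act (scal c) u \<in> weight_space D M \<phi>"
  unfolding weight_space_act
proof (intro conjI ballI; elim conjE)
  fix h assume u: "u \<in> CM" and h: "h \<in> Q" and k: "\<forall>h\<in>Q. act (letter (K h)) u = act (scal (qpow (\<phi> h))) u"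
  have "act (letter (K h)) (act (scal c) u) = act (letter (K h) * scal c) u"
    using u h by (simp add: act_mult)
  also have "letter (K h) * scal c = scal c * letter (K h)"
    by (rule scal_commute)
  also have "act (scal c * letter (K h)) u = act (scal c) (act (scal (qpow (\<phi> h))) u)"
    using u h k by (simp add: act_mult)
  also have "\<dots> = act (scal c * scal (qpow (\<phi> h))) u"
    using u by (simp add: act_mult)
  also have "scal c * scal (qpow (\<phi> h)) = scal (qpow (\<phi> h)) * scal c"
    by (rule scal_commute)
  also have "act (scal (qpow (\<phi> h)) * scal c) u = act (scal (qpow (\<phi> h))) (act (scal c) u)"
    using u by (simp add: act_mult)
  finally show "act (letter (K h)) (act (scal c) u) = act (scal (qpow (\<phi> h))) (act (scal c) u)" .
qed simp

text \<open>One argument serves raising and lowering operators: \<psi> is a simple root for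
  \<open>e''_i\<close> and its negative for \<open>f_i\<close>.\<close>

lemma weight_shift:
  assumes u: "u \<in> weight_space D M \<phi>" and g: "g \<in> boson_gens D" and \<phi>: "\<phi> \<in> P" and \<psi>: "\<psi> \<in> P"
    and comm: "\<And>h. h \<in> Q \<Longrightarrow> letter (K h) * letter g - scal (qpow (\<psi> h)) * letter g * letter (K h) \<in> BI"
  shows "act (letter g) u \<in> weight_space D M (\<phi> + \<psi>)"
  unfolding weight_space_act
proof (intro conjI ballI)
  have uc: "u \<in> CM" using u by (rule weight_space_carrier)
  show "act (letter g) u \<in> CM"
    using g uc by simp
  fix h assume h: "h \<in> Q"
  have "act (letter (K h)) (act (letter g) u) = act (letter (K h) * letter g) u"
    using g uc h by (simp add: act_mult)
  also have "\<dots> = act (scal (qpow (\<psi> h)) * letter g * letter (K h)) u"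
    using g uc h by (intro act_cong comm over_mult) simp_all
  also have "\<dots> = act (scal (qpow (\<psi> h)) * letter g) (act (letter (K h)) u)"
    using g uc h by (intro act_mult over_mult) simp_all
  also have "act (letter (K h)) u = act (scal (qpow (\<phi> h))) u"
    using u h by (simp add: weight_space_act)
  also have "act (scal (qpow (\<psi> h)) * letter g) (act (scal (qpow (\<phi> h))) u)
      = act (scal (qpow (\<psi> h)) * letter g * scal (qpow (\<phi> h))) u"
    using g uc by (intro act_mult [symmetric] over_mult) simp_all
  also have "scal (qpow (\<psi> h)) * letter g * scal (qpow (\<phi> h)) = scal (qpow ((\<phi> + \<psi>) h)) * letter g"
    using \<phi> \<psi> h by (simp add: qpow_add weight_int mult.assoc letter_scal' scal_scal mult.commute)
  also have "act (scal (qpow ((\<phi> + \<psi>) h)) * letter g) u = act (scal (qpow ((\<phi> + \<psi>) h))) (act (letter g) u)"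
    using g uc by (intro act_mult) simp_all
  finally show "act (letter (K h)) (act (letter g) u) = act (scal (qpow ((\<phi> + \<psi>) h))) (act (letter g) u)" .
qed

lemma weight_F:
  "u \<in> weight_space D M \<phi> \<Longrightarrow> \<phi> \<in> P \<Longrightarrow> i \<in> I \<Longrightarrow> act (letter (F i)) u \<in> weight_space D M (\<phi> + - simple_root D i)"
  using K_F_commute by (intro weight_shift weight_lattice_uminus simple_root_lattice) simp_all

lemma weight_E:
  "u \<in> weight_space D M \<phi> \<Longrightarrow> \<phi> \<in> P \<Longrightarrow> i \<in> I \<Longrightarrow> act (letter (E i)) u \<in> weight_space D M (\<phi> + simple_root D i)"
  using K_E_commute by (intro weight_shift simple_root_lattice) simp_all

section \<open>Primitive vectors\<close>

definition prim :: "('t \<Rightarrow> rat) \<Rightarrow> 'm \<Rightarrow> bool" where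
  "prim \<mu> u \<longleftrightarrow> \<mu> \<in> P \<and> u \<in> weight_space D M \<mu> \<and> (\<forall>i\<in>I. act (letter (E i)) u = \<zero>\<^bsub>M\<^esub>)"

lemma prim_carrier: "prim \<mu> u \<Longrightarrow> u \<in> CM"
  by (simp add: prim_def weight_space_act)

text \<open>The generators \<open>e''_i\<close> and \<open>q^h\<close> move through the word by the
  defining relations until they reach \<open>u\<close>, where the former give zero and the latter
  the weight; what is left behind is \<open>gop\<close>.\<close>

lemma act_gop_wmon:
  assumes u: "prim \<mu> u" and g: "g \<in> boson_gens D"
  shows "set w \<subseteq> F ` I \<Longrightarrow> act (letter g) (act (wmon w) u) = act (gop \<mu> g (wmon w)) u"
proof (cases g)
  case (F j)
  assume "set w \<subseteq> F ` I"
  then have "wmon w \<in> free_B" by (intro over_F) simp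
  then show ?thesis
    using F g prim_carrier [OF u] by (simp add: act_mult)
next
  case (E i)
  then have i: "i \<in> I" using g by simp
  have uc: "u \<in> CM" by (rule prim_carrier [OF u])
  have "act (letter (E i)) (act (wmon w) u) = act (SD.der_word (F i) w) u" if "set w \<subseteq> F ` I" for w
    using that
  proof (induction w)
    case Nil
    then show ?case using u i uc by (simp add: prim_def)
  next
    case (Cons f w)
    then obtain j where f: "f = F j" and j: "j \<in> I" by auto
    have w: "wmon w \<in> free_B" "SD.der_word (F i) w \<in> free_B"
      using Cons.prems SD.der_over [of "wmon w" "F ` I" "F i"] by (auto intro!: over_F)
    have fj: "letter (F j) \<in> free_B" "letter (E i) \<in> free_B" using i j by simp_all
    define n where "n = act (wmon w) u"
    have n: "n \<in> CM" using w uc by (simp add: n_def)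
    define c where "c = q powi bil (F i) (F j)"
    have "act (letter (E i)) (act (wmon (f # w)) u) = act (letter (E i) * letter (F j)) n"
      using fj w uc n by (simp add: f wmon_Cons act_mult n_def)
    also have "\<dots> = act (scal c * letter (F j) * letter (E i) + (if i = j then 1 else 0)) n"
      using BI_E_F [OF i j] fj unfolding q_at_powi [OF i j] c_def
      by (intro act_cong) (auto intro!: over_add over_mult)
    also have "\<dots> = act (scal c * letter (F j) * letter (E i)) n \<oplus>\<^bsub>M\<^esub> act (if i = j then 1 else 0) n"
      using fj n by (intro act_add over_mult) simp_all
    also have "act (scal c * letter (F j) * letter (E i)) n = act (scal c * letter (F j)) (act (SD.der_word (F i) w) u)"
      using fj n Cons by (subst act_mult) (auto simp: n_def intro: over_mult)
    also have "\<dots> = act (scal c * letter (F j) * SD.der_word (F i) w) u"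
      using fj w uc by (intro act_mult [symmetric] over_mult) simp_all
    also have "act (if i = j then 1 else 0) n = act (if i = j then wmon w else 0) u"
      using n w uc by (simp add: n_def)
    also have "act (scal c * letter (F j) * SD.der_word (F i) w) u \<oplus>\<^bsub>M\<^esub> act (if i = j then wmon w else 0) u
        = act (scal c * letter (F j) * SD.der_word (F i) w + (if i = j then wmon w else 0)) u"
      using fj w uc by (intro act_add [symmetric] over_mult) simp_all
    also have "scal c * letter (F j) * SD.der_word (F i) w + (if i = j then wmon w else 0) = SD.der_word (F i) (f # w)"
      by (simp add: f c_def mult.assoc)
    finally show ?case .
  qed
  then show "set w \<subseteq> F ` I \<Longrightarrow> ?thesis" using E by simp
next
  case (K h)
  then have h: "h \<in> Q" using g by simp
  have uc: "u \<in> CM" by (rule prim_carrier [OF u])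
  have "act (letter (K h)) (act (wmon w) u) = act (kop \<mu> h (wmon w)) u" if "set w \<subseteq> F ` I" for w
    using that
  proof (induction w)
    case Nil
    then show ?case
      using u h uc kop_wmon [of \<mu> h "[]"] by (simp add: prim_def weight_space_act qpow_def)
  next
    case (Cons f w)
    then obtain j where f: "f = F j" and j: "j \<in> I" by auto
    have w: "wmon w \<in> free_B" using Cons.prems by (intro over_F) simp
    have kw: "kop \<mu> h (wmon w) \<in> free_B" using w by (simp add: kop_wmon over_scal_mult)
    have fj: "letter (F j) \<in> free_B" "letter (K h) \<in> free_B" using h j by simp_all
    define c where "c = qpow (- simple_root D j h)"
    have fl: "\<lfloor>- simple_root D j h\<rfloor> = - \<lfloor>simple_root D j h\<rfloor>"
      using weight_floor_minus [OF simple_root_lattice h] weight_minus [OF simple_root_lattice] j by simp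
    have "act (letter (K h)) (act (wmon (f # w)) u) = act (letter (K h) * letter (F j)) (act (wmon w) u)"
      using fj w uc by (simp add: f wmon_Cons act_mult)
    also have "\<dots> = act (scal c * letter (F j) * letter (K h)) (act (wmon w) u)"
      unfolding c_def using K_F_commute [OF h j] fj by (intro act_cong over_mult) simp_all
    also have "\<dots> = act (scal c * letter (F j)) (act (kop \<mu> h (wmon w)) u)"
      using fj w uc Cons by (subst act_mult) (auto intro: over_mult)
    also have "\<dots> = act (scal c * letter (F j) * kop \<mu> h (wmon w)) u"
      using fj kw uc by (intro act_mult [symmetric] over_mult) simp_all
    also have "scal c * letter (F j) * kop \<mu> h (wmon w) = kop \<mu> h (wmon (f # w))"
      using kop_F [OF j, of \<mu> h "wmon w"] by (simp add: f wmon_Cons c_def qpow_def fl mult.assoc)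
    finally show ?case .
  qed
  then show "set w \<subseteq> F ` I \<Longrightarrow> ?thesis" using K by simp
qed

lemma act_gop:
  assumes u: "prim \<mu> u" and g: "g \<in> boson_gens D" and y: "y \<in> free_F"
  shows "act (letter g) (act y u) = act (gop \<mu> g y) u"
proof -
  have uc: "u \<in> CM" by (rule prim_carrier [OF u])
  have lg: "letter g \<in> free_B" using g by simp
  have "y \<in> free_F \<and> act (letter g) (act y u) = act (gop \<mu> g y) u"
    using y
  proof (induction rule: over_induct)
    case zero
    then show ?case using lg uc by (simp add: lin_0 [OF lin_gop])
  next
    case (add p r)
    then have "p \<in> free_B" "r \<in> free_B" "gop \<mu> g p \<in> free_B" "gop \<mu> g r \<in> free_B"
      using g by (auto intro!: over_F gop_over)
    then show ?case
      using add lg uc by (simp add: over_add act_add act_radd lin_add [OF lin_gop])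
  next
    case (word c w)
    have w: "wmon w \<in> free_B" "gop \<mu> g (wmon w) \<in> free_B"
      using word g by (auto intro!: over_F gop_over)
    have "act (letter g) (act (scal c * wmon w) u) = act (letter g * scal c) (act (wmon w) u)"
      using lg w uc by (simp add: act_mult over_mult)
    also have "letter g * scal c = scal c * letter g"
      by (rule scal_commute)
    also have "act (scal c * letter g) (act (wmon w) u) = act (scal c) (act (gop \<mu> g (wmon w)) u)"
      using lg w uc act_gop_wmon [OF u g word] by (simp add: act_mult)
    also have "\<dots> = act (gop \<mu> g (scal c * wmon w)) u"
      using w uc by (simp add: act_mult lin_scal [OF lin_gop])
    finally show ?case
      using word by (simp add: over_scal_mult)
  qed
  then show ?thesis by simp
qed

text \<open>Evaluation at a primitive vector intertwines \<open>rho \<mu>\<close> with the module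
  action, so everything about the module generated by \<open>u\<close> can be read off from
  words.\<close>

lemma act_rho:
  assumes u: "prim \<mu> u" and p: "p \<in> free_B" and y: "y \<in> free_F"
  shows "act p (act y u) = act (rho \<mu> p y) u"
proof -
  have uc: "u \<in> CM" by (rule prim_carrier [OF u])
  have yc: "act y u \<in> CM" using y uc by (simp add: over_F)
  have w: "wop \<mu> w y \<in> free_F \<and> act (wmon w) (act y u) = act (wop \<mu> w y) u" if "set w \<subseteq> boson_gens D" for w
    using that
  proof (induction w)
    case (Cons g w)
    then have "act (wmon (g # w)) (act y u) = act (letter g) (act (wop \<mu> w y) u)"
      using yc by (simp add: wmon_Cons act_mult)
    also have "\<dots> = act (wop \<mu> (g # w) y) u"
      using Cons by (simp add: act_gop [OF u])
    finally show ?case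
      using Cons by (simp add: gop_over)
  qed (use y yc in simp)
  have "p \<in> free_B \<and> act p (act y u) = act (rho \<mu> p y) u"
    using p
  proof (induction rule: over_induct)
    case zero
    then show ?case using yc uc by (simp add: lin_0 [OF lin_rho_left])
  next
    case (add p r)
    then show ?case
      using yc uc rho_over y by (simp add: over_add act_add lin_add [OF lin_rho_left] over_F)
  next
    case (word c v)
    then show ?case
      using yc uc w [OF word] by (simp add: over_scal_mult act_mult lin_scal [OF lin_rho_left] over_F)
  qed
  then show ?thesis by simp
qed

lemma act_rho_1: "prim \<mu> u \<Longrightarrow> p \<in> free_B \<Longrightarrow> act p u = act (rho \<mu> p 1) u"
  using act_rho [of \<mu> u p 1] prim_carrier by simp

lemma act_serre_ideal: "y \<in> free_F \<Longrightarrow> y \<in> SD.serre_ideal \<Longrightarrow> u \<in> CM \<Longrightarrow> act y u = \<zero>\<^bsub>M\<^esub>"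
  by (intro act_BI serre_ideal_F_BI)

text \<open>The product of \<open>e''_i\<close> that acts on words like
  \<open>ewd w\<close>.\<close>

abbreviation eword :: "('i, 't) boson_gen list \<Rightarrow> ('i, 't) boson_free" where
  "eword w \<equiv> wmon (map f_to_e (rev w))"

lemma eword_over: "set w \<subseteq> F ` I \<Longrightarrow> eword w \<in> free_B"
  by auto

lemma act_eword: "prim \<mu> u \<Longrightarrow> set w \<subseteq> F ` I \<Longrightarrow> y \<in> free_F \<Longrightarrow> act (eword w) (act y u) = act (SD.ewd w y) u"
  using act_rho [of \<mu> u "eword w" y] eword_over [of w] rho_emap [of "rev w" \<mu> y] by simp

text \<open>Nondegeneracy supplies a word in the \<open>e''_i\<close> that turns \<open>y\<close>
  into a nonzero constant modulo the Serre ideal, hence \<open>y u\<close> into a nonzero multiple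
  of \<open>u\<close>.\<close>

lemma prim_escape:
  assumes u: "prim \<mu> u" and y: "y \<in> free_F" "y \<notin> SD.serre_ideal" and N: "sub N" "act y u \<in> N"
  shows "u \<in> N"
proof -
  have uc: "u \<in> CM" by (rule prim_carrier [OF u])
  obtain w c where w: "set w \<subseteq> F ` I" and c: "c \<noteq> 0" and i: "SD.ewd w y - scal c \<in> SD.serre_ideal"
    using SD.nondegenerate [OF y] by blast
  have e: "SD.ewd w y \<in> free_F"
    by (rule SD.ewd_over [OF y(1)])
  have "act (SD.ewd w y) u = act (scal c) u"
    using e i by (intro act_cong serre_ideal_F_BI over_F over_diff) simp_all
  moreover have "act (eword w) (act y u) \<in> N"
    using N eword_over [OF w] unfolding sub_def by blast
  ultimately have "act (scal c) u \<in> N"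
    using act_eword [OF u w y(1)] by simp
  then have "act (scal (1 / c)) (act (scal c) u) \<in> N"
    using N by (simp add: sub_def)
  then show ?thesis
    using c uc by (simp flip: act_mult scal_mult)
qed

text \<open>A submodule missing \<open>u\<close> meets the submodule generated by \<open>u\<close>
  only in zero. This yields complements as well as the simplicity of \<open>H\<close>.\<close>

lemma prim_act_disjoint:
  assumes u: "prim \<mu> u" and N: "sub N" "u \<notin> N" and p: "p \<in> free_B" "act p u \<in> N"
  shows "act p u = \<zero>\<^bsub>M\<^esub>"
proof -
  have r: "rho \<mu> p 1 \<in> free_F" by (rule rho_over [OF p(1)]) simp
  have "rho \<mu> p 1 \<in> SD.serre_ideal"
    using prim_escape [OF u r _ N(1)] N(2) p act_rho_1 [OF u p(1)] by auto
  then show ?thesis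
    using act_rho_1 [OF u p(1)] act_serre_ideal [OF r] prim_carrier [OF u] by simp
qed

lemma sub_zero: "sub {\<zero>\<^bsub>M\<^esub>}"
  by (auto simp: sub_def)

text \<open>The condition on the right depends only on \<mu>. Annihilators of nonzero primitive
  vectors of equal weight therefore coincide, even in different modules.\<close>

lemma prim_act_eq_0_iff:
  assumes u: "prim \<mu> u" "u \<noteq> \<zero>\<^bsub>M\<^esub>" and p: "p \<in> free_B"
  shows "act p u = \<zero>\<^bsub>M\<^esub> \<longleftrightarrow> rho \<mu> p 1 \<in> SD.serre_ideal"
proof -
  have r: "rho \<mu> p 1 \<in> free_F" by (rule rho_over [OF p]) simp
  show ?thesis
    using prim_escape [OF u(1) r _ sub_zero] u(2) act_rho_1 [OF u(1) p] act_serre_ideal [OF r] prim_carrier [OF u(1)]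
    by auto
qed

fun rootf :: "('i, 't) boson_gen \<Rightarrow> 't \<Rightarrow> rat" where
  "rootf (F i) = simple_root D i"
| "rootf _ = 0"

definition rsum :: "('i, 't) boson_gen multiset \<Rightarrow> 't \<Rightarrow> rat" where
  "rsum \<gamma> = (\<Sum>g\<in>#\<gamma>. rootf g)"

lemma zero_weight: "0 \<in> P"
  using lattice by (auto simp: is_lattice_def fun_scale_def fun_eq_iff sum_fun_apply intro!: exI [of _ "\<lambda>_. 0"])

lemma rsum_weight: "set_mset \<gamma> \<subseteq> F ` I \<Longrightarrow> rsum \<gamma> \<in> P"
  by (induction \<gamma>) (auto simp: rsum_def zero_weight intro!: weight_lattice_add simple_root_lattice)

lemma weight_F_word:
  "u \<in> weight_space D M \<mu> \<Longrightarrow> \<mu> \<in> P \<Longrightarrow> set w \<subseteq> F ` I \<Longrightarrow> act (wmon w) u \<in> weight_space D M (\<mu> - rsum (mset w))"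
proof (induction w)
  case Nil
  then show ?case using weight_space_carrier by (simp add: rsum_def)
next
  case (Cons f w)
  then obtain i where f: "f = F i" and i: "i \<in> I" by auto
  have w: "set w \<subseteq> F ` I" using Cons.prems by simp
  have "act (letter (F i)) (act (wmon w) u) \<in> weight_space D M (\<mu> - rsum (mset w) + - simple_root D i)"
    using w by (intro weight_F weight_lattice_diff Cons.IH Cons.prems i rsum_weight) simp_all
  moreover have "\<mu> - rsum (mset w) + - simple_root D i = \<mu> - rsum (mset (f # w))"
    by (simp add: rsum_def f algebra_simps)
  moreover have "act (wmon (f # w)) u = act (letter (F i)) (act (wmon w) u)"
    using w i weight_space_carrier [OF Cons.prems(1)] over_F [of "wmon w"] by (simp add: f wmon_Cons act_mult)
  ultimately show ?case
    by (simp only:)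
qed

lemma weight_E_word:
  "u \<in> weight_space D M \<mu> \<Longrightarrow> \<mu> \<in> P \<Longrightarrow> set w \<subseteq> F ` I \<Longrightarrow> act (eword w) u \<in> weight_space D M (\<mu> + rsum (mset w))"
proof (induction w rule: rev_induct)
  case Nil
  then show ?case using weight_space_carrier by (simp add: rsum_def)
next
  case (snoc f w)
  then obtain i where f: "f = F i" and i: "i \<in> I" by auto
  have w: "set w \<subseteq> F ` I" using snoc.prems by simp
  have "act (letter (E i)) (act (eword w) u) \<in> weight_space D M (\<mu> + rsum (mset w) + simple_root D i)"
    using w by (intro weight_E weight_lattice_add snoc.IH snoc.prems i rsum_weight) simp_all
  moreover have "\<mu> + rsum (mset w) + simple_root D i = \<mu> + rsum (mset (w @ [f]))"
    by (simp add: rsum_def f algebra_simps)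
  moreover have "act (eword (w @ [f])) u = act (letter (E i)) (act (eword w) u)"
    using i weight_space_carrier [OF snoc.prems(1)] eword_over [OF w] by (simp add: f wmon_Cons act_mult)
  ultimately show ?case
    by (simp only:)
qed

lemma foldr_act:
  "set is \<subseteq> I \<Longrightarrow> x \<in> CM \<Longrightarrow> foldr (\<lambda>i v. cls (letter (E i)) \<odot>\<^bsub>M\<^esub> v) is x = act (wmon (map E is)) x"
proof (induction "is")
  case (Cons i "is")
  then have "wmon (map E is) \<in> free_B" by auto
  with Cons show ?case
    by (simp add: wmon_Cons act_mult flip: act_def)
qed simp

text \<open>A weight vector \<open>u\<close> killed by all products of \<open>l + 1\<close> of the \<open>e''\<^sub>i\<close> is corrected by \<open>Y u\<close>, which lies in the submodule
  generated by primitive vectors, to one killed by all products of \<open>l\<close> of them.\<close>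

lemma prim_generate:
  assumes O: "M \<in> category_O D" and N: "sub N" and prim: "\<And>\<mu> u. prim \<mu> u \<Longrightarrow> u \<in> N"
  shows "N = CM"
proof -
  have N0: "\<zero>\<^bsub>M\<^esub> \<in> N" and Nadd: "\<And>x y. x \<in> N \<Longrightarrow> y \<in> N \<Longrightarrow> x \<oplus>\<^bsub>M\<^esub> y \<in> N" and Nc: "N \<subseteq> CM"
    and Nact: "\<And>p x. p \<in> free_B \<Longrightarrow> x \<in> N \<Longrightarrow> act p x \<in> N"
    using N by (auto simp: sub_def)
  have claim: "u \<in> N" if "\<mu> \<in> P" "u \<in> weight_space D M \<mu>"
    "\<And>w. set w \<subseteq> F ` I \<Longrightarrow> length w = l \<Longrightarrow> act (eword w) u = \<zero>\<^bsub>M\<^esub>" for l \<mu> u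
    using that
  proof (induction l arbitrary: \<mu> u)
    case 0
    then have "u = \<zero>\<^bsub>M\<^esub>"
      using "0.prems"(3) [of "[]"] weight_space_carrier [OF "0.prems"(2)] by simp
    then show ?case by (simp add: N0)
  next
    case (Suc l)
    have uc: "u \<in> CM" by (rule weight_space_carrier [OF Suc.prems(2)])
    define W :: "('i, 't) boson_gen list set" where "W = {w. set w \<subseteq> F ` I \<and> length w = l}"
    have fin: "finite W"
      unfolding W_def using finite_lists_length_eq [of "F ` I" l] finite_index by simp
    obtain H where H0: "\<And>a b. H a b \<noteq> 0 \<Longrightarrow> mset a = mset b"
      and H: "\<And>w. w \<in> W \<Longrightarrow> wmon w - (\<Sum>a\<in>W. \<Sum>b\<in>W. scal (SD.coef w (wmon a) * H a b) * wmon b) \<in> SD.serre_ideal"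
      using SD.words_generalized_inverse [of l, folded W_def] by blast
    have wO: "wmon a \<in> free_B" "eword a \<in> free_B" if "a \<in> W" for a
      using that by (auto simp: W_def intro!: over_F eword_over)
    \<comment> \<open>As products of \<open>l + 1\<close> of the \<open>e''_i\<close> kill
      \<open>u\<close>, products of \<open>l\<close> of them send \<open>u\<close> to primitive
      vectors.\<close>
    define v where "v b = act (eword b) u" for b
    have v: "prim (\<mu> + rsum (mset b)) (v b)" if b: "b \<in> W" for b
      unfolding prim_def
    proof (intro conjI ballI)
      show "\<mu> + rsum (mset b) \<in> P"
        using b Suc.prems by (intro weight_lattice_add rsum_weight) (auto simp: W_def)
      show "v b \<in> weight_space D M (\<mu> + rsum (mset b))"
        using b Suc.prems unfolding v_def by (intro weight_E_word) (auto simp: W_def)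
      fix i assume i: "i \<in> I"
      have "act (letter (E i)) (v b) = act (eword (b @ [F i])) u"
        using i wO [OF b] uc by (simp add: v_def wmon_Cons act_mult)
      also have "\<dots> = \<zero>\<^bsub>M\<^esub>"
        using b i by (intro Suc.prems(3)) (auto simp: W_def)
      finally show "act (letter (E i)) (v b) = \<zero>\<^bsub>M\<^esub>" .
    qed
    \<comment> \<open>\<open>Y\<close> is chosen such that \<open>e_w Y u\<close> is the sum of
      \<open>coef w a * H a b\<close> times \<open>e_b u\<close> over \<open>a\<close> and
      \<open>b\<close>, which by the generalized inverse equals \<open>e_w u\<close> for every word
      \<open>w\<close> of length \<open>l\<close>.\<close>
    define Y where "Y = (\<Sum>a\<in>W. \<Sum>b\<in>W. scal (H a b) * (wmon a * eword b))"
    have tO: "scal (H a b) * (wmon a * eword b) \<in> free_B" if "a \<in> W" "b \<in> W" for a b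
      using that wO by (intro over_scal_mult over_mult)
    have YO: "Y \<in> free_B"
      unfolding Y_def by (intro over_sum tO)
    have tact: "act (scal (H a b) * (wmon a * eword b)) u = act (scal (H a b)) (act (wmon a) (v b))"
      if "a \<in> W" "b \<in> W" for a b
      using that wO uc by (simp add: act_mult over_mult v_def)
    have YN: "act Y u \<in> N"
      unfolding Y_def
    proof (intro act_sum_in fin uc over_sum tO N0 Nadd)
      fix a b assume ab: "a \<in> W" "b \<in> W"
      show "act (scal (H a b) * (wmon a * eword b)) u \<in> N"
        unfolding tact [OF ab] using prim [OF v [OF ab(2)]] wO [OF ab(1)] by (intro Nact) simp_all
    qed
    \<comment> \<open>\<open>H a b\<close> vanishes unless \<open>a\<close> and \<open>b\<close>
      have the same letters, so raising by \<open>b\<close> and lowering by \<open>a\<close>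
      compensate each other.\<close>
    have Yw: "act Y u \<in> weight_space D M \<mu>"
      unfolding Y_def
    proof (intro act_sum_in fin uc over_sum tO weight_space_zero weight_space_add)
      fix a b assume ab: "a \<in> W" "b \<in> W"
      have aF: "set a \<subseteq> F ` I" using ab by (simp add: W_def)
      show "act (scal (H a b) * (wmon a * eword b)) u \<in> weight_space D M \<mu>"
      proof (cases "H a b = 0")
        case True
        then show ?thesis using uc by (simp add: weight_space_zero)
      next
        case False
        then have m: "mset a = mset b" by (rule H0)
        have "act (wmon a) (v b) \<in> weight_space D M (\<mu> + rsum (mset b) - rsum (mset a))"
          using v [OF ab(2)] aF by (intro weight_F_word) (auto simp: prim_def)
        moreover have "\<mu> + rsum (mset b) - rsum (mset a) = \<mu>"
          by (simp add: m)
        ultimately show ?thesis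
          unfolding tact [OF ab] by (intro weight_space_scal) simp
      qed
    qed
    define z where "z = act (1 - Y) u"
    have zw: "z \<in> weight_space D M \<mu>"
    proof -
      have "z = act 1 u \<oplus>\<^bsub>M\<^esub> act (scal (-1) * Y) u"
        unfolding z_def using act_add [of 1 "scal (-1) * Y" u] YO uc
        by (simp add: scal_minus over_minus)
      also have "\<dots> \<in> weight_space D M \<mu>"
        using Suc.prems(2) Yw YO uc by (intro weight_space_add) (auto simp: act_mult intro: weight_space_scal)
      finally show ?thesis .
    qed
    have "z \<in> N"
    proof (rule Suc.IH [OF Suc.prems(1) zw])
      fix w :: "('i, 't) boson_gen list" assume w: "set w \<subseteq> F ` I" "length w = l"
      then have wW: "w \<in> W" by (simp add: W_def)
      define Z where "Z = (\<Sum>a\<in>W. \<Sum>b\<in>W. scal (SD.coef w (wmon a) * H a b) * wmon b)"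
      have ZF: "Z \<in> free_F"
        unfolding Z_def by (intro over_sum over_scal_mult) (simp add: W_def)
      \<comment> \<open>The expansion of the word \<open>w\<close> is carried over to the
        \<open>e''_i\<close>; \<open>tau\<close> supplies the reversal built into
        \<open>eword\<close>.\<close>
      have "emap (tau (wmon w - Z)) \<in> BI"
        using H [OF wW] w ZF unfolding Z_def [symmetric]
        by (intro serre_ideal_E_BI SD.serre_ideal_tau tau_over over_diff) simp_all
      then have wZ: "eword w - emap (tau Z) \<in> BI"
        by (simp add: lin_diff [OF lin_tau] lin_diff [OF lin_emap])
      have eZ: "emap (tau Z) = (\<Sum>a\<in>W. \<Sum>b\<in>W. scal (SD.coef w (wmon a) * H a b) * eword b)"
        unfolding Z_def by (simp add: lin_sum [OF lin_tau] lin_sum [OF lin_emap] lin_scal [OF lin_emap])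
      have eO: "scal (SD.coef w (wmon a) * H a b) * eword b \<in> free_B" if "b \<in> W" for a b
        using that wO by (intro over_scal_mult)
      have "act (eword w) u = act (emap (tau Z)) u"
        using wO [OF wW] wZ eO unfolding eZ by (intro act_cong over_sum) simp_all
      also have "\<dots> = act (eword w * Y) u"
        unfolding eZ Y_def sum_distrib_left
      proof (intro act_sum_cong [symmetric] fin uc over_sum over_mult tO eO wO [OF wW])
        fix a b assume ab: "a \<in> W" "b \<in> W"
        have vc: "v b \<in> CM" using v [OF ab(2)] by (rule prim_carrier)
        have e: "SD.ewd w (wmon a) = scal (SD.coef w (wmon a))"
        proof (cases "mset w = mset a")
          case True
          then show ?thesis by (intro SD.ewd_eq_coef) simp
        next
          case False
          have "\<not> mset w \<subseteq># mset a"
          proof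
            assume "mset w \<subseteq># mset a"
            moreover have "size (mset w) = size (mset a)"
              using ab w by (simp add: W_def)
            ultimately show False
              using False by (metis mset_subset_size nat_neq_iff subset_mset.le_imp_less_or_eq)
          qed
          then have "SD.ewd w (wmon a) = 0"
            using SD.ewd_homog [of "mset a" "wmon a" w] by simp
          then show ?thesis by (simp add: SD.coef_def)
        qed
        have "act (eword w * (scal (H a b) * (wmon a * eword b))) u
            = act (scal (H a b) * eword w) (act (wmon a) (v b))"
          using ab wO wO [OF wW] uc
          by (simp add: wmon_scal act_mult over_mult v_def)
        also have "\<dots> = act (scal (H a b)) (act (scal (SD.coef w (wmon a))) (v b))"
          using ab vc wO [OF wW] wO(1) [OF ab(1)] act_eword [OF v [OF ab(2)] w(1), of "wmon a"]
          by (simp add: act_mult e W_def)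
        also have "\<dots> = act (scal (SD.coef w (wmon a) * H a b) * eword b) u"
          using ab vc wO(2) [OF ab(2)] uc
          by (simp add: v_def act_mult scal_mult [symmetric] mult.commute flip: act_mult [of "scal _" "scal _"])
        finally show "act (scal (SD.coef w (wmon a) * H a b) * eword b) u
            = act (eword w * (scal (H a b) * (wmon a * eword b))) u" ..
      qed (simp_all add: wO del: over_wmon)
      finally have "act (eword w) u = act (eword w * Y) u"
        by simp
      moreover have "act (eword w) z = act (eword w * (1 - Y)) u"
        using wO [OF wW] YO uc by (simp add: z_def act_mult over_diff)
      moreover have "\<dots> = act (eword w) u \<ominus>\<^bsub>M\<^esub> act (eword w * Y) u"
        using wO [OF wW] YO uc act_diff [of "eword w" "eword w * Y" u]
        by (simp add: right_diff_distrib over_mult)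
      moreover have "act (eword w * Y) u \<in> CM"
        using wO [OF wW] YO uc by (intro act_closed over_mult)
      ultimately show "act (eword w) z = \<zero>\<^bsub>M\<^esub>"
        by (simp add: a_minus_def LM.M.r_neg)
    qed
    then have "z \<oplus>\<^bsub>M\<^esub> act Y u \<in> N"
      using YN by (rule Nadd)
    moreover have "z \<oplus>\<^bsub>M\<^esub> act Y u = u"
      using act_add [of "1 - Y" Y u] YO uc by (simp add: z_def over_diff)
    ultimately show ?case by simp
  qed
  have "CM \<subseteq> N"
  proof
    fix u assume u: "u \<in> CM"
    have ds: "is_direct_sum M P (weight_space D M)"
      and nil: "\<And>u. u \<in> CM \<Longrightarrow> \<exists>l>0. \<forall>is. length is = l \<and> set is \<subseteq> I \<longrightarrow>
        foldr (\<lambda>i v. cls (letter (E i)) \<odot>\<^bsub>M\<^esub> v) is u = \<zero>\<^bsub>M\<^esub>"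
      using O by (auto simp: category_O_def)
    obtain c where c: "\<And>l. l \<in> P \<Longrightarrow> c l \<in> weight_space D M l" and c0: "\<And>l. l \<notin> P \<Longrightarrow> c l = \<zero>\<^bsub>M\<^esub>"
      and fc: "finite {l. c l \<noteq> \<zero>\<^bsub>M\<^esub>}" and us: "u = finsum M c {l. c l \<noteq> \<zero>\<^bsub>M\<^esub>}"
      using ds u unfolding is_direct_sum_def by blast
    have cN: "c \<mu> \<in> N" for \<mu>
    proof (cases "\<mu> \<in> P")
      case True
      note cw = c [OF True]
      obtain l where l: "\<And>is. length is = l \<Longrightarrow> set is \<subseteq> I \<Longrightarrow>
          foldr (\<lambda>i v. cls (letter (E i)) \<odot>\<^bsub>M\<^esub> v) is (c \<mu>) = \<zero>\<^bsub>M\<^esub>"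
        using nil [OF weight_space_carrier [OF cw]] by blast
      show ?thesis
      proof (rule claim [OF True cw])
        fix w :: "('i, 't) boson_gen list" assume w: "set w \<subseteq> F ` I" "length w = l"
        then obtain "is" where "is": "w = map F is" "set is \<subseteq> I"
          by (induction w arbitrary: l) (auto simp: Cons_eq_map_conv, metis insert_subset list.simps(15))
        have "act (eword w) (c \<mu>) = foldr (\<lambda>i v. cls (letter (E i)) \<odot>\<^bsub>M\<^esub> v) (rev is) (c \<mu>)"
          using "is" weight_space_carrier [OF cw] by (subst foldr_act) (auto simp: rev_map o_def)
        then show "act (eword w) (c \<mu>) = \<zero>\<^bsub>M\<^esub>"
          using l [of "rev is"] "is" w by simp
      qed
    next
      case False
      then show ?thesis by (simp add: c0 N0)
    qed
    have "finsum M c A \<in> N" if "finite A" for A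
      using that
    proof (induction A rule: finite_induct)
      case (insert x A)
      then show ?case
        using cN Nc by (subst LM.M.finsum_insert) (auto intro: Nadd)
    qed (simp add: N0)
    then show "u \<in> N"
      using us fc by simp
  qed
  then show ?thesis
    using Nc by blast
qed

section \<open>Weight decompositions and complements\<close>

lemma finsum_in_CM: "(\<And>l. l \<in> A \<Longrightarrow> c l \<in> CM) \<Longrightarrow> finsum M c A \<in> CM"
  by (intro LM.M.finsum_closed) auto

lemma act_finsum:
  assumes "finite A" "p \<in> free_B" "\<And>l. l \<in> A \<Longrightarrow> c l \<in> CM"
  shows "act p (finsum M c A) = finsum M (\<lambda>l. act p (c l)) A"
  using assms
proof (induction A rule: finite_induct)
  case (insert x A)
  then show ?case
    by (simp add: LM.M.finsum_insert act_radd finsum_in_CM Pi_def)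
qed simp

lemma finsum_superset:
  assumes "finite A" "{l. c l \<noteq> \<zero>\<^bsub>M\<^esub>} \<subseteq> A" "\<And>l. c l \<in> CM"
  shows "finsum M c {l. c l \<noteq> \<zero>\<^bsub>M\<^esub>} = finsum M c A"
  using assms by (intro LM.M.add.finprod_mono_neutral_cong_left) auto

lemma act_K_weight:
  "u \<in> weight_space D M \<phi> \<Longrightarrow> h \<in> Q \<Longrightarrow>
    act (letter (K h) - scal a) u = act (scal (qpow (\<phi> h) - a)) u"
proof -
  assume u: "u \<in> weight_space D M \<phi>" and h: "h \<in> Q"
  have uc: "u \<in> CM" by (rule weight_space_carrier [OF u])
  have "act (letter (K h) - scal a) u = act (letter (K h)) u \<ominus>\<^bsub>M\<^esub> act (scal a) u"
    using h uc by (intro act_diff) simp_all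
  also have "act (letter (K h)) u = act (scal (qpow (\<phi> h))) u"
    using u h by (simp add: weight_space_act)
  also have "\<dots> \<ominus>\<^bsub>M\<^esub> act (scal a) u = act (scal (qpow (\<phi> h) - a)) u"
    using uc by (simp add: scal_diff act_diff)
  finally show ?thesis .
qed

text \<open>Applying \<open>q^h\<close> minus its eigenvalue on the component \<open>a\<close>
  removes that component and multiplies another one by a nonzero factor if \<open>h\<close>
  separates the two weights; the shorter sum falls under the induction hypothesis.\<close>

lemma weight_spaces_independent:
  assumes "finite A"
  shows "A \<subseteq> P \<Longrightarrow> (\<And>l. l \<in> A \<Longrightarrow> c l \<in> weight_space D M l) \<Longrightarrow> finsum M c A = \<zero>\<^bsub>M\<^esub> \<Longrightarrow>
    \<forall>l\<in>A. c l = \<zero>\<^bsub>M\<^esub>"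
  using assms
proof (induction A arbitrary: c rule: finite_induct)
  case (insert a A)
  have cc: "c l \<in> CM" if "l \<in> insert a A" for l
    using insert.prems(2) [OF that] by (rule weight_space_carrier)
  have sum: "c a \<oplus>\<^bsub>M\<^esub> finsum M c A = \<zero>\<^bsub>M\<^esub>"
    using insert cc by (subst LM.M.finsum_insert [symmetric]) auto
  have cA: "c b = \<zero>\<^bsub>M\<^esub>" if b: "b \<in> A" for b
  proof -
    have ab: "a \<in> P" "b \<in> P" "b \<noteq> a"
      using b insert by auto
    obtain h where h: "h \<in> Q" and ne: "b h \<noteq> a h"
      using weight_separation [OF ab(2,1,3)] by blast
    define T :: "('i, 't) boson_free" where "T = letter (K h) - scal (qpow (a h))"
    have T: "T \<in> free_B" unfolding T_def using h by (intro over_diff) simp_all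
    have Tc: "act T (c l) = act (scal (qpow (l h) - qpow (a h))) (c l)" if "l \<in> insert a A" for l
      unfolding T_def by (rule act_K_weight [OF insert.prems(2) [OF that] h])
    have "act T (c a \<oplus>\<^bsub>M\<^esub> finsum M c A) = \<zero>\<^bsub>M\<^esub>"
      unfolding sum using T by simp
    moreover have "act T (c a) = \<zero>\<^bsub>M\<^esub>"
      using Tc [of a] cc [of a] by simp
    ultimately have "act T (finsum M c A) = \<zero>\<^bsub>M\<^esub>"
      using T cc by (simp add: act_radd finsum_in_CM)
    then have "finsum M (\<lambda>l. act T (c l)) A = \<zero>\<^bsub>M\<^esub>"
      using act_finsum [OF insert.hyps(1) T, of c] cc by simp
    moreover have "act T (c l) \<in> weight_space D M l" if "l \<in> A" for l
      using that insert.prems(2) [of l] by (simp add: Tc weight_space_scal)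
    ultimately have "\<forall>l\<in>A. act T (c l) = \<zero>\<^bsub>M\<^esub>"
      using insert.prems(1) by (intro insert.IH) auto
    then have "act (scal (qpow (b h) - qpow (a h))) (c b) = \<zero>\<^bsub>M\<^esub>"
      using b Tc [of b] by simp
    moreover have "qpow (b h) - qpow (a h) \<noteq> 0"
      using ne qpow_inj [of "b h" "a h"] weight_int [OF ab(1) h] weight_int [OF ab(2) h] by auto
    ultimately show ?thesis
      using b cc [of b] act_scal_0 by blast
  qed
  have "finsum M c A = finsum M (\<lambda>l. \<zero>\<^bsub>M\<^esub>) A"
    by (rule LM.M.finsum_cong') (auto simp: cA)
  then have "finsum M c A = \<zero>\<^bsub>M\<^esub>"
    by (simp add: LM.M.finsum_zero)
  then show ?case
    using cA sum cc by auto
qed simp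

text \<open>This captures the existence half of the weight decomposition; uniqueness holds in every
  module by \<open>weight_spaces_independent\<close>.\<close>

inductive_set weight_sums :: "'m set" where
  zero: "\<zero>\<^bsub>M\<^esub> \<in> weight_sums"
| add: "u \<in> weight_sums \<Longrightarrow> v \<in> weight_space D M \<mu> \<Longrightarrow> \<mu> \<in> P \<Longrightarrow> v \<oplus>\<^bsub>M\<^esub> u \<in> weight_sums"

lemma weight_sums_carrier: "u \<in> weight_sums \<Longrightarrow> u \<in> CM"
  by (induction rule: weight_sums.induct) (auto dest: weight_space_carrier)

lemma weight_sums_add: "u \<in> weight_sums \<Longrightarrow> v \<in> weight_sums \<Longrightarrow> u \<oplus>\<^bsub>M\<^esub> v \<in> weight_sums"
proof (induction rule: weight_sums.induct)
  case zero
  then show ?case by (simp add: weight_sums_carrier)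
next
  case (add u w \<mu>)
  then show ?case
    using weight_sums_carrier weight_space_carrier by (simp add: LM.M.a_assoc weight_sums.add)
qed

lemma weight_sums_decomposition:
  "u \<in> weight_sums \<Longrightarrow> \<exists>c. (\<forall>l\<in>P. c l \<in> weight_space D M l) \<and> (\<forall>l. l \<notin> P \<longrightarrow> c l = \<zero>\<^bsub>M\<^esub>) \<and>
    finite {l. c l \<noteq> \<zero>\<^bsub>M\<^esub>} \<and> u = finsum M c {l. c l \<noteq> \<zero>\<^bsub>M\<^esub>}"
proof (induction rule: weight_sums.induct)
  case zero
  show ?case
    by (rule exI [of _ "\<lambda>_. \<zero>\<^bsub>M\<^esub>"]) (simp add: weight_space_zero)
next
  case (add u v \<mu>)
  then obtain c where c: "\<And>l. l \<in> P \<Longrightarrow> c l \<in> weight_space D M l" and c0: "\<And>l. l \<notin> P \<Longrightarrow> c l = \<zero>\<^bsub>M\<^esub>"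
    and fin: "finite {l. c l \<noteq> \<zero>\<^bsub>M\<^esub>}" and u: "u = finsum M c {l. c l \<noteq> \<zero>\<^bsub>M\<^esub>}"
    by blast
  have cc: "c l \<in> CM" for l
    using c [of l] c0 [of l] by (cases "l \<in> P") (auto dest: weight_space_carrier)
  have vc: "v \<in> CM" by (rule weight_space_carrier [OF add.hyps(2)])
  define c' where "c' = c (\<mu> := v \<oplus>\<^bsub>M\<^esub> c \<mu>)"
  have cc': "c' l \<in> CM" for l
    using cc vc by (simp add: c'_def)
  define A where "A = {l. c l \<noteq> \<zero>\<^bsub>M\<^esub>} - {\<mu>}"
  have A: "finite A" "\<mu> \<notin> A" "{l. c l \<noteq> \<zero>\<^bsub>M\<^esub>} \<subseteq> insert \<mu> A" "{l. c' l \<noteq> \<zero>\<^bsub>M\<^esub>} \<subseteq> insert \<mu> A"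
    using fin by (auto simp: A_def c'_def split: if_splits)
  have "finsum M c' {l. c' l \<noteq> \<zero>\<^bsub>M\<^esub>} = finsum M c' (insert \<mu> A)"
    using A cc' by (intro finsum_superset) auto
  also have "\<dots> = c' \<mu> \<oplus>\<^bsub>M\<^esub> finsum M c' A"
    using A cc' by (intro LM.M.finsum_insert) auto
  also have "finsum M c' A = finsum M c A"
    using A cc by (intro LM.M.finsum_cong') (auto simp: c'_def)
  also have "c' \<mu> \<oplus>\<^bsub>M\<^esub> finsum M c A = v \<oplus>\<^bsub>M\<^esub> (c \<mu> \<oplus>\<^bsub>M\<^esub> finsum M c A)"
    using vc cc finsum_in_CM [of A c] by (simp add: c'_def LM.M.a_assoc)
  also have "c \<mu> \<oplus>\<^bsub>M\<^esub> finsum M c A = finsum M c (insert \<mu> A)"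
    using A cc by (intro LM.M.finsum_insert [symmetric]) auto
  also have "\<dots> = u"
    unfolding u using A cc by (intro finsum_superset [symmetric]) auto
  finally have "v \<oplus>\<^bsub>M\<^esub> u = finsum M c' {l. c' l \<noteq> \<zero>\<^bsub>M\<^esub>}" ..
  moreover have "finite {l. c' l \<noteq> \<zero>\<^bsub>M\<^esub>}"
    using A finite_subset by blast
  moreover have "\<forall>l\<in>P. c' l \<in> weight_space D M l" "\<forall>l. l \<notin> P \<longrightarrow> c' l = \<zero>\<^bsub>M\<^esub>"
    using c c0 add.hyps weight_space_add by (auto simp: c'_def)
  ultimately show ?case by blast
qed

lemma category_O_I:
  assumes W: "CM \<subseteq> weight_sums"
    and nil: "\<And>u. u \<in> CM \<Longrightarrow> \<exists>l>0. \<forall>w. length w = l \<and> set w \<subseteq> F ` I \<longrightarrow> act (eword w) u = \<zero>\<^bsub>M\<^esub>"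
  shows "M \<in> category_O D"
  unfolding category_O_def mem_Collect_eq
proof (intro conjI ballI left_mod)
  show "is_direct_sum M P (weight_space D M)"
    unfolding is_direct_sum_def
  proof (intro ballI ex_ex1I)
    fix u assume "u \<in> CM"
    with W show "\<exists>c. (\<forall>l\<in>P. c l \<in> weight_space D M l) \<and> (\<forall>l. l \<notin> P \<longrightarrow> c l = \<zero>\<^bsub>M\<^esub>) \<and>
        finite {l. c l \<noteq> \<zero>\<^bsub>M\<^esub>} \<and> u = finsum M c {l. c l \<noteq> \<zero>\<^bsub>M\<^esub>}"
      by (intro weight_sums_decomposition) auto
  next
    fix u c c'
    assume "(\<forall>l\<in>P. c l \<in> weight_space D M l) \<and> (\<forall>l. l \<notin> P \<longrightarrow> c l = \<zero>\<^bsub>M\<^esub>) \<and>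
        finite {l. c l \<noteq> \<zero>\<^bsub>M\<^esub>} \<and> u = finsum M c {l. c l \<noteq> \<zero>\<^bsub>M\<^esub>}"
      and "(\<forall>l\<in>P. c' l \<in> weight_space D M l) \<and> (\<forall>l. l \<notin> P \<longrightarrow> c' l = \<zero>\<^bsub>M\<^esub>) \<and>
        finite {l. c' l \<noteq> \<zero>\<^bsub>M\<^esub>} \<and> u = finsum M c' {l. c' l \<noteq> \<zero>\<^bsub>M\<^esub>}"
    then have c: "\<And>l. l \<in> P \<Longrightarrow> c l \<in> weight_space D M l" "\<And>l. l \<notin> P \<Longrightarrow> c l = \<zero>\<^bsub>M\<^esub>"
        "finite {l. c l \<noteq> \<zero>\<^bsub>M\<^esub>}" "u = finsum M c {l. c l \<noteq> \<zero>\<^bsub>M\<^esub>}"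
      and c': "\<And>l. l \<in> P \<Longrightarrow> c' l \<in> weight_space D M l" "\<And>l. l \<notin> P \<Longrightarrow> c' l = \<zero>\<^bsub>M\<^esub>"
        "finite {l. c' l \<noteq> \<zero>\<^bsub>M\<^esub>}" "u = finsum M c' {l. c' l \<noteq> \<zero>\<^bsub>M\<^esub>}"
      by blast+
    have cc: "c l \<in> CM" "c' l \<in> CM" for l
      using c(1,2) [of l] c'(1,2) [of l] by (cases "l \<in> P"; auto dest: weight_space_carrier)+
    define A where "A = {l. c l \<noteq> \<zero>\<^bsub>M\<^esub>} \<union> {l. c' l \<noteq> \<zero>\<^bsub>M\<^esub>}"
    have A: "finite A" "A \<subseteq> P"
      using c(2,3) c'(2,3) by (auto simp: A_def)
    have uA: "u = finsum M c A" "u = finsum M c' A"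
      using c(4) c'(4) finsum_superset [of A c] finsum_superset [of A c'] A cc by (auto simp: A_def)
    define m :: "('i, 't) boson_free" where "m = scal (-1)"
    have mact: "act m x = \<ominus>\<^bsub>M\<^esub> x" if "x \<in> CM" for x
      using that act_minus [of 1 x] by (simp add: m_def scal_minus)
    define e where "e l = c l \<oplus>\<^bsub>M\<^esub> act m (c' l)" for l
    have mO: "m \<in> free_B" by (simp add: m_def)
    have "finsum M e A = finsum M c A \<oplus>\<^bsub>M\<^esub> finsum M (\<lambda>l. act m (c' l)) A"
      unfolding e_def using cc mO by (intro LM.M.finsum_addf) auto
    also have "finsum M (\<lambda>l. act m (c' l)) A = act m (finsum M c' A)"
      using A mO cc by (intro act_finsum [symmetric]) auto
    also have "finsum M c A \<oplus>\<^bsub>M\<^esub> act m (finsum M c' A) = \<zero>\<^bsub>M\<^esub>"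
      using uA cc finsum_in_CM [of A c] by (simp add: mact LM.M.r_neg)
    finally have "\<forall>l\<in>A. e l = \<zero>\<^bsub>M\<^esub>"
      using A c(1) c'(1)
      by (intro weight_spaces_independent) (auto simp: e_def m_def intro!: weight_space_add weight_space_scal)
    moreover have "c l = c' l" if "e l = \<zero>\<^bsub>M\<^esub>" for l
    proof -
      have "c l \<oplus>\<^bsub>M\<^esub> \<ominus>\<^bsub>M\<^esub> c' l = \<zero>\<^bsub>M\<^esub>"
        using that cc(2) [of l] by (simp add: e_def mact)
      then have "\<ominus>\<^bsub>M\<^esub> (\<ominus>\<^bsub>M\<^esub> c' l) = c l"
        using cc by (intro LM.M.minus_equality LM.M.a_inv_closed)
      then show ?thesis
        using LM.M.minus_minus [OF cc(2)] by simp
    qed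
    ultimately have cA: "c l = c' l" if "l \<in> A" for l
      using that by blast
    show "c = c'"
    proof
      fix l
      show "c l = c' l"
      proof (cases "l \<in> A")
        case False
        then show ?thesis by (simp add: A_def)
      qed (rule cA)
    qed
  qed
next
  fix u assume u: "u \<in> CM"
  obtain l where "l > 0" and l: "\<And>w. length w = l \<Longrightarrow> set w \<subseteq> F ` I \<Longrightarrow> act (eword w) u = \<zero>\<^bsub>M\<^esub>"
    using nil [OF u] by blast
  have "foldr (\<lambda>i v. cls (letter (E i)) \<odot>\<^bsub>M\<^esub> v) is u = \<zero>\<^bsub>M\<^esub>" if "length is = l" "set is \<subseteq> I" for "is"
    using foldr_act [OF that(2) u] l [of "rev (map F is)"] that by (auto simp: rev_map o_def)
  with \<open>l > 0\<close> show "\<exists>l>0. \<forall>is. length is = l \<and> set is \<subseteq> I \<longrightarrow>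
      foldr (\<lambda>i v. cls (letter (E i)) \<odot>\<^bsub>M\<^esub> v) is u = \<zero>\<^bsub>M\<^esub>"
    by blast
qed

definition cyc :: "'m \<Rightarrow> 'm set" where
  "cyc u = (\<lambda>p. act p u) ` free_B"

lemma cyc_sub: "u \<in> CM \<Longrightarrow> sub (cyc u)"
  unfolding sub_def cyc_def
proof (intro conjI ballI)
  assume u: "u \<in> CM"
  show "\<zero>\<^bsub>M\<^esub> \<in> (\<lambda>p. act p u) ` free_B"
    using u by (intro image_eqI [of _ _ 0]) simp_all
  show "x \<oplus>\<^bsub>M\<^esub> y \<in> (\<lambda>p. act p u) ` free_B" if "x \<in> (\<lambda>p. act p u) ` free_B" "y \<in> (\<lambda>p. act p u) ` free_B" for x y
    using that u by (auto simp flip: act_add intro: over_add)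
  show "act p x \<in> (\<lambda>p. act p u) ` free_B" if "p \<in> free_B" "x \<in> (\<lambda>p. act p u) ` free_B" for p x
    using that u by (auto simp flip: act_mult intro: over_mult)
qed auto

lemma cyc_self: "u \<in> CM \<Longrightarrow> u \<in> cyc u"
  unfolding cyc_def by (intro image_eqI [of _ _ 1]) simp_all

lemma cyc_F: "prim \<mu> u \<Longrightarrow> x \<in> cyc u \<Longrightarrow> \<exists>y\<in>free_F. x = act y u"
  using act_rho_1 rho_over unfolding cyc_def by fastforce

text \<open>Words in the \<open>f_i\<close> send \<open>u\<close> to weight vectors, and iterated
  derivations longer than all words of \<open>y\<close> annihilate \<open>y\<close>, which gives the
  nilpotency condition.\<close>

lemma cyc_category_O:
  assumes u: "prim \<mu> u" and gen: "CM = cyc u"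
  shows "M \<in> category_O D"
proof (rule category_O_I)
  have uc: "u \<in> CM" by (rule prim_carrier [OF u])
  have ws: "y \<in> free_F \<and> act y u \<in> weight_sums" if "y \<in> free_F" for y
    using that
  proof (induction rule: over_induct)
    case zero
    then show ?case using uc by (simp add: weight_sums.zero)
  next
    case (add p r)
    then show ?case using uc by (simp add: over_add over_F act_add weight_sums_add)
  next
    case (word c w)
    have "act (wmon w) u \<in> weight_space D M (\<mu> - rsum (mset w))"
      using u word by (intro weight_F_word) (auto simp: prim_def)
    then have "act (scal c) (act (wmon w) u) \<in> weight_space D M (\<mu> - rsum (mset w))"
      by (rule weight_space_scal)
    moreover have "act (scal c) (act (wmon w) u) = act (scal c * wmon w) u"
      using word uc over_F [of "wmon w"] by (simp add: act_mult)
    moreover have "\<mu> - rsum (mset w) \<in> P"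
      using u word by (intro weight_lattice_diff rsum_weight) (auto simp: prim_def)
    ultimately show ?case
      using weight_sums.add [OF weight_sums.zero, of "act (scal c * wmon w) u" "\<mu> - rsum (mset w)"] word
        weight_space_carrier by (simp add: over_scal_mult)
  qed
  show "CM \<subseteq> weight_sums"
    using gen cyc_F [OF u] ws by blast
  fix x assume "x \<in> CM"
  then obtain y where y: "y \<in> free_F" and x: "x = act y u"
    using gen cyc_F [OF u] by blast
  have "\<exists>l. \<forall>w. l \<le> length w \<longrightarrow> SD.ewd w y = 0"
    using y
  proof (induction rule: over_induct)
    case zero
    then show ?case by (simp add: lin_0 [OF SD.lin_ewd])
  next
    case (add p r)
    then obtain a b where "\<And>w. a \<le> length w \<Longrightarrow> SD.ewd w p = 0" "\<And>w. b \<le> length w \<Longrightarrow> SD.ewd w r = 0"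
      by blast
    then show ?case
      by (intro exI [of _ "max a b"]) (simp add: lin_add [OF SD.lin_ewd])
  next
    case (word c v)
    have "SD.ewd w (wmon v) = 0" if "Suc (length v) \<le> length w" for w
    proof -
      have "\<not> mset w \<subseteq># mset v"
        using that size_mset_mono [of "mset w" "mset v"] by auto
      then show ?thesis
        using SD.ewd_homog [of "mset v" "wmon v" w] by simp
    qed
    then show ?case
      by (intro exI [of _ "Suc (length v)"]) (simp add: lin_scal [OF SD.lin_ewd])
  qed
  then obtain l where l: "\<And>w. l \<le> length w \<Longrightarrow> SD.ewd w y = 0" by blast
  \<comment> \<open>The successor only serves to make the length positive.\<close>
  have "act (eword w) x = \<zero>\<^bsub>M\<^esub>" if "length w = Suc l" "set w \<subseteq> F ` I" for w
    using act_eword [OF u that(2) y] l [of w] that uc by (simp add: x)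
  then show "\<exists>l>0. \<forall>w. length w = l \<and> set w \<subseteq> F ` I \<longrightarrow> act (eword w) x = \<zero>\<^bsub>M\<^esub>"
    by (intro exI [of _ "Suc l"]) auto
qed

lemma sub_left_module:
  assumes N: "sub N"
  shows "boson_module D (M\<lparr>carrier := N\<rparr>)"
proof -
  have Nc: "\<And>x. x \<in> N \<Longrightarrow> x \<in> CM" and N0: "\<zero>\<^bsub>M\<^esub> \<in> N"
    and Nadd: "\<And>x y. x \<in> N \<Longrightarrow> y \<in> N \<Longrightarrow> x \<oplus>\<^bsub>M\<^esub> y \<in> N"
    using N by (auto simp: sub_def)
  have Nsm: "a \<odot>\<^bsub>M\<^esub> x \<in> N" if "a \<in> carrier B" "x \<in> N" for a x
    using cls_surj [OF that(1)] that(2) N by (auto simp: sub_def act_def)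
  have "abelian_group (M\<lparr>carrier := N\<rparr>)"
  proof (rule abelian_groupI)
    fix x assume "x \<in> carrier (M\<lparr>carrier := N\<rparr>)"
    then have "x \<in> N" by simp
    then show "\<exists>y\<in>carrier (M\<lparr>carrier := N\<rparr>). y \<oplus>\<^bsub>M\<lparr>carrier := N\<rparr>\<^esub> x = \<zero>\<^bsub>M\<lparr>carrier := N\<rparr>\<^esub>"
      using sub_neg [OF N] Nc by (intro bexI [of _ "\<ominus>\<^bsub>M\<^esub> x"]) (simp_all add: LM.M.l_neg)
  qed (use Nc N0 Nadd in \<open>simp_all add: LM.M.a_ac\<close>)
  then have "left_module B (M\<lparr>carrier := N\<rparr>)"
    using Nc Nsm
    by (intro left_module.intro left_module_axioms.intro B_ring)
      (simp_all add: LM.smult_l_distr LM.smult_r_distr LM.smult_assoc LM.smult_one)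
  then show ?thesis
    by (intro boson_module.intro boson_module_axioms.intro kac_moody_data_axioms)
qed

lemma cyc_sub_category_O:
  assumes u: "prim \<mu> u"
  shows "M\<lparr>carrier := cyc u\<rparr> \<in> category_O D"
proof -
  have uc: "u \<in> CM" by (rule prim_carrier [OF u])
  interpret N: boson_module D "M\<lparr>carrier := cyc u\<rparr>"
    by (rule sub_left_module [OF cyc_sub [OF uc]])
  have act: "N.act = act"
    by (simp add: fun_eq_iff N.act_def act_def)
  have "N.prim \<mu> u"
    using u cyc_self [OF uc] by (simp add: N.prim_def prim_def N.weight_space_act weight_space_act act)
  moreover have "N.cyc u = cyc u"
  proof -
    have "N.cyc u = (\<lambda>p. act p u) ` free_B"
      unfolding N.cyc_def act ..
    then show ?thesis
      by (simp only: cyc_def)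
  qed
  ultimately show ?thesis
    using N.cyc_category_O [of \<mu> u] by simp
qed

text \<open>If zero were the only primitive vector, the zero submodule would satisfy the hypothesis
  of \<open>prim_generate\<close> and fill the module.\<close>

lemma simple_generator:
  assumes "simple_object B (category_O D) M"
  obtains \<mu> u where "prim \<mu> u" "u \<noteq> \<zero>\<^bsub>M\<^esub>" "CM = cyc u"
proof -
  have O: "M \<in> category_O D" and ne: "CM \<noteq> {\<zero>\<^bsub>M\<^esub>}"
    and simple: "\<And>L. sub L \<Longrightarrow> M\<lparr>carrier := L\<rparr> \<in> category_O D \<Longrightarrow> L = {\<zero>\<^bsub>M\<^esub>} \<or> L = CM"
    using assms by (auto simp: simple_object_def submodule_iff_sub)
  obtain \<mu> u where u: "prim \<mu> u" "u \<noteq> \<zero>\<^bsub>M\<^esub>"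
    using prim_generate [OF O sub_zero] ne by auto
  have uc: "u \<in> CM" by (rule prim_carrier [OF u(1)])
  have "cyc u = {\<zero>\<^bsub>M\<^esub>} \<or> cyc u = CM"
    by (intro simple cyc_sub uc cyc_sub_category_O [OF u(1)])
  then show ?thesis
    using that [OF u] cyc_self [OF uc] u(2) by auto
qed

lemma set_add_iff: "x \<in> L <+>\<^bsub>M\<^esub> N \<longleftrightarrow> (\<exists>l\<in>L. \<exists>n\<in>N. x = l \<oplus>\<^bsub>M\<^esub> n)"
  by (auto simp: set_add_def')

lemma sub_set_add:
  assumes L: "sub L" and N: "sub N"
  shows "sub (L <+>\<^bsub>M\<^esub> N)"
proof -
  have c: "\<And>x. x \<in> L \<Longrightarrow> x \<in> CM" "\<And>x. x \<in> N \<Longrightarrow> x \<in> CM"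
    using L N by (auto simp: sub_def)
  have "\<zero>\<^bsub>M\<^esub> \<in> L <+>\<^bsub>M\<^esub> N"
    unfolding set_add_iff using L N by (intro bexI [of _ "\<zero>\<^bsub>M\<^esub>"]) (auto simp: sub_def)
  moreover have "x \<oplus>\<^bsub>M\<^esub> y \<in> L <+>\<^bsub>M\<^esub> N" if xy: "x \<in> L <+>\<^bsub>M\<^esub> N" "y \<in> L <+>\<^bsub>M\<^esub> N" for x y
  proof -
    obtain l n l' n' where *: "l \<in> L" "n \<in> N" "x = l \<oplus>\<^bsub>M\<^esub> n" "l' \<in> L" "n' \<in> N" "y = l' \<oplus>\<^bsub>M\<^esub> n'"
      using xy by (auto simp: set_add_iff)
    have "x \<oplus>\<^bsub>M\<^esub> y = (l \<oplus>\<^bsub>M\<^esub> l') \<oplus>\<^bsub>M\<^esub> (n \<oplus>\<^bsub>M\<^esub> n')"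
      using * c by (simp add: LM.M.a_ac)
    moreover have "l \<oplus>\<^bsub>M\<^esub> l' \<in> L" "n \<oplus>\<^bsub>M\<^esub> n' \<in> N"
      using * L N by (auto simp: sub_def)
    ultimately show ?thesis unfolding set_add_iff by blast
  qed
  moreover have "act p x \<in> L <+>\<^bsub>M\<^esub> N" if p: "p \<in> free_B" and x: "x \<in> L <+>\<^bsub>M\<^esub> N" for p x
  proof -
    obtain l n where *: "l \<in> L" "n \<in> N" "x = l \<oplus>\<^bsub>M\<^esub> n"
      using x by (auto simp: set_add_iff)
    then have "act p x = act p l \<oplus>\<^bsub>M\<^esub> act p n"
      using p c by (simp add: act_radd)
    moreover have "act p l \<in> L" "act p n \<in> N"
      using * p L N by (auto simp: sub_def)
    ultimately show ?thesis unfolding set_add_iff by blast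
  qed
  ultimately show ?thesis
    using c by (auto simp: sub_def set_add_iff)
qed

lemma set_add_incl:
  assumes L: "sub L" and N: "sub N"
  shows "L \<subseteq> L <+>\<^bsub>M\<^esub> N" "N \<subseteq> L <+>\<^bsub>M\<^esub> N"
proof -
  have c: "L \<subseteq> CM" "N \<subseteq> CM" "\<zero>\<^bsub>M\<^esub> \<in> L" "\<zero>\<^bsub>M\<^esub> \<in> N"
    using L N by (auto simp: sub_def)
  show "L \<subseteq> L <+>\<^bsub>M\<^esub> N"
  proof
    fix x assume "x \<in> L"
    then show "x \<in> L <+>\<^bsub>M\<^esub> N"
      unfolding set_add_iff using c by (intro bexI [of _ x] bexI [of _ "\<zero>\<^bsub>M\<^esub>"]) auto
  qed
  show "N \<subseteq> L <+>\<^bsub>M\<^esub> N"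
  proof
    fix x assume "x \<in> N"
    then show "x \<in> L <+>\<^bsub>M\<^esub> N"
      unfolding set_add_iff using c by (intro bexI [of _ "\<zero>\<^bsub>M\<^esub>"] bexI [of _ x]) auto
  qed
qed

text \<open>A submodule maximal among those meeting \<open>L\<close> trivially is a complement, because adjoining to it the
  submodule generated by a primitive vector outside \<open>L + N\<close> keeps the intersection trivial.\<close>

lemma complement_exists:
  assumes O: "M \<in> category_O D" and L: "sub L"
  obtains N where "sub N" "L \<inter> N = {\<zero>\<^bsub>M\<^esub>}" "L <+>\<^bsub>M\<^esub> N = CM"
proof -
  define X where "X = {N. sub N \<and> L \<inter> N = {\<zero>\<^bsub>M\<^esub>}}"
  have "\<exists>N\<in>X. \<forall>N'\<in>X. N \<subseteq> N' \<longrightarrow> N' = N"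
  proof (rule subset_Zorn_nonempty)
    have "{\<zero>\<^bsub>M\<^esub>} \<in> X"
      using sub_zero L by (auto simp: X_def sub_def)
    then show "X \<noteq> {}" by blast
    fix C assume ne: "C \<noteq> {}" and C: "subset.chain X C"
    have CX: "\<And>N. N \<in> C \<Longrightarrow> sub N \<and> L \<inter> N = {\<zero>\<^bsub>M\<^esub>}"
      and lin: "\<And>N N'. N \<in> C \<Longrightarrow> N' \<in> C \<Longrightarrow> N \<subseteq> N' \<or> N' \<subseteq> N"
      using C by (auto simp: X_def subset_chain_def)
    have "x \<oplus>\<^bsub>M\<^esub> y \<in> \<Union> C" if xy: "x \<in> \<Union> C" "y \<in> \<Union> C" for x y
    proof -
      obtain N N' where N: "N \<in> C" "x \<in> N" "N' \<in> C" "y \<in> N'" using xy by blast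
      then have "\<exists>N''\<in>C. x \<in> N'' \<and> y \<in> N''"
        using lin [OF N(1,3)] by blast
      then show ?thesis
        using CX unfolding sub_def by blast
    qed
    moreover have "\<Union> C \<subseteq> CM" "\<zero>\<^bsub>M\<^esub> \<in> \<Union> C" "\<And>p x. p \<in> free_B \<Longrightarrow> x \<in> \<Union> C \<Longrightarrow> act p x \<in> \<Union> C"
      using CX ne unfolding sub_def by blast+
    ultimately have "sub (\<Union> C)"
      unfolding sub_def by blast
    moreover have "L \<inter> \<Union> C = {\<zero>\<^bsub>M\<^esub>}"
      using CX ne by blast
    ultimately show "\<Union> C \<in> X"
      by (simp add: X_def)
  qed
  then obtain N where N: "sub N" "L \<inter> N = {\<zero>\<^bsub>M\<^esub>}" and max: "\<And>N'. sub N' \<Longrightarrow> L \<inter> N' = {\<zero>\<^bsub>M\<^esub>} \<Longrightarrow> N \<subseteq> N' \<Longrightarrow> N' = N"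
    by (auto simp: X_def)
  define S where "S = L <+>\<^bsub>M\<^esub> N"
  have S: "sub S" unfolding S_def by (rule sub_set_add [OF L N(1)])
  have Lc: "\<And>x. x \<in> L \<Longrightarrow> x \<in> CM" and Nc: "\<And>x. x \<in> N \<Longrightarrow> x \<in> CM"
    using L N by (auto simp: sub_def)
  have "S = CM"
  proof (rule prim_generate [OF O S])
    fix \<mu> u assume u: "prim \<mu> u"
    have uc: "u \<in> CM" by (rule prim_carrier [OF u])
    show "u \<in> S"
    proof (rule ccontr)
      assume uS: "u \<notin> S"
      define N' where "N' = N <+>\<^bsub>M\<^esub> cyc u"
      have N': "sub N'" unfolding N'_def by (rule sub_set_add [OF N(1) cyc_sub [OF uc]])
      have "L \<inter> N' \<subseteq> {\<zero>\<^bsub>M\<^esub>}"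
      proof
        fix x assume "x \<in> L \<inter> N'"
        then obtain n p where x: "x \<in> L" and n: "n \<in> N" and p: "p \<in> free_B" and xn: "x = n \<oplus>\<^bsub>M\<^esub> act p u"
          by (auto simp: N'_def set_add_iff cyc_def)
        \<comment> \<open>A difference of elements of \<open>L\<close> and \<open>N\<close> lies in
          \<open>S\<close>, which misses \<open>u\<close>. So \<open>act p u\<close> vanishes, and
          \<open>x = n\<close> lies in both \<open>L\<close> and \<open>N\<close>.\<close>
        have "act p u = x \<ominus>\<^bsub>M\<^esub> n"
          using Lc [OF x] Nc [OF n] p uc unfolding xn by (simp add: a_minus_def LM.M.a_ac LM.M.r_neg2)
        also have "\<dots> \<in> S"
          using x n set_add_incl [OF L N(1)] by (intro sub_minus S) (auto simp: S_def)
        finally have "act p u = \<zero>\<^bsub>M\<^esub>"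
          by (rule prim_act_disjoint [OF u S uS p])
        then have "x = n"
          using xn Nc [OF n] by simp
        then show "x \<in> {\<zero>\<^bsub>M\<^esub>}"
          using x n N(2) by blast
      qed
      moreover have "\<zero>\<^bsub>M\<^esub> \<in> L \<inter> N'"
        using L N' by (auto simp: sub_def)
      ultimately have "N' = N"
        using set_add_incl(1) [OF N(1) cyc_sub [OF uc]] by (intro max N') (auto simp: N'_def)
      moreover have "u \<in> N'"
        using set_add_incl(2) [OF N(1) cyc_sub [OF uc]] cyc_self [OF uc] by (auto simp: N'_def)
      ultimately show False
        using uS set_add_incl(2) [OF L N(1)] by (auto simp: S_def)
    qed
  qed
  with N show ?thesis
    using that by (simp add: S_def)
qed

end

section \<open>Highest weight modules\<close>

context kac_moody_data
begin

text \<open>The map sends \<open>p u\<close> to \<open>p v\<close>. It is well defined and injective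
  because both annihilators are described by the same condition on
  \<open>rho \<mu> p 1\<close>.\<close>

lemma cyclic_modules_isomorphic:
  fixes M :: "(('i, 't) boson, 'm) module" and N :: "(('i, 't) boson, 'n) module"
  assumes "boson_module D M" and "boson_module D N"
    and u: "boson_module.prim D M \<mu> u" "u \<noteq> \<zero>\<^bsub>M\<^esub>" "carrier M = boson_module.cyc D M u"
    and v: "boson_module.prim D N \<mu> v" "v \<noteq> \<zero>\<^bsub>N\<^esub>" "carrier N = boson_module.cyc D N v"
  shows "left_module_isomorphic B M N"
proof -
  interpret M: boson_module D M by fact
  interpret N: boson_module D N by fact
  have uc: "u \<in> carrier M" and vc: "v \<in> carrier N"
    using M.prim_carrier [OF u(1)] N.prim_carrier [OF v(1)] by auto
  have eq: "M.act p u = M.act r u \<longleftrightarrow> N.act p v = N.act r v" if pr: "p \<in> free_B" "r \<in> free_B" for p r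
  proof -
    have d: "p - r \<in> free_B" using pr by (rule over_diff)
    have "M.act p u = M.act (p - r) u \<oplus>\<^bsub>M\<^esub> M.act r u" "N.act p v = N.act (p - r) v \<oplus>\<^bsub>N\<^esub> N.act r v"
      using M.act_add [OF d pr(2) uc] N.act_add [OF d pr(2) vc] by simp_all
    then have "M.act p u = M.act r u \<longleftrightarrow> M.act (p - r) u = \<zero>\<^bsub>M\<^esub>"
      "N.act p v = N.act r v \<longleftrightarrow> N.act (p - r) v = \<zero>\<^bsub>N\<^esub>"
      using pr d uc vc M.LM.M.add.l_cancel_one N.LM.M.add.l_cancel_one by simp_all
    then show ?thesis
      using M.prim_act_eq_0_iff [OF u(1,2) d] N.prim_act_eq_0_iff [OF v(1,2) d] by simp
  qed
  define \<psi> where "\<psi> x = N.act (SOME p. p \<in> free_B \<and> M.act p u = x) v" for x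
  have \<psi>: "\<psi> (M.act p u) = N.act p v" if "p \<in> free_B" for p
  proof -
    have "(SOME r. r \<in> free_B \<and> M.act r u = M.act p u) \<in> free_B \<and>
        M.act (SOME r. r \<in> free_B \<and> M.act r u = M.act p u) u = M.act p u"
      by (rule someI [of _ p]) (simp add: that)
    then show ?thesis
      unfolding \<psi>_def using eq that by blast
  qed
  have Mx: "\<exists>p\<in>free_B. x = M.act p u" if "x \<in> carrier M" for x
    using that unfolding u(3) M.cyc_def by auto
  have Nx: "\<exists>p\<in>free_B. x = N.act p v" if "x \<in> carrier N" for x
    using that unfolding v(3) N.cyc_def by auto
  have "left_module_iso B M N \<psi>"
    unfolding left_module_iso_def
  proof (intro conjI ballI)
    show "bij_betw \<psi> (carrier M) (carrier N)"
    proof (rule bij_betwI')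
      fix x y assume "x \<in> carrier M" "y \<in> carrier M"
      then show "(\<psi> x = \<psi> y) = (x = y)"
        using Mx eq by (metis \<psi>)
    next
      fix x assume "x \<in> carrier M"
      then show "\<psi> x \<in> carrier N"
        using Mx [of x] \<psi> vc by auto
    next
      fix y assume "y \<in> carrier N"
      then obtain p where "p \<in> free_B" "y = N.act p v" using Nx by blast
      then show "\<exists>x\<in>carrier M. y = \<psi> x"
        using \<psi> uc by (intro bexI [of _ "M.act p u"]) simp_all
    qed
  next
    fix x y assume "x \<in> carrier M" "y \<in> carrier M"
    then obtain p r where p: "p \<in> free_B" "x = M.act p u" and r: "r \<in> free_B" "y = M.act r u"
      using Mx by blast
    then have "x \<oplus>\<^bsub>M\<^esub> y = M.act (p + r) u"
      using uc by (simp add: M.act_add)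
    then show "\<psi> (x \<oplus>\<^bsub>M\<^esub> y) = \<psi> x \<oplus>\<^bsub>N\<^esub> \<psi> y"
      using p r vc by (simp add: \<psi> over_add N.act_add)
  next
    fix a x assume "a \<in> carrier B" "x \<in> carrier M"
    then obtain p r where p: "p \<in> free_B" "x = M.act p u" and r: "r \<in> free_B" "a = cls r"
      using Mx cls_surj by blast
    then have "a \<odot>\<^bsub>M\<^esub> x = M.act (r * p) u"
      using uc by (simp add: M.act_mult flip: M.act_def)
    then show "\<psi> (a \<odot>\<^bsub>M\<^esub> x) = a \<odot>\<^bsub>N\<^esub> \<psi> x"
      using p r vc by (simp add: \<psi> over_mult N.act_mult flip: N.act_def)
  qed
  then show ?thesis
    by (auto simp: left_module_isomorphic_def)
qed

lemma H_gens_carrier: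
  "(\<lambda>i. cls (letter (E i))) ` I \<union> (\<lambda>h. cls (letter (K h) - scal (qpow (\<phi> h)))) ` Q \<subseteq> carrier B"
  by (auto intro!: cls_closed over_diff)

end

section \<open>Left ideals and quotients by them\<close>

lemma left_span_superset:
  assumes "ring R" "S \<subseteq> carrier R"
  shows "S \<subseteq> left_span R S"
proof
  interpret ring R by fact
  fix s assume s: "s \<in> S"
  then have "s \<in> carrier R" using assms(2) by auto
  then have "s = finsum R (\<lambda>s. \<one>\<^bsub>R\<^esub> \<otimes>\<^bsub>R\<^esub> s) {s}"
    by (simp add: finsum_insert)
  then show "s \<in> left_span R S"
    unfolding left_span_def using s by (intro CollectI exI [of _ "{s}"] exI [of _ "\<lambda>_. \<one>\<^bsub>R\<^esub>"]) auto
qed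

lemma left_span_least:
  assumes "ring R" "S \<subseteq> carrier R" "x \<in> left_span R S"
    and "\<zero>\<^bsub>R\<^esub> \<in> X" "\<And>x y. x \<in> X \<Longrightarrow> y \<in> X \<Longrightarrow> x \<oplus>\<^bsub>R\<^esub> y \<in> X"
    and "\<And>b s. b \<in> carrier R \<Longrightarrow> s \<in> S \<Longrightarrow> b \<otimes>\<^bsub>R\<^esub> s \<in> X"
  shows "x \<in> X"
proof -
  interpret ring R by fact
  obtain A c where A: "finite A" "A \<subseteq> S" and c: "c \<in> A \<rightarrow> carrier R"
    and x: "x = finsum R (\<lambda>s. c s \<otimes>\<^bsub>R\<^esub> s) A"
    using assms(3) by (auto simp: left_span_def)
  have "finsum R (\<lambda>s. c s \<otimes>\<^bsub>R\<^esub> s) A \<in> X"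
    using A c
  proof (induction A rule: finite_induct)
    case (insert s A)
    then have "finsum R (\<lambda>s. c s \<otimes>\<^bsub>R\<^esub> s) (insert s A) = c s \<otimes>\<^bsub>R\<^esub> s \<oplus>\<^bsub>R\<^esub> finsum R (\<lambda>s. c s \<otimes>\<^bsub>R\<^esub> s) A"
      using assms(2) by (intro finsum_insert) auto
    with insert show ?case by (simp add: assms(5,6))
  qed (simp add: assms(4))
  then show ?thesis by (simp add: x)
qed

lemma left_span_add:
  assumes "ring R" "S \<subseteq> carrier R" "x \<in> left_span R S" "y \<in> left_span R S"
  shows "x \<oplus>\<^bsub>R\<^esub> y \<in> left_span R S"
proof -
  interpret ring R by fact
  obtain A c where A: "finite A" "A \<subseteq> S" and c: "c \<in> A \<rightarrow> carrier R"
    and x: "x = finsum R (\<lambda>s. c s \<otimes>\<^bsub>R\<^esub> s) A"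
    using assms(3) by (auto simp: left_span_def)
  obtain A' c' where A': "finite A'" "A' \<subseteq> S" and c': "c' \<in> A' \<rightarrow> carrier R"
    and y: "y = finsum R (\<lambda>s. c' s \<otimes>\<^bsub>R\<^esub> s) A'"
    using assms(4) by (auto simp: left_span_def)
  \<comment> \<open>Padding with zero coefficients brings both combinations to the common support
    \<open>A \<union> A'\<close>.\<close>
  define d where "d s = (if s \<in> A then c s else \<zero>\<^bsub>R\<^esub>)" for s
  define d' where "d' s = (if s \<in> A' then c' s else \<zero>\<^bsub>R\<^esub>)" for s
  have dc: "d s \<in> carrier R" "d' s \<in> carrier R" for s
    using c c' by (auto simp: d_def d'_def)
  have S: "s \<in> carrier R" if "s \<in> A \<union> A'" for s
    using that A A' assms(2) by auto
  have "x = finsum R (\<lambda>s. d s \<otimes>\<^bsub>R\<^esub> s) (A \<union> A')"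
    unfolding x using A A' S dc by (intro add.finprod_mono_neutral_cong_left) (use c in \<open>auto simp: d_def Pi_def\<close>)
  moreover have "y = finsum R (\<lambda>s. d' s \<otimes>\<^bsub>R\<^esub> s) (A \<union> A')"
    unfolding y using A A' S dc by (intro add.finprod_mono_neutral_cong_left) (use c' in \<open>auto simp: d'_def Pi_def\<close>)
  moreover have "finsum R (\<lambda>s. d s \<otimes>\<^bsub>R\<^esub> s) (A \<union> A') \<oplus>\<^bsub>R\<^esub> finsum R (\<lambda>s. d' s \<otimes>\<^bsub>R\<^esub> s) (A \<union> A')
      = finsum R (\<lambda>s. d s \<otimes>\<^bsub>R\<^esub> s \<oplus>\<^bsub>R\<^esub> d' s \<otimes>\<^bsub>R\<^esub> s) (A \<union> A')"
    using S dc by (intro finsum_addf [symmetric]) auto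
  moreover have "\<dots> = finsum R (\<lambda>s. (d s \<oplus>\<^bsub>R\<^esub> d' s) \<otimes>\<^bsub>R\<^esub> s) (A \<union> A')"
    using S dc by (intro finsum_cong') (auto simp: l_distr)
  ultimately have "x \<oplus>\<^bsub>R\<^esub> y = finsum R (\<lambda>s. (d s \<oplus>\<^bsub>R\<^esub> d' s) \<otimes>\<^bsub>R\<^esub> s) (A \<union> A')"
    by simp
  then show ?thesis
    unfolding left_span_def using A A' dc
    by (intro CollectI exI [of _ "A \<union> A'"] exI [of _ "\<lambda>s. d s \<oplus>\<^bsub>R\<^esub> d' s"]) auto
qed

lemma left_span_mult:
  assumes "ring R" "S \<subseteq> carrier R" "x \<in> left_span R S" "b \<in> carrier R"
  shows "b \<otimes>\<^bsub>R\<^esub> x \<in> left_span R S"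
proof -
  interpret ring R by fact
  obtain A c where A: "finite A" "A \<subseteq> S" and c: "c \<in> A \<rightarrow> carrier R"
    and x: "x = finsum R (\<lambda>s. c s \<otimes>\<^bsub>R\<^esub> s) A"
    using assms(3) by (auto simp: left_span_def)
  have S: "s \<in> carrier R" if "s \<in> A" for s
    using that A assms(2) by auto
  have "b \<otimes>\<^bsub>R\<^esub> x = finsum R (\<lambda>s. b \<otimes>\<^bsub>R\<^esub> (c s \<otimes>\<^bsub>R\<^esub> s)) A"
    unfolding x using A c S assms(4) by (intro finsum_rdistr) auto
  also have "\<dots> = finsum R (\<lambda>s. (b \<otimes>\<^bsub>R\<^esub> c s) \<otimes>\<^bsub>R\<^esub> s) A"
    using c S assms(4) by (intro finsum_cong') (auto simp: m_assoc Pi_def)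
  finally show ?thesis
    unfolding left_span_def using A c assms(4)
    by (intro CollectI exI [of _ A] exI [of _ "\<lambda>s. b \<otimes>\<^bsub>R\<^esub> c s"]) auto
qed

lemma left_span_carrier:
  assumes "ring R" "S \<subseteq> carrier R"
  shows "left_span R S \<subseteq> carrier R"
proof
  interpret ring R by fact
  fix x assume "x \<in> left_span R S"
  then show "x \<in> carrier R"
    using assms(2) by (intro left_span_least [OF assms, of x "carrier R"]) auto
qed

lemma left_span_zero: "\<zero>\<^bsub>R\<^esub> \<in> left_span R S" if "ring R"
proof -
  interpret ring R by fact
  show ?thesis
    unfolding left_span_def by (intro CollectI exI [of _ "{}"] exI [of _ "\<lambda>_. \<zero>\<^bsub>R\<^esub>"]) auto
qed

lemma left_span_additive_subgroup:
  assumes "ring R" "S \<subseteq> carrier R"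
  shows "abelian_subgroup (left_span R S) R"
proof -
  interpret ring R by fact
  have inv: "\<ominus>\<^bsub>R\<^esub> x \<in> left_span R S" if x: "x \<in> left_span R S" for x
  proof -
    have "(\<ominus>\<^bsub>R\<^esub> \<one>\<^bsub>R\<^esub>) \<otimes>\<^bsub>R\<^esub> x \<in> left_span R S"
      by (intro left_span_mult assms x) simp
    then show ?thesis
      using left_span_carrier [OF assms] x by (auto simp: l_minus)
  qed
  have "subgroup (left_span R S) (add_monoid R)"
    using left_span_carrier [OF assms] left_span_add [OF assms] left_span_zero [OF assms(1)] inv
    by unfold_locales (auto simp: a_inv_def)
  then show ?thesis
    by (intro abelian_subgroupI3 additive_subgroupI is_abelian_group)
qed

locale left_ideal_quotient = ring R for R :: "'a ring" +
  fixes N :: "'a set"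
  assumes N_subgroup: "abelian_subgroup N R"
    and N_left: "\<And>a x. a \<in> carrier R \<Longrightarrow> x \<in> N \<Longrightarrow> a \<otimes>\<^bsub>R\<^esub> x \<in> N"
begin

interpretation N: abelian_subgroup N R by (rule N_subgroup)

abbreviation "QM \<equiv> quotient_module (regular_module R) N"

definition proj :: "'a \<Rightarrow> 'a set" where
  "proj x = N +>\<^bsub>R\<^esub> x"

lemma QM_carrier: "carrier QM = proj ` carrier R"
  by (auto simp: quotient_module_def regular_module_def A_RCOSETS_def' a_r_coset_def' proj_def)

lemma QM_zero: "zero QM = N"
  by (simp add: quotient_module_def)

lemma QM_add: "x \<in> carrier R \<Longrightarrow> y \<in> carrier R \<Longrightarrow> proj x \<oplus>\<^bsub>QM\<^esub> proj y = proj (x \<oplus>\<^bsub>R\<^esub> y)"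
  using N.a_rcos_sum [of x y]
  by (simp add: quotient_module_def regular_module_def proj_def set_add_def')

lemma proj_zero: "proj \<zero>\<^bsub>R\<^esub> = N"
  unfolding proj_def using N.a_subset by simp

lemma proj_eq_zero_iff: "x \<in> carrier R \<Longrightarrow> proj x = N \<longleftrightarrow> x \<in> N"
  unfolding proj_def using N.a_rcos_const N.a_rcos_self by blast

text \<open>By the left ideal property all cosets in the defining union are equal, so the union is a
  single coset.\<close>

lemma QM_smult: "a \<in> carrier R \<Longrightarrow> x \<in> carrier R \<Longrightarrow> a \<odot>\<^bsub>QM\<^esub> proj x = proj (a \<otimes>\<^bsub>R\<^esub> x)"
proof -
  assume a: "a \<in> carrier R" and x: "x \<in> carrier R"
  have "N +>\<^bsub>R\<^esub> (a \<otimes>\<^bsub>R\<^esub> y) = N +>\<^bsub>R\<^esub> (a \<otimes>\<^bsub>R\<^esub> x)" if y: "y \<in> N +>\<^bsub>R\<^esub> x" for y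
  proof -
    obtain n where n: "n \<in> N" "y = n \<oplus>\<^bsub>R\<^esub> x"
      using y by (auto simp: a_r_coset_def')
    then have "a \<otimes>\<^bsub>R\<^esub> y = a \<otimes>\<^bsub>R\<^esub> n \<oplus>\<^bsub>R\<^esub> a \<otimes>\<^bsub>R\<^esub> x"
      using a x by (simp add: r_distr)
    also have "\<dots> \<in> N +>\<^bsub>R\<^esub> (a \<otimes>\<^bsub>R\<^esub> x)"
      using N_left [OF a n(1)] by (auto simp: a_r_coset_def')
    finally show ?thesis
      using a x by (intro N.a_repr_independence' [symmetric]) auto
  qed
  moreover have "x \<in> N +>\<^bsub>R\<^esub> x"
    by (rule N.a_rcos_self [OF x])
  ultimately have "(\<Union>y\<in>N +>\<^bsub>R\<^esub> x. N +>\<^bsub>R\<^esub> (a \<otimes>\<^bsub>R\<^esub> y)) = N +>\<^bsub>R\<^esub> (a \<otimes>\<^bsub>R\<^esub> x)"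
    by blast
  then show ?thesis
    by (simp add: quotient_module_def regular_module_def proj_def a_r_coset_def')
qed

lemma QM_left_module: "left_module R QM"
proof -
  have zc: "\<zero>\<^bsub>QM\<^esub> = proj \<zero>\<^bsub>R\<^esub>"
    by (simp add: QM_zero proj_zero)
  have "abelian_group QM"
  proof (rule abelian_groupI)
    fix x assume "x \<in> carrier QM"
    then obtain y where "y \<in> carrier R" "x = proj y" by (auto simp: QM_carrier)
    then show "\<exists>z\<in>carrier QM. z \<oplus>\<^bsub>QM\<^esub> x = \<zero>\<^bsub>QM\<^esub>"
      by (intro bexI [of _ "proj (\<ominus>\<^bsub>R\<^esub> y)"]) (auto simp: QM_add zc l_neg QM_carrier)
  qed (auto simp: QM_carrier QM_add zc a_ac)
  then show ?thesis
    by (intro left_module.intro left_module_axioms.intro ring_axioms)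
      (auto simp: QM_carrier QM_add QM_smult l_distr r_distr m_assoc)
qed

end

section \<open>The highest weight module of a given weight\<close>

locale boson_highest = kac_moody_data D for D :: "('i, 't::ab_group_add) cartan_data" +
  fixes \<phi> :: "'t \<Rightarrow> rat"
  assumes weight: "\<phi> \<in> weight_lattice D"
begin

abbreviation "H \<equiv> H_module D \<phi>"

lemma H_ideal_eq: "H_ideal D \<phi> = left_span B
    ((\<lambda>i. cls (letter (E i))) ` I \<union> (\<lambda>h. cls (letter (K h) - scal (qpow (\<phi> h)))) ` Q)"
  by (simp add: H_ideal_def)

sublocale LQ: left_ideal_quotient B "H_ideal D \<phi>"
proof (intro left_ideal_quotient.intro left_ideal_quotient_axioms.intro B_ring)
  show "abelian_subgroup (H_ideal D \<phi>) B"
    unfolding H_ideal_eq by (intro left_span_additive_subgroup B_ring H_gens_carrier)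
  show "a \<otimes>\<^bsub>B\<^esub> x \<in> H_ideal D \<phi>" if "a \<in> carrier B" "x \<in> H_ideal D \<phi>" for a x
    using that unfolding H_ideal_eq by (intro left_span_mult B_ring H_gens_carrier)
qed

lemma H_module_eq: "H = LQ.QM"
  by (simp add: H_module_def)

sublocale HM: boson_module D H
  using LQ.QM_left_module unfolding H_module_eq
  by (intro boson_module.intro boson_module_axioms.intro kac_moody_data_axioms)

lemma H_carrier: "carrier H = LQ.proj ` carrier B"
  unfolding H_module_eq by (rule LQ.QM_carrier)

lemma H_smult: "a \<in> carrier B \<Longrightarrow> x \<in> carrier B \<Longrightarrow> a \<odot>\<^bsub>H\<^esub> LQ.proj x = LQ.proj (a \<otimes>\<^bsub>B\<^esub> x)"
  unfolding H_module_eq by (rule LQ.QM_smult)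

definition u0 :: "('i, 't) boson set" where
  "u0 = LQ.proj \<one>\<^bsub>B\<^esub>"

lemma u0_carrier: "u0 \<in> carrier H"
  by (simp add: u0_def H_carrier)

lemma act_u0: "p \<in> free_B \<Longrightarrow> HM.act p u0 = LQ.proj (cls p)"
  unfolding HM.act_def u0_def by (simp add: H_smult cls_closed)

lemma H_zero: "\<zero>\<^bsub>H\<^esub> = H_ideal D \<phi>"
  by (simp add: H_module_eq LQ.QM_zero)

lemma act_u0_eq_0: "p \<in> free_B \<Longrightarrow> cls p \<in> H_ideal D \<phi> \<Longrightarrow> HM.act p u0 = \<zero>\<^bsub>H\<^esub>"
  by (simp add: act_u0 H_zero LQ.proj_eq_zero_iff cls_closed)

lemma H_ideal_gen: "s \<in> (\<lambda>i. cls (letter (E i))) ` I \<union> (\<lambda>h. cls (letter (K h) - scal (qpow (\<phi> h)))) ` Q \<Longrightarrow>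
    s \<in> H_ideal D \<phi>"
  unfolding H_ideal_eq using left_span_superset [OF B_ring H_gens_carrier] by blast

lemma prim_u0: "HM.prim \<phi> u0"
  unfolding HM.prim_def HM.weight_space_act
proof (intro conjI ballI weight u0_carrier)
  fix h assume h: "h \<in> Q"
  let ?T = "letter (K h) - scal (qpow (\<phi> h))"
  have T: "?T \<in> free_B" using h by (intro over_diff) simp_all
  have "HM.act (letter (K h)) u0 = HM.act (?T + scal (qpow (\<phi> h))) u0"
    by simp
  also have "\<dots> = HM.act ?T u0 \<oplus>\<^bsub>H\<^esub> HM.act (scal (qpow (\<phi> h))) u0"
    using T u0_carrier by (intro HM.act_add) simp_all
  also have "HM.act ?T u0 = \<zero>\<^bsub>H\<^esub>"
    using h by (intro act_u0_eq_0 T H_ideal_gen) auto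
  finally show "HM.act (letter (K h)) u0 = HM.act (scal (qpow (\<phi> h))) u0"
    using u0_carrier by simp
next
  fix i assume "i \<in> I"
  then show "HM.act (letter (E i)) u0 = \<zero>\<^bsub>H\<^esub>"
    by (intro act_u0_eq_0 H_ideal_gen) auto
qed

lemma H_cyc: "carrier H = HM.cyc u0"
proof -
  have "carrier B = cls ` free_B"
    using cls_surj cls_closed by blast
  then show ?thesis
    unfolding HM.cyc_def by (simp add: H_carrier image_image act_u0 cong: image_cong)
qed

text \<open>Under \<open>rho\<close> the generators of the left ideal annihilate \<open>1\<close>,
  and so do their left multiples. Asking merely for some representative \<open>p\<close> avoids a
  well-definedness argument here.\<close>

lemma H_ideal_rho: "b \<in> H_ideal D \<phi> \<Longrightarrow> \<exists>p\<in>free_B. b = cls p \<and> rho \<phi> p 1 \<in> SD.serre_ideal"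
proof -
  assume b: "b \<in> H_ideal D \<phi>"
  let ?X = "{b. \<exists>p\<in>free_B. b = cls p \<and> rho \<phi> p 1 \<in> SD.serre_ideal}"
  have "b \<in> ?X"
  proof (rule left_span_least [OF B_ring H_gens_carrier b [unfolded H_ideal_eq]])
    show "\<zero>\<^bsub>B\<^esub> \<in> ?X"
      using cls_0 by (auto intro!: bexI [of _ 0] simp: lin_0 [OF lin_rho_left] SD.serre_ideal.zero)
    show "x \<oplus>\<^bsub>B\<^esub> y \<in> ?X" if xy: "x \<in> ?X" "y \<in> ?X" for x y
    proof -
      obtain p r where "p \<in> free_B" "x = cls p" "rho \<phi> p 1 \<in> SD.serre_ideal"
        "r \<in> free_B" "y = cls r" "rho \<phi> r 1 \<in> SD.serre_ideal"
        using xy by blast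
      then show ?thesis
        by (auto intro!: bexI [of _ "p + r"] simp: cls_add over_add lin_add [OF lin_rho_left] SD.serre_ideal.add)
    qed
    fix a s assume a: "a \<in> carrier B"
      and s: "s \<in> (\<lambda>i. cls (letter (E i))) ` I \<union> (\<lambda>h. cls (letter (K h) - scal (qpow (\<phi> h)))) ` Q"
    obtain p where p: "p \<in> free_B" "a = cls p" using cls_surj [OF a] by blast
    obtain t where t: "t \<in> free_B" "s = cls t" "rho \<phi> t 1 = 0"
    proof -
      from s consider i where "i \<in> I" "s = cls (letter (E i))"
        | h where "h \<in> Q" "s = cls (letter (K h) - scal (qpow (\<phi> h)))" by blast
      then show thesis
      proof cases
        case 1
        then show thesis by (intro that [of "letter (E i)"]) simp_all
      next
        case 2
        have "kop \<phi> h 1 = qs \<lfloor>\<phi> h\<rfloor>"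
          using kop_wmon [of \<phi> h "[]"] by simp
        with 2 show thesis
          by (intro that [of "letter (K h) - scal (qpow (\<phi> h))"])
            (auto simp: lin_diff [OF lin_rho_left] qpow_def intro!: over_diff)
      qed
    qed
    have "rho \<phi> (p * t) 1 = 0"
      by (simp add: rho_mult t lin_0 [OF lin_rho_right])
    then show "a \<otimes>\<^bsub>B\<^esub> s \<in> ?X"
      using p t by (auto intro!: bexI [of _ "p * t"] simp: cls_mult over_mult SD.serre_ideal.zero)
  qed
  then show ?thesis by simp
qed

text \<open>Otherwise the unit is the class of some \<open>p\<close> with
  \<open>rho \<phi> p 1\<close> in the Serre ideal. As \<open>1 - p\<close> acts into the ideal by
  \<open>rho_BI\<close>, the constant \<open>1\<close> would lie in it.\<close>

lemma u0_nonzero: "u0 \<noteq> \<zero>\<^bsub>H\<^esub>"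
proof
  assume "u0 = \<zero>\<^bsub>H\<^esub>"
  then have "\<one>\<^bsub>B\<^esub> \<in> H_ideal D \<phi>"
    by (simp add: u0_def H_zero LQ.proj_eq_zero_iff)
  then obtain p where p: "p \<in> free_B" "\<one>\<^bsub>B\<^esub> = cls p" and r: "rho \<phi> p 1 \<in> SD.serre_ideal"
    using H_ideal_rho by blast
  have "cls (1 - p) = cls 1 \<oplus>\<^bsub>B\<^esub> cls (- p)"
    using cls_add [of 1 "- p"] p by (simp add: over_minus)
  also have "\<dots> = \<zero>\<^bsub>B\<^esub>"
    using p by (simp add: cls_1 cls_minus cls_closed LQ.r_neg)
  finally have "1 - p \<in> BI"
    using cls_0_iff [of "1 - p"] p by (simp add: over_diff)
  then have "rho \<phi> (1 - p) 1 \<in> SD.serre_ideal"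
    by (intro rho_BI weight) simp_all
  then have "rho \<phi> (1 - p) 1 + rho \<phi> p 1 \<in> SD.serre_ideal"
    using r by (rule SD.serre_ideal.add)
  then have "(scal 1 :: ('i, 't) boson_free) \<in> SD.serre_ideal"
    by (simp add: lin_diff [OF lin_rho_left])
  then show False
    by (simp only: SD.scal_in_serre_ideal)
qed

lemma H_category_O: "H \<in> category_O D"
  by (rule HM.cyc_category_O [OF prim_u0 H_cyc])

text \<open>A submodule containing \<open>u0\<close> is everything; one missing \<open>u0\<close>
  meets the module generated by \<open>u0\<close> trivially, and that module is everything.\<close>

lemma H_simple: "simple_object B (category_O D) H"
  unfolding simple_object_def
proof (intro conjI allI impI H_category_O)
  show "carrier H \<noteq> {\<zero>\<^bsub>H\<^esub>}"
    using u0_carrier u0_nonzero by auto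
  fix L assume "submodule L B H \<and> H\<lparr>carrier := L\<rparr> \<in> category_O D"
  then have L: "HM.sub L"
    by (simp add: HM.submodule_iff_sub)
  show "L = {\<zero>\<^bsub>H\<^esub>} \<or> L = carrier H"
  proof (cases "u0 \<in> L")
    case True
    then have "HM.cyc u0 \<subseteq> L"
      using L by (auto simp: HM.cyc_def HM.sub_def)
    then show ?thesis
      using L H_cyc by (auto simp: HM.sub_def)
  next
    case False
    have "x = \<zero>\<^bsub>H\<^esub>" if "x \<in> L" for x
    proof -
      have "x \<in> HM.cyc u0"
        using that L H_cyc by (auto simp: HM.sub_def)
      then obtain p where "p \<in> free_B" "x = HM.act p u0"
        by (auto simp: HM.cyc_def)
      then show ?thesis
        using HM.prim_act_disjoint [OF prim_u0 L False] that by simp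
    qed
    then show ?thesis
      using L by (auto simp: HM.sub_def)
  qed
qed

end

section \<open>The subalgebra generated by the \<open>f_i\<close> and freeness\<close>

context kac_moody_data
begin

text \<open>Constants and the \<open>f_i\<close> are the only generators, so every element of
  \<open>B^-\<close> has a representative without \<open>E\<close> and \<open>K\<close>, to which
  the theory of words applies.\<close>

lemma boson_minus_carrier: "carrier (boson_minus D) = cls ` free_F"
proof -
  let ?G = "range (\<lambda>c. cls (scal c)) \<union> (\<lambda>i. cls (letter (F i))) ` I"
  have "b \<in> cls ` free_F" if "b \<in> generate_ring B ?G" for b
    using that
  proof (induction rule: generate_ring.induct)
    case one
    show ?case by (rule image_eqI [of _ _ 1]) (simp_all add: cls_1)
  next
    case (incl h)
    then show ?case by auto
  next
    case (a_inv h)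
    then obtain p where "p \<in> free_F" "h = cls p" by blast
    then show ?case
      by (intro image_eqI [of _ _ "- p"]) (simp_all add: cls_minus over_F over_minus)
  next
    case (eng_add h1 h2)
    then obtain p r where "p \<in> free_F" "h1 = cls p" "r \<in> free_F" "h2 = cls r" by blast
    then show ?case
      by (intro image_eqI [of _ _ "p + r"]) (simp_all add: cls_add over_F over_add)
  next
    case (eng_mult h1 h2)
    then obtain p r where "p \<in> free_F" "h1 = cls p" "r \<in> free_F" "h2 = cls r" by blast
    then show ?case
      by (intro image_eqI [of _ _ "p * r"]) (simp_all add: cls_mult over_F over_mult)
  qed
  moreover have "p \<in> free_F \<and> cls p \<in> generate_ring B ?G" if "p \<in> free_F" for p
    using that
  proof (induction rule: over_induct)
    case zero
    have "cls (scal 0) \<in> generate_ring B ?G"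
      by (rule generate_ring.incl) blast
    then show ?case by simp
  next
    case (add p r)
    then show ?case by (simp add: cls_add over_F over_add generate_ring.eng_add)
  next
    case (word c w)
    have "cls (wmon w) \<in> generate_ring B ?G"
      using word
    proof (induction w)
      case Nil
      then show ?case by (simp add: cls_1 generate_ring.one)
    next
      case (Cons g w)
      then obtain i where i: "g = F i" "i \<in> I" by auto
      have "cls (letter (F i)) \<in> generate_ring B ?G"
        using i by (intro generate_ring.incl) blast
      then show ?case
        using Cons i over_F [of "wmon w"] by (simp add: wmon_Cons cls_mult generate_ring.eng_mult)
    qed
    moreover have "cls (scal c) \<in> generate_ring B ?G"
      by (rule generate_ring.incl) blast
    ultimately show ?case
      using word over_F [of "wmon w"] by (simp add: cls_mult over_scal_mult generate_ring.eng_mult)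
  qed
  ultimately show ?thesis
    unfolding boson_minus_def by auto
qed

lemma boson_minus_ring: "ring (boson_minus D)"
  unfolding boson_minus_def
  by (rule ring.generate_ring_is_ring [OF B_ring]) (auto intro!: cls_closed)

lemma boson_minus_simps [simp]: "mult (boson_minus D) = mult B" "add (boson_minus D) = add B"
  "one (boson_minus D) = one B" "zero (boson_minus D) = zero B"
  by (simp_all add: boson_minus_def)

lemma boson_minus_incl: "b \<in> carrier (boson_minus D) \<Longrightarrow> b \<in> carrier B"
  using over_F by (auto simp: boson_minus_carrier intro: cls_closed)

end

context boson_highest
begin

lemma H_left_module_minus: "left_module (boson_minus D) H"
  using boson_minus_incl
  by (intro left_module.intro left_module_axioms.intro boson_minus_ring HM.LM.M.abelian_group_axioms)
    (simp_all add: HM.LM.smult_closed HM.LM.smult_l_distr HM.LM.smult_r_distr HM.LM.smult_assoc HM.LM.smult_one)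

text \<open>The basis is \<open>u0\<close>. Coefficients exist because words in the
  \<open>f_i\<close> already exhaust the module; they are unique because an element of
  \<open>B^-\<close> killing \<open>u0\<close> comes from the Serre ideal and so vanishes in
  \<open>B\<close>.\<close>

lemma H_free: "free_of_rank (boson_minus D) H 1"
  unfolding free_of_rank_def
proof (intro conjI exI [of _ "{u0}"] ballI H_left_module_minus)
  show "finite {u0}" "card {u0} = 1" "{u0} \<subseteq> carrier H"
    using u0_carrier by simp_all
  fix x assume "x \<in> carrier H"
  then obtain y where y: "y \<in> free_F" and x: "x = HM.act y u0"
    using HM.cyc_F [OF prim_u0] H_cyc by blast
  have sum: "finsum H (\<lambda>s. c s \<odot>\<^bsub>H\<^esub> s) {u0} = c u0 \<odot>\<^bsub>H\<^esub> u0" if "c u0 \<in> carrier (boson_minus D)" for c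
    using that boson_minus_incl u0_carrier
    by (subst HM.LM.M.finsum_insert) (auto simp: HM.LM.smult_closed)
  show "\<exists>!c. c \<in> {u0} \<rightarrow>\<^sub>E carrier (boson_minus D) \<and> x = finsum H (\<lambda>s. c s \<odot>\<^bsub>H\<^esub> s) {u0}"
  proof (rule ex1I [of _ "\<lambda>s\<in>{u0}. cls y"])
    have "cls y \<in> carrier (boson_minus D)"
      using y by (simp add: boson_minus_carrier)
    then show "(\<lambda>s\<in>{u0}. cls y) \<in> {u0} \<rightarrow>\<^sub>E carrier (boson_minus D) \<and>
        x = finsum H (\<lambda>s. (\<lambda>s\<in>{u0}. cls y) s \<odot>\<^bsub>H\<^esub> s) {u0}"
      using sum [of "\<lambda>s\<in>{u0}. cls y"] by (simp add: x HM.act_def)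
  next
    fix c assume c: "c \<in> {u0} \<rightarrow>\<^sub>E carrier (boson_minus D) \<and> x = finsum H (\<lambda>s. c s \<odot>\<^bsub>H\<^esub> s) {u0}"
    then have cu: "c u0 \<in> carrier (boson_minus D)" by auto
    then obtain z where z: "z \<in> free_F" and cz: "c u0 = cls z"
      by (auto simp: boson_minus_carrier)
    have "HM.act z u0 = HM.act y u0"
      using c sum [of c] cu x by (simp add: cz HM.act_def)
    then have "HM.act (z - y) u0 = \<zero>\<^bsub>H\<^esub>"
      using y z u0_carrier by (simp add: HM.act_diff over_F a_minus_def HM.LM.M.r_neg)
    then have "rho \<phi> (z - y) 1 \<in> SD.serre_ideal"
      using HM.prim_act_eq_0_iff [OF prim_u0 u0_nonzero, of "z - y"] y z by (simp add: over_F over_diff)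
    then have "z - y \<in> SD.serre_ideal"
      using rho_F [of "z - y" \<phi> 1] y z by (simp add: over_diff)
    then have "z - y \<in> BI"
      using y z by (intro serre_ideal_F_BI over_diff)
    then have "cls z = cls y"
      using y z by (intro cls_eq over_F)
    then show "c = (\<lambda>s\<in>{u0}. cls y)"
      using c cz by (auto simp: PiE_def extensional_def fun_eq_iff)
  qed
qed

end

theorem theorem6p1:
  fixes D :: "('i, 't::ab_group_add) cartan_data"
  assumes "kac_moody_data D"
  shows "semisimple_category (boson_algebra D)
           (category_O D :: (('i, 't) boson, 'm) module set)
       \<and> (\<forall>\<phi>\<in>weight_lattice D. simple_object (boson_algebra D) (category_O D) (H_module D \<phi>))
       \<and> (\<forall>M :: (('i, 't) boson, 'm) module.
            simple_object (boson_algebra D) (category_O D) M \<longrightarrow>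
            (\<exists>\<phi>\<in>weight_lattice D.
               left_module_isomorphic (boson_algebra D) M (H_module D \<phi>)))
       \<and> (\<forall>\<phi>\<in>weight_lattice D. free_of_rank (boson_minus D) (H_module D \<phi>) 1)"
proof (intro conjI ballI allI impI)
  interpret kac_moody_data D by fact
  have bm: "boson_module D M" if "M \<in> category_O D" for M :: "(('i, 't) boson, 'm) module"
    using that by (intro boson_module.intro boson_module_axioms.intro assms) (simp add: category_O_def)
  have bh: "boson_highest D \<phi>" if "\<phi> \<in> weight_lattice D" for \<phi>
    using that by (intro boson_highest.intro boson_highest_axioms.intro assms)
  show "semisimple_category (boson_algebra D) (category_O D :: (('i, 't) boson, 'm) module set)"
    unfolding semisimple_category_def
  proof (intro ballI allI impI)
    fix M :: "(('i, 't) boson, 'm) module" and L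
    assume M: "M \<in> category_O D" and L: "submodule L (boson_algebra D) M \<and> M\<lparr>carrier := L\<rparr> \<in> category_O D"
    interpret boson_module D M by (rule bm [OF M])
    show "\<exists>N. submodule N (boson_algebra D) M \<and> L \<inter> N = {\<zero>\<^bsub>M\<^esub>} \<and> L <+>\<^bsub>M\<^esub> N = carrier M"
      using complement_exists [OF M, of L] L unfolding submodule_iff_sub by metis
  qed
  fix \<phi> assume \<phi>: "\<phi> \<in> weight_lattice D"
  show "simple_object (boson_algebra D) (category_O D) (H_module D \<phi>)"
    by (rule boson_highest.H_simple [OF bh [OF \<phi>]])
  show "free_of_rank (boson_minus D) (H_module D \<phi>) 1"
    by (rule boson_highest.H_free [OF bh [OF \<phi>]])
next
  fix M :: "(('i, 't) boson, 'm) module"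
  assume M: "simple_object (boson_algebra D) (category_O D) M"
  interpret kac_moody_data D by fact
  interpret boson_module D M
    using M by (intro boson_module.intro boson_module_axioms.intro assms)
      (simp add: simple_object_def category_O_def)
  obtain \<mu> u where u: "prim \<mu> u" "u \<noteq> \<zero>\<^bsub>M\<^esub>" "carrier M = cyc u"
    by (rule simple_generator [OF M])
  have \<mu>: "\<mu> \<in> weight_lattice D"
    using u(1) by (simp add: prim_def)
  interpret Hmu: boson_highest D \<mu>
    using \<mu> by (intro boson_highest.intro boson_highest_axioms.intro assms)
  \<comment> \<open>Both \<open>M\<close> and \<open>H_module D \<mu>\<close> are generated by a
    nonzero primitive vector of weight \<mu>.\<close>
  show "\<exists>\<phi>\<in>weight_lattice D. left_module_isomorphic (boson_algebra D) M (H_module D \<phi>)"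
    using cyclic_modules_isomorphic [OF boson_module_axioms Hmu.HM.boson_module_axioms u
        Hmu.prim_u0 Hmu.u0_nonzero Hmu.H_cyc] \<mu> by blast
qed

end
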